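(* (Evolution contact Tulczyjew triple.) Let $\mathcal{Q}$ be a smooth manifold, $\mathcal{M}=T^*\mathcal{Q}\times\mathbb{R}$ with contact form $\eta=\eta_{\mathcal{Q}}=dz-p_idq^i$ and Reeb vector field $\mathcal{R}=\partial/\partial z$, let $H\mathcal{M}=\ker\eta\subset T\mathcal{M}$, and let $\omega_\eta$ be the symplectic form on $H\mathcal{M}\times\mathbb{R}$ defined in the context. Then the maps $$\beta^0:H\mathcal{M}\times\mathbb{R}\to T^*\mathcal{M},\qquad (V,u)\mapsto-\iota_Vd\eta-u\,\eta,$$ and $$\alpha^0:H\mathcal{M}\times\mathbb{R}\to T^*(T\mathcal{Q}\times\mathbb{R}),\qquad \alpha^0(q^i,p_i,z,\dot q^i,\dot p_i,u)=(q^i,\dot q^i,z,\,up_i+\dot p_i,\,p_i,\,-u),$$ are symplectic diffeomorphisms from $(H\mathcal{M}\times\mathbb{R},\omega_\eta)$ onto $T^*\mathcal{M}$ and $T^*(T\mathcal{Q}\times\mathbb{R})$, respectively, endowed with their canonical symplectic forms. They are fibered over $\mathcal{M}$ (via $(V,u)\mapsto$ base point of $V$) and over $T\mathcal{Q}\times\mathbb{R}$ (via $(q^i,p_i,z,\dot q^i,\dot p_i,u)\mapsto(q^i,\dot q^i,z)$), respectively. Moreover, for every smooth function $H:\mathcal{M}\to\mathbb{R}$ with evolution vector field $\varepsilon_H$, $$\beta^0\circ(\varepsilon_H,\mathcal{R}(H))=-dH,$$ and the image of $(\varepsilon_H,\mathcal{R}(H)):\mathcal{M}\to H\mathcal{M}\times\mathbb{R}$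 is a Lagrangian submanifold of $(H\mathcal{M}\times\mathbb{R},\omega_\eta)$.
   Context: For a contact manifold $(\mathcal{M},\eta)$ (dimension $2n+1$, $\eta\wedge(d\eta)^n$ nowhere zero) with Reeb vector field $\mathcal{R}$ ($\iota_{\mathcal{R}}\eta=1$, $\iota_{\mathcal{R}}d\eta=0$), the evolution vector field $\varepsilon_H$ of a smooth function $H$ is the vector field determined by $\mathcal{L}_{\varepsilon_H}\eta=dH-\mathcal{R}(H)\eta$ and $\eta(\varepsilon_H)=0$. The tangent contact form on $T\mathcal{M}\times\mathbb{R}$ is $\eta^{\mathcal{T}}=u\,\eta^V+\eta^C$, where $u$ is the coordinate on $\mathbb{R}$ and, for $\eta=\eta_idx^i$, $\eta^V=\eta_idx^i$ and $\eta^C=\dot x^j\frac{\partial\eta_i}{\partial x^j}dx^i+\eta_id\dot x^i$ are its vertical and complete lifts. Let $j:H\mathcal{M}\times\mathbb{R}\hookrightarrow T\mathcal{M}\times\mathbb{R}$ be the inclusion, $\theta_\eta=j^*\eta^{\mathcal{T}}$ and $\omega_\eta=d\theta_\eta$; $\omega_\eta$ is a symplectic form. For $\mathcal{M}=T^*\mathcal{Q}\times\mathbb{R}$, with coordinates $(q^i,p_i,z)$ and induced coordinates $(q^i,p_i,z,\dot q^i,\dot p_i,\dot z,u)$ on $T\mathcal{M}\times\mathbb{R}$, the submanifold $H\mathcal{M}\times\mathbb{R}$ is $\{\dot z=p_i\dot q^i\}$ and has coordinates $(q^i,p_i,z,\dot q^i,\dot p_i,u)$. The coordinates on $T^*(T\mathcal{Q}\times\mathbb{R})$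 are $(q^i,\dot q^i,z)$ followed by the momenta conjugate to $q^i,\dot q^i,z$. The map $\alpha^0$ is globally defined: it equals $\mathrm{pr}\circ\alpha^c\circ j$, where $\alpha^c:T(T^*\mathcal{Q}\times\mathbb{R})\times\mathbb{R}\to T^*(T\mathcal{Q}\times\mathbb{R})\times\mathbb{R}$ is the global diffeomorphism $(q^i,p_i,z,\dot q^i,\dot p_i,\dot z,u)\mapsto(q^i,\dot q^i,z,up_i+\dot p_i,p_i,-u,\dot z)$ and $\mathrm{pr}$ forgets the last real factor. The canonical symplectic form on a cotangent bundle $T^*\mathcal{N}$ is $\omega_{\mathcal{N}}=-d\theta_{\mathcal{N}}$ with $\theta_{\mathcal{N}}$ the Liouville one-form. A Lagrangian submanifold is a submanifold of half the dimension on which the symplectic form vanishes. *)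

theory Defs
  imports "HOL-Analysis.Analysis"
begin

section \<open>Smooth manifolds\<close>

text \<open>C-infinity maps on an open subset of a (finite-dimensional) normed space. Derivatives are taken
  in the full space, so this is only meant for open \<open>S\<close>.\<close>

primrec Ck_on :: "nat \<Rightarrow> 'a::real_normed_vector set \<Rightarrow> ('a \<Rightarrow> 'b::real_normed_vector) \<Rightarrow> bool" where
  "Ck_on 0 S f \<longleftrightarrow> continuous_on S f"
| "Ck_on (Suc k) S f \<longleftrightarrow>
     (\<forall>x\<in>S. f differentiable at x) \<and> (\<forall>v. Ck_on k S (\<lambda>x. frechet_derivative f (at x) v))"

definition smooth_on :: "'a::real_normed_vector set \<Rightarrow> ('a \<Rightarrow> 'b::real_normed_vector) \<Rightarrow> bool" where
  "smooth_on S f \<longleftrightarrow> (\<forall>k. Ck_on k S f)"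

text \<open>A chart is a domain with a coordinate map. Besides its atlas, a manifold structure carries a
  choice \<open>pref p\<close> of one atlas chart around each point \<open>p\<close>. The tangent space at \<open>p\<close> is the model
  space, a vector being given by its components in the chart \<open>pref p\<close>; covectors at \<open>p\<close> are
  likewise given by their components, acting by the inner product. The choice of \<open>pref\<close> is arbitrary.\<close>

type_synonym ('a, 'e) chart = "'a set \<times> ('a \<Rightarrow> 'e)"

abbreviation cdom :: "('a, 'e) chart \<Rightarrow> 'a set" where "cdom c \<equiv> fst c"
abbreviation cmap :: "('a, 'e) chart \<Rightarrow> 'a \<Rightarrow> 'e" where "cmap c \<equiv> snd c"
abbreviation cinv :: "('a, 'e) chart \<Rightarrow> 'e \<Rightarrow> 'a" where "cinv c \<equiv> inv_into (fst c) (snd c)"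

record ('a, 'e) mfd =
  pts :: "'a set"
  charts :: "('a, 'e) chart set"
  pref :: "'a \<Rightarrow> ('a, 'e) chart"

definition is_chart :: "'a set \<Rightarrow> ('a, 'e::euclidean_space) chart \<Rightarrow> bool" where
  "is_chart X c \<longleftrightarrow> cdom c \<subseteq> X \<and> inj_on (cmap c) (cdom c) \<and> open (cmap c ` cdom c)"

definition compatible :: "('a, 'e::euclidean_space) chart \<Rightarrow> ('a, 'e) chart \<Rightarrow> bool" where
  "compatible c d \<longleftrightarrow>
     open (cmap c ` (cdom c \<inter> cdom d)) \<and> open (cmap d ` (cdom c \<inter> cdom d)) \<and>
     smooth_on (cmap c ` (cdom c \<inter> cdom d)) (cmap d \<circ> cinv c) \<and>
     smooth_on (cmap d ` (cdom c \<inter> cdom d)) (cmap c \<circ> cinv d)"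

definition mfd_topology :: "('a, 'e::euclidean_space) mfd \<Rightarrow> 'a topology" where
  "mfd_topology M =
     topology (\<lambda>U. U \<subseteq> pts M \<and> (\<forall>c\<in>charts M. open (cmap c ` (cdom c \<inter> U))))"

definition smooth_manifold :: "('a, 'e::euclidean_space) mfd \<Rightarrow> bool" where
  "smooth_manifold M \<longleftrightarrow>
     (\<forall>c\<in>charts M. is_chart (pts M) c) \<and>
     (\<forall>c\<in>charts M. \<forall>d\<in>charts M. compatible c d) \<and>
     (\<forall>p\<in>pts M. pref M p \<in> charts M \<and> p \<in> cdom (pref M p)) \<and>
     Hausdorff_space (mfd_topology M) \<and> second_countable (mfd_topology M)"

definition smooth_map ::
    "('a, 'e::euclidean_space) mfd \<Rightarrow> ('b, 'f::euclidean_space) mfd \<Rightarrow> ('a \<Rightarrow> 'b) \<Rightarrow> bool" where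
  "smooth_map M N f \<longleftrightarrow>
     continuous_map (mfd_topology M) (mfd_topology N) f \<and>
     (\<forall>c\<in>charts M. \<forall>d\<in>charts N.
        smooth_on (cmap c ` (cdom c \<inter> f -` cdom d)) (cmap d \<circ> f \<circ> cinv c))"

definition diffeo ::
    "('a, 'e::euclidean_space) mfd \<Rightarrow> ('b, 'f::euclidean_space) mfd \<Rightarrow> ('a \<Rightarrow> 'b) \<Rightarrow> bool" where
  "diffeo M N f \<longleftrightarrow>
     bij_betw f (pts M) (pts N) \<and> smooth_map M N f \<and> smooth_map N M (inv_into (pts M) f)"

text \<open>Components in the chart \<open>c\<close> of a tangent vector at \<open>p\<close>, and the vector at \<open>p\<close> with given
  components in \<open>c\<close>.\<close>

definition to_coords :: "('a, 'e::euclidean_space) mfd \<Rightarrow> ('a, 'e) chart \<Rightarrow> 'a \<Rightarrow> 'e \<Rightarrow> 'e" where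
  "to_coords M c p = frechet_derivative (cmap c \<circ> cinv (pref M p)) (at (cmap (pref M p) p))"

definition from_coords :: "('a, 'e::euclidean_space) mfd \<Rightarrow> ('a, 'e) chart \<Rightarrow> 'a \<Rightarrow> 'e \<Rightarrow> 'e" where
  "from_coords M c p = frechet_derivative (cmap (pref M p) \<circ> cinv c) (at (cmap c p))"

definition tangent_map ::
    "('a, 'e::euclidean_space) mfd \<Rightarrow> ('b, 'f::euclidean_space) mfd \<Rightarrow> ('a \<Rightarrow> 'b) \<Rightarrow> 'a \<Rightarrow> 'e \<Rightarrow> 'f" where
  "tangent_map M N f p =
     frechet_derivative (cmap (pref N (f p)) \<circ> f \<circ> cinv (pref M p)) (at (cmap (pref M p) p))"

section \<open>The real line, products, tangent and cotangent bundles\<close>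

definition real_chart :: "(real, real) chart" where
  "real_chart = (UNIV, \<lambda>x. x)"

definition real_line :: "(real, real) mfd" where
  "real_line = \<lparr>pts = UNIV, charts = {real_chart}, pref = (\<lambda>_. real_chart)\<rparr>"

definition prod_chart :: "('a, 'e) chart \<Rightarrow> ('b, 'f) chart \<Rightarrow> ('a \<times> 'b, 'e \<times> 'f) chart" where
  "prod_chart c d = (cdom c \<times> cdom d, map_prod (cmap c) (cmap d))"

definition prod_mfd :: "('a, 'e) mfd \<Rightarrow> ('b, 'f) mfd \<Rightarrow> ('a \<times> 'b, 'e \<times> 'f) mfd" where
  "prod_mfd M N =
     \<lparr>pts = pts M \<times> pts N,
      charts = {prod_chart c d |c d. c \<in> charts M \<and> d \<in> charts N},
      pref = (\<lambda>(p, q). prod_chart (pref M p) (pref N q))\<rparr>"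

text \<open>Induced coordinates \<open>(x, \<dot>x)\<close> on the tangent and \<open>(x, p)\<close> on the cotangent bundle.\<close>

definition tangent_chart ::
    "('a, 'e::euclidean_space) mfd \<Rightarrow> ('a, 'e) chart \<Rightarrow> ('a \<times> 'e, 'e \<times> 'e) chart" where
  "tangent_chart M c = (cdom c \<times> UNIV, \<lambda>(p, v). (cmap c p, to_coords M c p v))"

definition cotangent_chart ::
    "('a, 'e::euclidean_space) mfd \<Rightarrow> ('a, 'e) chart \<Rightarrow> ('a \<times> 'e, 'e \<times> 'e) chart" where
  "cotangent_chart M c = (cdom c \<times> UNIV, \<lambda>(p, a). (cmap c p, adjoint (from_coords M c p) a))"

definition tangent :: "('a, 'e::euclidean_space) mfd \<Rightarrow> ('a \<times> 'e, 'e \<times> 'e) mfd" where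
  "tangent M =
     \<lparr>pts = pts M \<times> UNIV,
      charts = tangent_chart M ` charts M,
      pref = (\<lambda>(p, v). tangent_chart M (pref M p))\<rparr>"

definition cotangent :: "('a, 'e::euclidean_space) mfd \<Rightarrow> ('a \<times> 'e, 'e \<times> 'e) mfd" where
  "cotangent M =
     \<lparr>pts = pts M \<times> UNIV,
      charts = cotangent_chart M ` charts M,
      pref = (\<lambda>(p, a). cotangent_chart M (pref M p))\<rparr>"

text \<open>The covector representing a linear functional.\<close>

definition covector :: "('e::euclidean_space \<Rightarrow> real) \<Rightarrow> 'e" where
  "covector f = (\<Sum>b\<in>Basis. f b *\<^sub>R b)"

section \<open>Vector fields and differential forms\<close>

type_synonym ('a, 'e) vfield = "'a \<Rightarrow> 'e"
type_synonym ('a, 'e) form1 = "'a \<Rightarrow> 'e \<Rightarrow> real"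
type_synonym ('a, 'e) form2 = "'a \<Rightarrow> 'e \<Rightarrow> 'e \<Rightarrow> real"

definition smooth_vfield :: "('a, 'e::euclidean_space) mfd \<Rightarrow> ('a, 'e) vfield \<Rightarrow> bool" where
  "smooth_vfield M X \<longleftrightarrow> smooth_map M (tangent M) (\<lambda>p. (p, X p))"

definition differential :: "('a, 'e::euclidean_space) mfd \<Rightarrow> ('a \<Rightarrow> real) \<Rightarrow> ('a, 'e) form1" where
  "differential M H = tangent_map M real_line H"

definition pullback1 ::
    "('a, 'e::euclidean_space) mfd \<Rightarrow> ('b, 'f::euclidean_space) mfd \<Rightarrow> ('a \<Rightarrow> 'b) \<Rightarrow>
     ('b, 'f) form1 \<Rightarrow> ('a, 'e) form1" where
  "pullback1 M N f \<theta> p v = \<theta> (f p) (tangent_map M N f p v)"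

definition pullback2 ::
    "('a, 'e::euclidean_space) mfd \<Rightarrow> ('b, 'f::euclidean_space) mfd \<Rightarrow> ('a \<Rightarrow> 'b) \<Rightarrow>
     ('b, 'f) form2 \<Rightarrow> ('a, 'e) form2" where
  "pullback2 M N f \<omega> p v w = \<omega> (f p) (tangent_map M N f p v) (tangent_map M N f p w)"

text \<open>Coordinate expressions in a chart \<open>c\<close>, as functions of the coordinates \<open>x\<close>.\<close>

definition local_form ::
    "('a, 'e::euclidean_space) mfd \<Rightarrow> ('a, 'e) chart \<Rightarrow> ('a, 'e) form1 \<Rightarrow> 'e \<Rightarrow> 'e \<Rightarrow> real" where
  "local_form M c \<theta> x v = \<theta> (cinv c x) (from_coords M c (cinv c x) v)"

definition local_vfield ::
    "('a, 'e::euclidean_space) mfd \<Rightarrow> ('a, 'e) chart \<Rightarrow> ('a, 'e) vfield \<Rightarrow> 'e \<Rightarrow> 'e" where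
  "local_vfield M c X x = to_coords M c (cinv c x) (X (cinv c x))"

text \<open>The definitions below are coordinate formulas at \<open>p\<close>, evaluated in the chart \<open>pref M p\<close>, in which
  the vectors at \<open>p\<close> are their own components. The first one is
  \<open>(d\<theta>)(v, w) = v\<^sup>i w\<^sup>j (\<partial>\<^sub>i \<theta>\<^sub>j - \<partial>\<^sub>j \<theta>\<^sub>i)\<close> (no factor 1/2).\<close>

definition ext_d :: "('a, 'e::euclidean_space) mfd \<Rightarrow> ('a, 'e) form1 \<Rightarrow> ('a, 'e) form2" where
  "ext_d M \<theta> p v w =
     (let c = pref M p; x = cmap c p in
        frechet_derivative (\<lambda>y. local_form M c \<theta> y w) (at x) v
      - frechet_derivative (\<lambda>y. local_form M c \<theta> y v) (at x) w)"

text \<open>\<open>(L\<^sub>X \<theta>)\<^sub>i = X\<^sup>j \<partial>\<^sub>j \<theta>\<^sub>i + \<theta>\<^sub>j \<partial>\<^sub>i X\<^sup>j\<close>; equivalently \<open>(L\<^sub>X \<theta>)(Y) = X(\<theta>(Y)) - \<theta>([X,Y])\<close>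
  with \<open>Y\<close> the extension of \<open>w\<close> having constant components.\<close>

definition lie_deriv ::
    "('a, 'e::euclidean_space) mfd \<Rightarrow> ('a, 'e) vfield \<Rightarrow> ('a, 'e) form1 \<Rightarrow> ('a, 'e) form1" where
  "lie_deriv M X \<theta> p w =
     (let c = pref M p; x = cmap c p in
        frechet_derivative (\<lambda>y. local_form M c \<theta> y w) (at x) (X p)
      + \<theta> p (frechet_derivative (local_vfield M c X) (at x) w))"

text \<open>Vertical lift \<open>\<theta>\<^sub>i dx\<^sup>i\<close> and complete lift \<open>\<dot>x\<^sup>j \<partial>\<^sub>j \<theta>\<^sub>i dx\<^sup>i + \<theta>\<^sub>i d\<dot>x\<^sup>i\<close>, as one-forms on the
  tangent bundle; \<open>(a, b)\<close> are the \<open>(x, \<dot>x)\<close>-components of the argument.\<close>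

definition vertical_lift ::
    "('a, 'e::euclidean_space) mfd \<Rightarrow> ('a, 'e) form1 \<Rightarrow> ('a \<times> 'e, 'e \<times> 'e) form1" where
  "vertical_lift M \<theta> = (\<lambda>(p, v) (a, b). \<theta> p a)"

definition complete_lift ::
    "('a, 'e::euclidean_space) mfd \<Rightarrow> ('a, 'e) form1 \<Rightarrow> ('a \<times> 'e, 'e \<times> 'e) form1" where
  "complete_lift M \<theta> = (\<lambda>(p, v) (a, b).
     (let c = pref M p in
        frechet_derivative (\<lambda>y. local_form M c \<theta> y a) (at (cmap c p)) v + \<theta> p b))"

definition tangent_contact_form ::
    "('a, 'e::euclidean_space) mfd \<Rightarrow> ('a, 'e) form1 \<Rightarrow>
     (('a \<times> 'e) \<times> real, ('e \<times> 'e) \<times> real) form1" where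
  "tangent_contact_form M \<eta> = (\<lambda>(V, u) (W, _).
     u * vertical_lift M \<eta> V W + complete_lift M \<eta> V W)"

section \<open>Symplectic notions\<close>

definition liouville :: "('a, 'e::euclidean_space) mfd \<Rightarrow> ('a \<times> 'e, 'e \<times> 'e) form1" where
  "liouville N = (\<lambda>(p, a) V. a \<bullet> tangent_map (cotangent N) N fst (p, a) V)"

definition canonical_form :: "('a, 'e::euclidean_space) mfd \<Rightarrow> ('a \<times> 'e, 'e \<times> 'e) form2" where
  "canonical_form N = (\<lambda>\<alpha> V W. - ext_d (cotangent N) (liouville N) \<alpha> V W)"

definition symplectic_diffeo ::
    "('a, 'e::euclidean_space) mfd \<Rightarrow> ('a, 'e) form2 \<Rightarrow>
     ('b, 'f::euclidean_space) mfd \<Rightarrow> ('b, 'f) form2 \<Rightarrow> ('a \<Rightarrow> 'b) \<Rightarrow> bool" where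
  "symplectic_diffeo M \<omega> N \<omega>' f \<longleftrightarrow>
     diffeo M N f \<and> (\<forall>p\<in>pts M. pullback2 M N f \<omega>' p = \<omega> p)"

text \<open>A chart of the maximal atlas in which \<open>S\<close> is the linear subspace \<open>L\<close>.\<close>

definition slice_chart ::
    "('a, 'e::euclidean_space) mfd \<Rightarrow> 'a set \<Rightarrow> ('a, 'e) chart \<Rightarrow> 'e set \<Rightarrow> bool" where
  "slice_chart M S c L \<longleftrightarrow>
     is_chart (pts M) c \<and> (\<forall>d\<in>charts M. compatible c d) \<and>
     subspace L \<and> cmap c ` (cdom c \<inter> S) = cmap c ` cdom c \<inter> L"

definition submanifold :: "('a, 'e::euclidean_space) mfd \<Rightarrow> nat \<Rightarrow> 'a set \<Rightarrow> bool" where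
  "submanifold M k S \<longleftrightarrow>
     S \<subseteq> pts M \<and> (\<forall>p\<in>S. \<exists>c L. p \<in> cdom c \<and> slice_chart M S c L \<and> dim L = k)"

definition subtangent :: "('a, 'e::euclidean_space) mfd \<Rightarrow> 'a set \<Rightarrow> 'a \<Rightarrow> 'e set" where
  "subtangent M S p = {v. \<exists>c L. p \<in> cdom c \<and> slice_chart M S c L \<and> to_coords M c p v \<in> L}"

definition lagrangian_submanifold ::
    "('a, 'e::euclidean_space) mfd \<Rightarrow> ('a, 'e) form2 \<Rightarrow> 'a set \<Rightarrow> bool" where
  "lagrangian_submanifold M \<omega> S \<longleftrightarrow>
     (\<exists>k. 2 * k = DIM('e) \<and> submanifold M k S) \<and>
     (\<forall>p\<in>S. \<forall>v\<in>subtangent M S p. \<forall>w\<in>subtangent M S p. \<omega> p v w = 0)"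

section \<open>Reeb and evolution vector fields\<close>

definition reeb_field ::
    "('a, 'e::euclidean_space) mfd \<Rightarrow> ('a, 'e) form1 \<Rightarrow> ('a, 'e) vfield \<Rightarrow> bool" where
  "reeb_field M \<eta> R \<longleftrightarrow>
     smooth_vfield M R \<and> (\<forall>m\<in>pts M. \<eta> m (R m) = 1 \<and> (\<forall>W. ext_d M \<eta> m (R m) W = 0))"

definition evolution_field ::
    "('a, 'e::euclidean_space) mfd \<Rightarrow> ('a, 'e) form1 \<Rightarrow> ('a, 'e) vfield \<Rightarrow> ('a \<Rightarrow> real) \<Rightarrow>
     ('a, 'e) vfield \<Rightarrow> bool" where
  "evolution_field M \<eta> R H X \<longleftrightarrow>
     smooth_vfield M X \<and>
     (\<forall>m\<in>pts M. \<eta> m (X m) = 0 \<and>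
        (\<forall>W. lie_deriv M X \<eta> m W = differential M H m W - differential M H m (R m) * \<eta> m W))"

section \<open>The triple over \<open>T\<^sup>*Q \<times> \<real>\<close>\<close>

definition phase :: "('a, 'e::euclidean_space) mfd \<Rightarrow> (('a \<times> 'e) \<times> real, ('e \<times> 'e) \<times> real) mfd" where
  "phase Q = prod_mfd (cotangent Q) real_line"

definition velocity :: "('a, 'e::euclidean_space) mfd \<Rightarrow> (('a \<times> 'e) \<times> real, ('e \<times> 'e) \<times> real) mfd" where
  "velocity Q = prod_mfd (tangent Q) real_line"

text \<open>\<open>\<eta>\<^sub>Q = dz - p\<^sub>i dq\<^sup>i\<close>, and \<open>\<partial>/\<partial>z\<close>.\<close>

definition eta :: "('a, 'e::euclidean_space) mfd \<Rightarrow> (('a \<times> 'e) \<times> real, ('e \<times> 'e) \<times> real) form1" where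
  "eta Q m W = differential (phase Q) snd m W
             - pullback1 (phase Q) (cotangent Q) fst (liouville Q) m W"

definition d_dz :: "(('a \<times> 'e) \<times> real, ('e::euclidean_space \<times> 'e) \<times> real) vfield" where
  "d_dz m = ((0, 0), 1)"

type_synonym ('a, 'e) hm_point = "((('a \<times> 'e) \<times> real) \<times> (('e \<times> 'e) \<times> real)) \<times> real"
type_synonym 'e hm_model = "'e \<times> 'e \<times> real \<times> 'e \<times> 'e \<times> real"

definition TM_R :: "('a, 'e::euclidean_space) mfd \<Rightarrow>
    (('a, 'e) hm_point, ((('e \<times> 'e) \<times> real) \<times> (('e \<times> 'e) \<times> real)) \<times> real) mfd" where
  "TM_R Q = prod_mfd (tangent (phase Q)) real_line"

definition HM_R_set :: "('a, 'e::euclidean_space) mfd \<Rightarrow> ('a, 'e) hm_point set" where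
  "HM_R_set Q = {((m, V), u) |m V u. m \<in> pts (phase Q) \<and> eta Q m V = 0}"

text \<open>A chart of \<open>Q\<close> induces the chart \<open>(q, p, z, \<dot>q, \<dot>p, \<dot>z, u)\<close> of \<open>TM \<times> \<real>\<close> and, dropping
  \<open>\<dot>z = p\<^sub>i \<dot>q\<^sup>i\<close>, the chart \<open>(q, p, z, \<dot>q, \<dot>p, u)\<close> of \<open>HM \<times> \<real>\<close>.\<close>

definition phase_chart ::
    "('a, 'e::euclidean_space) mfd \<Rightarrow> ('a, 'e) chart \<Rightarrow> (('a \<times> 'e) \<times> real, ('e \<times> 'e) \<times> real) chart" where
  "phase_chart Q c = prod_chart (cotangent_chart Q c) real_chart"

definition TM_R_chart :: "('a, 'e::euclidean_space) mfd \<Rightarrow> ('a, 'e) chart \<Rightarrow>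
    (('a, 'e) hm_point, ((('e \<times> 'e) \<times> real) \<times> (('e \<times> 'e) \<times> real)) \<times> real) chart" where
  "TM_R_chart Q c = prod_chart (tangent_chart (phase Q) (phase_chart Q c)) real_chart"

definition HM_R_chart ::
    "('a, 'e::euclidean_space) mfd \<Rightarrow> ('a, 'e) chart \<Rightarrow> (('a, 'e) hm_point, 'e hm_model) chart" where
  "HM_R_chart Q c =
     (cdom (TM_R_chart Q c) \<inter> HM_R_set Q,
      \<lambda>x. case cmap (TM_R_chart Q c) x of
        ((((q, p), z), ((dq, dp), dz)), u) \<Rightarrow> (q, p, z, dq, dp, u))"

definition HM_R :: "('a, 'e::euclidean_space) mfd \<Rightarrow> (('a, 'e) hm_point, 'e hm_model) mfd" where
  "HM_R Q =
     \<lparr>pts = HM_R_set Q,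
      charts = HM_R_chart Q ` charts Q,
      pref = (\<lambda>((((q, p), z), V), u). HM_R_chart Q (pref Q q))\<rparr>"

definition theta_eta :: "('a, 'e::euclidean_space) mfd \<Rightarrow> (('a, 'e) hm_point, 'e hm_model) form1" where
  "theta_eta Q = pullback1 (HM_R Q) (TM_R Q) (\<lambda>x. x) (tangent_contact_form (phase Q) (eta Q))"

definition omega_eta :: "('a, 'e::euclidean_space) mfd \<Rightarrow> (('a, 'e) hm_point, 'e hm_model) form2" where
  "omega_eta Q = ext_d (HM_R Q) (theta_eta Q)"

definition beta0 :: "('a, 'e::euclidean_space) mfd \<Rightarrow> ('a, 'e) hm_point \<Rightarrow>
    (('a \<times> 'e) \<times> real) \<times> (('e \<times> 'e) \<times> real)" where
  "beta0 Q = (\<lambda>((m, V), u).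
     (m, covector (\<lambda>W. - ext_d (phase Q) (eta Q) m V W - u * eta Q m W)))"

text \<open>Chart of \<open>T\<^sup>*(TQ \<times> \<real>)\<close> with coordinates \<open>(((q, \<dot>q), z), ((\<pi>\<^sub>q, \<pi>\<^sub>\<dot>\<^sub>q), \<pi>\<^sub>z))\<close>.\<close>

definition velocity_cotangent_chart :: "('a, 'e::euclidean_space) mfd \<Rightarrow> ('a, 'e) chart \<Rightarrow>
    ((('a \<times> 'e) \<times> real) \<times> (('e \<times> 'e) \<times> real), (('e \<times> 'e) \<times> real) \<times> (('e \<times> 'e) \<times> real)) chart" where
  "velocity_cotangent_chart Q c =
     cotangent_chart (velocity Q) (prod_chart (tangent_chart Q c) real_chart)"

definition alpha0_local ::
    "'e::euclidean_space hm_model \<Rightarrow> (('e \<times> 'e) \<times> real) \<times> (('e \<times> 'e) \<times> real)" where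
  "alpha0_local = (\<lambda>(q, p, z, dq, dp, u). (((q, dq), z), ((u *\<^sub>R p + dp, p), - u)))"

text \<open>Defined through the coordinates induced by the chosen chart of \<open>Q\<close> at the base point; that the
  coordinate formula then holds for every chart of \<open>Q\<close> is \<open>alpha0_well_defined\<close>.\<close>

definition alpha0 :: "('a, 'e::euclidean_space) mfd \<Rightarrow> ('a, 'e) hm_point \<Rightarrow>
    (('a \<times> 'e) \<times> real) \<times> (('e \<times> 'e) \<times> real)" where
  "alpha0 Q x =
     (let c = pref Q (fst (fst (fst (fst x)))) in
        cinv (velocity_cotangent_chart Q c) (alpha0_local (cmap (HM_R_chart Q c) x)))"

definition alpha0_well_defined :: "('a, 'e::euclidean_space) mfd \<Rightarrow> bool" where
  "alpha0_well_defined Q \<longleftrightarrow>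
     (\<forall>c\<in>charts Q. \<forall>x\<in>cdom (HM_R_chart Q c).
        alpha0 Q x \<in> cdom (velocity_cotangent_chart Q c) \<and>
        cmap (velocity_cotangent_chart Q c) (alpha0 Q x) = alpha0_local (cmap (HM_R_chart Q c) x))"

definition base_point :: "('a, 'e) hm_point \<Rightarrow> ('a \<times> 'e) \<times> real" where
  "base_point = (\<lambda>((m, V), u). m)"

text \<open>\<open>(q, p, z, \<dot>q, \<dot>p, u) \<mapsto> (q, \<dot>q, z)\<close>; \<open>\<dot>q\<close> is the image of the tangent vector under the
  derivative of the projection to \<open>Q\<close>.\<close>

definition velocity_proj ::
    "('a, 'e::euclidean_space) mfd \<Rightarrow> ('a, 'e) hm_point \<Rightarrow> ('a \<times> 'e) \<times> real" where
  "velocity_proj Q = (\<lambda>((((q, p), z), V), u).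
     ((q, tangent_map (phase Q) Q (\<lambda>m. fst (fst m)) ((q, p), z) V), z))"

text \<open>The map \<open>(\<epsilon>\<^sub>H, R(H))\<close>.\<close>

definition evolution_section ::
    "('a, 'e::euclidean_space) mfd \<Rightarrow> (('a \<times> 'e) \<times> real \<Rightarrow> real) \<Rightarrow>
     (('a \<times> 'e) \<times> real, ('e \<times> 'e) \<times> real) vfield \<Rightarrow> ('a \<times> 'e) \<times> real \<Rightarrow> ('a, 'e) hm_point" where
  "evolution_section Q H \<epsilon> m = ((m, \<epsilon> m), differential (phase Q) H m (d_dz m))"

end

theory Submission
  imports Defs
begin

text \<open>
  Every map in the theorem covers the identity of \<open>Q\<close>, and every chart involved is induced by a chart
  of \<open>Q\<close>. In such charts \<open>\<theta>\<^sub>\<eta> = u dz - (up + \<dot>p) dq + \<dot>q dp\<close>. The map \<open>\<beta>\<^sup>0\<close> has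
  momenta \<open>(up + \<dot>p, -\<dot>q, -u)\<close>, so it pulls the Liouville form back to \<open>-\<theta>\<^sub>\<eta>\<close>; the map \<open>\<alpha>\<^sup>0\<close> has
  momenta \<open>(up + \<dot>p, p, -u)\<close>, and the pullback differs from \<open>-\<theta>\<^sub>\<eta>\<close> by the exact form
  \<open>d(p\<^sub>i \<dot>q\<^sup>i)\<close>. That the coordinate formulas hold in every chart comes down to the symmetry of the
  second derivatives of transition maps.

  By Cartan's formula \<open>\<beta>\<^sup>0\<close> carries the section \<open>(\<epsilon>\<^sub>H, R(H))\<close> to \<open>-dH\<close>. Its image is thus the set
  where the momenta of \<open>\<beta>\<^sup>0\<close> equal minus the gradient of \<open>H\<close>; adding this gradient to the momenta
  gives slice charts, and the symplectic form vanishes on tangent vectors because the Hessian of \<open>H\<close>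
  is symmetric.
\<close>

section \<open>Smooth maps between open subsets of Euclidean spaces\<close>

text \<open>A tangent vector is stored by its components in the chart that \<open>pref\<close> picks
  at its base point, and \<open>pref\<close> may jump from point to point. Formulas in stored
  components can be evaluated at a point but not differentiated; this is why each form is first
  computed in every chart induced by \<open>Q\<close>, with the Jacobians to and from the preferred
  chart, before a derivative is taken. The form \<open>theta_eta\<close> is tied to
  \<open>beta0\<close> by a chart-free identity: at V the complete lift of \<eta> is i_V d\<eta> +
  d(\<eta>(V)), and \<eta>(V) vanishes on HM. So \<open>theta_eta\<close> at (V, u) is the pullback
  of u \<eta> + i_V d\<eta> along the base projection, which is minus the covector that defines
  \<open>beta0\<close>. This sign meets the one in the canonical form -d(Liouville), and the
  pullback is \<open>omega_eta\<close> itself. In coordinates both maps are polynomial bijections of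
  the whole model space with polynomial inverse, so bijectivity and smoothness of the inverse are
  read off explicit formulas.\<close>

lemma Ck_on_subset: "Ck_on k S f \<Longrightarrow> T \<subseteq> S \<Longrightarrow> Ck_on k T f"
  by (induction k arbitrary: f) (auto intro: continuous_on_subset)

lemma differentiable_cong_open:
  assumes "open S" "x \<in> S" "\<And>x. x \<in> S \<Longrightarrow> f x = g x" "f differentiable at x"
  shows "g differentiable at x" "frechet_derivative g (at x) = frechet_derivative f (at x)"
proof -
  have "(g has_derivative frechet_derivative f (at x)) (at x)"
    using assms frechet_derivative_works has_derivative_transform_within_open by blast
  then show "g differentiable at x" "frechet_derivative g (at x) = frechet_derivative f (at x)"
    by (auto simp: differentiable_def dest: frechet_derivative_at)
qed

lemma Ck_on_cong:
  assumes "open S" "\<And>x. x \<in> S \<Longrightarrow> f x = g x" "Ck_on k S f"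
  shows "Ck_on k S g"
  using assms(2,3)
proof (induction k arbitrary: f g)
  case 0
  then show ?case by (simp cong: continuous_on_cong_simp)
next
  case (Suc k)
  have d: "g differentiable at x" "frechet_derivative g (at x) = frechet_derivative f (at x)"
    if "x \<in> S" for x
    using differentiable_cong_open[OF assms(1) that Suc.prems(1)] Suc.prems(2) that by auto
  have "Ck_on k S (\<lambda>x. frechet_derivative g (at x) v)" for v
    by (rule Suc.IH[of "\<lambda>x. frechet_derivative f (at x) v"]) (use d Suc.prems in auto)
  with d show ?case by auto
qed

lemma Ck_on_SucD: "Ck_on (Suc k) S f \<Longrightarrow> Ck_on k S f"
proof (induction k arbitrary: f)
  case 0
  then show ?case
    by (auto intro!: continuous_at_imp_continuous_on differentiable_imp_continuous_within)
next
  case (Suc k)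
  then show ?case by (auto simp del: Ck_on.simps(1))
qed

section \<open>Closure properties of C^k maps\<close>

lemma Ck_on_const: "Ck_on k S (\<lambda>x. c)"
proof (induction k arbitrary: c)
  case (Suc k)
  then show ?case by simp
qed auto

text \<open>Lets an induction step supply the derivative as a formula; openness of S carries the
  identity with \<open>frechet_derivative\<close> to the next order.\<close>

lemma Ck_on_Suc_intro:
  assumes "open S"
    and "\<And>x. x \<in> S \<Longrightarrow> (f has_derivative f' x) (at x)" "\<And>v. Ck_on k S (\<lambda>x. f' x v)"
  shows "Ck_on (Suc k) S f"
  unfolding Ck_on.simps
proof (intro conjI ballI allI)
  show "f differentiable at x" if "x \<in> S" for x
    using assms(2)[OF that] differentiable_def by blast
  show "Ck_on k S (\<lambda>x. frechet_derivative f (at x) v)" for v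
    by (rule Ck_on_cong[OF assms(1) _ assms(3)[of v]])
       (use assms(2) frechet_derivative_at in metis)
qed

lemma Ck_on_SucE:
  assumes "Ck_on (Suc k) S f" "x \<in> S"
  shows "(f has_derivative frechet_derivative f (at x)) (at x)"
  using assms frechet_derivative_works by auto

lemma Ck_on_bounded_linear:
  assumes "open S" "bounded_linear L" "Ck_on k S f"
  shows "Ck_on k S (\<lambda>x. L (f x))"
  using assms(3)
proof (induction k arbitrary: f)
  case 0
  then show ?case by (simp add: bounded_linear.continuous_on[OF assms(2)])
next
  case (Suc k)
  show ?case
    by (rule Ck_on_Suc_intro[OF assms(1),
          of _ "\<lambda>x v. L (frechet_derivative f (at x) v)"])
       (use Suc bounded_linear.has_derivative[OF assms(2) Ck_on_SucE[OF Suc.prems]] in auto)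
qed

lemma Ck_on_ident: "open S \<Longrightarrow> Ck_on k S (\<lambda>x. x)"
  by (cases k) (auto intro: Ck_on_const)

lemma Ck_on_add:
  assumes "open S" "Ck_on k S f" "Ck_on k S g"
  shows "Ck_on k S (\<lambda>x. f x + g x)"
  using assms(2,3)
proof (induction k arbitrary: f g)
  case 0
  then show ?case by (simp add: continuous_on_add)
next
  case (Suc k)
  show ?case
    by (rule Ck_on_Suc_intro[OF assms(1),
          of _ "\<lambda>x v. frechet_derivative f (at x) v + frechet_derivative g (at x) v"])
       (use Suc has_derivative_add[OF Ck_on_SucE[OF Suc.prems(1)] Ck_on_SucE[OF Suc.prems(2)]] in auto)
qed

lemma Ck_on_sum:
  assumes "open S" "\<And>i. i \<in> I \<Longrightarrow> Ck_on k S (f i)"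
  shows "Ck_on k S (\<lambda>x. \<Sum>i\<in>I. f i x)"
  using assms(2) by (induction I rule: infinite_finite_induct) (auto intro: Ck_on_const Ck_on_add assms(1))

lemma Ck_on_bounded_bilinear:
  assumes "open S" "bounded_bilinear B" "Ck_on k S f" "Ck_on k S g"
  shows "Ck_on k S (\<lambda>x. B (f x) (g x))"
  using assms(3,4)
proof (induction k arbitrary: f g)
  case 0
  then show ?case by (simp add: bounded_bilinear.continuous_on[OF assms(2)])
next
  case (Suc k)
  show ?case
  proof (rule Ck_on_Suc_intro[OF assms(1),
          of _ "\<lambda>x v. B (f x) (frechet_derivative g (at x) v) + B (frechet_derivative f (at x) v) (g x)"])
    show "((\<lambda>x. B (f x) (g x)) has_derivative
        (\<lambda>v. B (f x) (frechet_derivative g (at x) v) + B (frechet_derivative f (at x) v) (g x))) (at x)"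
      if "x \<in> S" for x
      using bounded_bilinear.FDERIV[OF assms(2) Ck_on_SucE[OF Suc.prems(1) that] Ck_on_SucE[OF Suc.prems(2) that]] .
    show "Ck_on k S (\<lambda>x. B (f x) (frechet_derivative g (at x) v) + B (frechet_derivative f (at x) v) (g x))" for v
      \<comment> \<open>Each product pairs a derivative, of order k, with an undifferentiated
        factor, whose order is lowered from Suc k to k.\<close>
      using Suc.prems Ck_on_SucD[OF Suc.prems(1)] Ck_on_SucD[OF Suc.prems(2)]
      by (intro Ck_on_add assms(1) Suc.IH) auto
  qed
qed

text \<open>\<open>Ck_on\<close> speaks of derivatives in fixed directions only; this expansion
  trades a varying direction for varying coefficients.\<close>

lemma linear_eq_sum_Basis:
  fixes L :: "'a::euclidean_space \<Rightarrow> 'b::real_vector"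
  assumes "linear L"
  shows "L v = (\<Sum>b\<in>Basis. (v \<bullet> b) *\<^sub>R L b)"
proof -
  have "L v = L (\<Sum>b\<in>Basis. (v \<bullet> b) *\<^sub>R b)" by (simp add: euclidean_representation)
  also have "\<dots> = (\<Sum>b\<in>Basis. (v \<bullet> b) *\<^sub>R L b)"
    using assms by (simp add: linear_sum linear_scale)
  finally show ?thesis .
qed

text \<open>The chain rule applies g' to the moving vector f'(x) v. Expanded over the basis of the
  middle space, it is a sum of components of f' times fixed-direction derivatives of g composed with
  f; the induction hypothesis, general in g, covers the latter.\<close>

lemma Ck_on_compose:
  fixes f :: "'a::euclidean_space \<Rightarrow> 'b::euclidean_space" and g :: "'b \<Rightarrow> 'c::real_normed_vector"
  assumes "open S" "open T" "Ck_on k S f" "Ck_on k T g" "\<And>x. x \<in> S \<Longrightarrow> f x \<in> T"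
  shows "Ck_on k S (\<lambda>x. g (f x))"
  using assms(3,4)
proof (induction k arbitrary: g)
  case 0
  then show ?case using assms(5) by (auto intro: continuous_on_compose2)
next
  case (Suc k)
  let ?f' = "\<lambda>x. frechet_derivative f (at x)" and ?g' = "\<lambda>x. frechet_derivative g (at x)"
  show ?case
  proof (rule Ck_on_Suc_intro[OF assms(1), of _ "\<lambda>x v. \<Sum>b\<in>Basis. (?f' x v \<bullet> b) *\<^sub>R ?g' (f x) b"])
    fix x assume x: "x \<in> S"
    have g: "(g has_derivative ?g' (f x)) (at (f x))"
      using Ck_on_SucE[OF Suc.prems(2)] assms(5) x by auto
    have "((\<lambda>x. g (f x)) has_derivative (\<lambda>v. ?g' (f x) (?f' x v))) (at x)"
      using has_derivative_compose[OF Ck_on_SucE[OF Suc.prems(1) x] g] by simp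
    also have "(\<lambda>v. ?g' (f x) (?f' x v)) = (\<lambda>v. \<Sum>b\<in>Basis. (?f' x v \<bullet> b) *\<^sub>R ?g' (f x) b)"
      using linear_eq_sum_Basis[OF has_derivative_linear[OF g]] by blast
    finally show "((\<lambda>x. g (f x)) has_derivative
       (\<lambda>v. \<Sum>b\<in>Basis. (?f' x v \<bullet> b) *\<^sub>R ?g' (f x) b)) (at x)" .
  next
    fix v
    have "Ck_on k S (\<lambda>x. ?g' (f x) b)" for b
      using Suc.IH[of "\<lambda>y. ?g' y b"] Suc.prems Ck_on_SucD by auto
    moreover have "Ck_on k S (\<lambda>x. ?f' x v \<bullet> b)" for b
      by (rule Ck_on_bounded_linear[OF assms(1) bounded_linear_inner_left]) (use Suc.prems(1) in simp)
    ultimately show "Ck_on k S (\<lambda>x. \<Sum>b\<in>Basis. (?f' x v \<bullet> b) *\<^sub>R ?g' (f x) b)"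
      by (intro Ck_on_sum Ck_on_bounded_bilinear[OF _ bounded_bilinear_scaleR] assms(1))
  qed
qed

section \<open>Closure properties of smooth maps\<close>

lemma smooth_on_subset: "smooth_on S f \<Longrightarrow> T \<subseteq> S \<Longrightarrow> smooth_on T f"
  unfolding smooth_on_def using Ck_on_subset by blast

lemma smooth_on_cong:
  "open S \<Longrightarrow> (\<And>x. x \<in> S \<Longrightarrow> f x = g x) \<Longrightarrow> smooth_on S f \<Longrightarrow> smooth_on S g"
  unfolding smooth_on_def using Ck_on_cong by blast

lemma smooth_on_imp_continuous_on: "smooth_on S f \<Longrightarrow> continuous_on S f"
  unfolding smooth_on_def by (metis Ck_on.simps(1))

lemma smooth_on_has_derivative:
  "smooth_on S f \<Longrightarrow> x \<in> S \<Longrightarrow> (f has_derivative frechet_derivative f (at x)) (at x)"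
  unfolding smooth_on_def using Ck_on_SucE by blast

lemma smooth_on_differentiable: "smooth_on S f \<Longrightarrow> x \<in> S \<Longrightarrow> f differentiable at x"
  using smooth_on_has_derivative differentiable_def by blast

lemma smooth_on_linear_frechet_derivative:
  "smooth_on S f \<Longrightarrow> x \<in> S \<Longrightarrow> linear (frechet_derivative f (at x))"
  using smooth_on_has_derivative has_derivative_linear by blast

lemma smooth_on_directional_derivative:
  assumes "smooth_on S f"
  shows "smooth_on S (\<lambda>x. frechet_derivative f (at x) v)"
  using assms unfolding smooth_on_def by (metis Ck_on.simps(2))

lemma smooth_on_const: "smooth_on S (\<lambda>x. c)"
  by (simp add: smooth_on_def Ck_on_const)

lemma smooth_on_ident: "open S \<Longrightarrow> smooth_on S (\<lambda>x. x)"
  by (simp add: smooth_on_def Ck_on_ident)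

lemma smooth_on_bounded_linear:
  "open S \<Longrightarrow> bounded_linear L \<Longrightarrow> smooth_on S f \<Longrightarrow> smooth_on S (\<lambda>x. L (f x))"
  by (simp add: smooth_on_def Ck_on_bounded_linear)

lemma smooth_on_add:
  "open S \<Longrightarrow> smooth_on S f \<Longrightarrow> smooth_on S g \<Longrightarrow> smooth_on S (\<lambda>x. f x + g x)"
  by (simp add: smooth_on_def Ck_on_add)

lemma smooth_on_minus:
  "open S \<Longrightarrow> smooth_on S f \<Longrightarrow> smooth_on S (\<lambda>x. - f x)"
  by (rule smooth_on_bounded_linear[OF _ bounded_linear_minus[OF bounded_linear_ident]])

lemma smooth_on_diff:
  "open S \<Longrightarrow> smooth_on S f \<Longrightarrow> smooth_on S g \<Longrightarrow> smooth_on S (\<lambda>x. f x - g x)"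
  using smooth_on_add[of S f "\<lambda>x. - g x"] smooth_on_minus[of S g] by simp

lemma smooth_on_sum:
  "open S \<Longrightarrow> (\<And>i. i \<in> I \<Longrightarrow> smooth_on S (f i)) \<Longrightarrow> smooth_on S (\<lambda>x. \<Sum>i\<in>I. f i x)"
  by (simp add: smooth_on_def Ck_on_sum)

lemma smooth_on_bounded_bilinear:
  "open S \<Longrightarrow> bounded_bilinear B \<Longrightarrow> smooth_on S f \<Longrightarrow> smooth_on S g \<Longrightarrow>
   smooth_on S (\<lambda>x. B (f x) (g x))"
  by (simp add: smooth_on_def Ck_on_bounded_bilinear)

lemma smooth_on_scaleR:
  "open S \<Longrightarrow> smooth_on S f \<Longrightarrow> smooth_on S g \<Longrightarrow> smooth_on S (\<lambda>x. f x *\<^sub>R g x)"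
  by (rule smooth_on_bounded_bilinear[OF _ bounded_bilinear_scaleR])

lemma smooth_on_inner:
  "open S \<Longrightarrow> smooth_on S f \<Longrightarrow> smooth_on S g \<Longrightarrow> smooth_on S (\<lambda>x. f x \<bullet> g x)"
  by (rule smooth_on_bounded_bilinear[OF _ bounded_bilinear_inner])

lemma smooth_on_fst: "open S \<Longrightarrow> smooth_on S f \<Longrightarrow> smooth_on S (\<lambda>x. fst (f x))"
  by (rule smooth_on_bounded_linear[OF _ bounded_linear_fst])

lemma smooth_on_snd: "open S \<Longrightarrow> smooth_on S f \<Longrightarrow> smooth_on S (\<lambda>x. snd (f x))"
  by (rule smooth_on_bounded_linear[OF _ bounded_linear_snd])

lemma smooth_on_Pair:
  assumes "open S" "smooth_on S f" "smooth_on S g"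
  shows "smooth_on S (\<lambda>x. (f x, g x))"
proof -
  have "smooth_on S (\<lambda>x. (f x, 0) + (0, g x))"
    using assms
    by (intro smooth_on_add smooth_on_bounded_linear[where L = "\<lambda>y. (y, 0)"]
        smooth_on_bounded_linear[where L = "\<lambda>y. (0, y)"] bounded_linear_Pair
        bounded_linear_ident bounded_linear_zero)
  then show ?thesis by simp
qed

lemma smooth_on_compose:
  fixes f :: "'a::euclidean_space \<Rightarrow> 'b::euclidean_space" and g :: "'b \<Rightarrow> 'c::real_normed_vector"
  assumes "open S" "open T" "smooth_on S f" "smooth_on T g" "\<And>x. x \<in> S \<Longrightarrow> f x \<in> T"
  shows "smooth_on S (\<lambda>x. g (f x))"
  using assms Ck_on_compose by (fastforce simp: smooth_on_def)

text \<open>Base point and direction vary together, as in the transition maps of a tangent bundle,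
  where the direction is itself a coordinate.\<close>

lemma smooth_on_frechet_derivative:
  fixes f :: "'a::euclidean_space \<Rightarrow> 'b::real_normed_vector" and g :: "'c::euclidean_space \<Rightarrow> 'a"
  assumes "open S" "open T" "smooth_on T f" "smooth_on S g" "smooth_on S h"
    and "\<And>x. x \<in> S \<Longrightarrow> g x \<in> T"
  shows "smooth_on S (\<lambda>x. frechet_derivative f (at (g x)) (h x))"
proof (rule smooth_on_cong[OF assms(1)])
  show "(\<Sum>b\<in>Basis. (h x \<bullet> b) *\<^sub>R frechet_derivative f (at (g x)) b) = frechet_derivative f (at (g x)) (h x)"
    if "x \<in> S" for x
    by (rule linear_eq_sum_Basis[symmetric, OF smooth_on_linear_frechet_derivative[OF assms(3) assms(6)[OF that]]])
  show "smooth_on S (\<lambda>x. \<Sum>b\<in>Basis. (h x \<bullet> b) *\<^sub>R frechet_derivative f (at (g x)) b)"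
    using assms
    by (intro smooth_on_sum smooth_on_scaleR smooth_on_inner smooth_on_const
        smooth_on_compose[OF assms(1,2,4) smooth_on_directional_derivative[OF assms(3)]])
qed

lemmas smooth_on_intros = smooth_on_const smooth_on_ident smooth_on_add smooth_on_minus
  smooth_on_diff smooth_on_scaleR smooth_on_inner smooth_on_fst smooth_on_snd smooth_on_Pair

text \<open>Both mixed second derivatives are limits of the same second difference quotient.\<close>

lemma second_difference_mvt:
  fixes f :: "'a::real_normed_vector \<Rightarrow> real"
  assumes f: "\<And>s t. 0 \<le> s \<Longrightarrow> s \<le> h \<Longrightarrow> 0 \<le> t \<Longrightarrow> t \<le> h \<Longrightarrow>
      (f has_derivative f' (x + s *\<^sub>R u + t *\<^sub>R v)) (at (x + s *\<^sub>R u + t *\<^sub>R v))"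
    and f': "\<And>s t. 0 \<le> s \<Longrightarrow> s \<le> h \<Longrightarrow> 0 \<le> t \<Longrightarrow> t \<le> h \<Longrightarrow>
      ((\<lambda>y. f' y u) has_derivative f'' (x + s *\<^sub>R u + t *\<^sub>R v)) (at (x + s *\<^sub>R u + t *\<^sub>R v))"
    and "0 < h"
  obtains s t where "0 < s" "s < h" "0 < t" "t < h"
    "f (x + h *\<^sub>R u + h *\<^sub>R v) - f (x + h *\<^sub>R u) - f (x + h *\<^sub>R v) + f x
       = h * (h * f'' (x + s *\<^sub>R u + t *\<^sub>R v) v)"
proof -
  have lin: "linear (f' (x + s *\<^sub>R u + t *\<^sub>R v))" "linear (f'' (x + s *\<^sub>R u + t *\<^sub>R v))"
    if "0 \<le> s" "s \<le> h" "0 \<le> t" "t \<le> h" for s t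
    using f[OF that] f'[OF that] has_derivative_linear by auto
  have d1: "((\<lambda>s. f (x + s *\<^sub>R u + t *\<^sub>R v)) has_real_derivative f' (x + s *\<^sub>R u + t *\<^sub>R v) u) (at s)"
    if st: "0 \<le> s" "s \<le> h" "0 \<le> t" "t \<le> h" for s t
  proof -
    have "((\<lambda>s. x + s *\<^sub>R u + t *\<^sub>R v) has_derivative (\<lambda>r. r *\<^sub>R u)) (at s)"
      by (auto intro!: derivative_eq_intros)
    from has_derivative_compose[OF this f[OF st]]
    show ?thesis
      unfolding has_field_derivative_def
      by (rule has_derivative_eq_rhs) (simp add: fun_eq_iff linear_scale[OF lin(1)[OF st]])
  qed
  have d2: "((\<lambda>t. f' (x + s *\<^sub>R u + t *\<^sub>R v) u) has_real_derivative f'' (x + s *\<^sub>R u + t *\<^sub>R v) v) (at t)"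
    if st: "0 \<le> s" "s \<le> h" "0 \<le> t" "t \<le> h" for s t
  proof -
    have "((\<lambda>t. x + s *\<^sub>R u + t *\<^sub>R v) has_derivative (\<lambda>r. r *\<^sub>R v)) (at t)"
      by (auto intro!: derivative_eq_intros)
    from has_derivative_compose[OF this f'[OF st]]
    show ?thesis
      unfolding has_field_derivative_def
      by (rule has_derivative_eq_rhs) (simp add: fun_eq_iff linear_scale[OF lin(2)[OF st]])
  qed
  \<comment> \<open>The increment in direction v, as a function of the step in direction u. The mean
    value theorem in s and then, for the resulting derivative, in t produces the mixed derivative at
    one interior point.\<close>
  define g where "g = (\<lambda>s. f (x + s *\<^sub>R u + h *\<^sub>R v) - f (x + s *\<^sub>R u + 0 *\<^sub>R v))"
  have "\<exists>s>0. s < h \<and> g h - g 0 = (h - 0) * (f' (x + s *\<^sub>R u + h *\<^sub>R v) u - f' (x + s *\<^sub>R u + 0 *\<^sub>R v) u)"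
    unfolding g_def using \<open>0 < h\<close>
    by (intro MVT2 DERIV_diff d1) auto
  then obtain s where s: "0 < s" "s < h"
    "g h - g 0 = h * (f' (x + s *\<^sub>R u + h *\<^sub>R v) u - f' (x + s *\<^sub>R u + 0 *\<^sub>R v) u)" by auto
  have "\<exists>t>0. t < h \<and> f' (x + s *\<^sub>R u + h *\<^sub>R v) u - f' (x + s *\<^sub>R u + 0 *\<^sub>R v) u
      = (h - 0) * f'' (x + s *\<^sub>R u + t *\<^sub>R v) v"
    using \<open>0 < h\<close> s by (intro MVT2 d2) auto
  then obtain t where t: "0 < t" "t < h" "f' (x + s *\<^sub>R u + h *\<^sub>R v) u - f' (x + s *\<^sub>R u + 0 *\<^sub>R v) u
      = h * f'' (x + s *\<^sub>R u + t *\<^sub>R v) v" by auto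
  show ?thesis
    by (rule that[OF s(1,2) t(1,2)]) (use s(3) t(3) in \<open>simp add: g_def algebra_simps\<close>)
qed

lemma frechet_derivative_symmetric_real:
  fixes f :: "'a::real_normed_vector \<Rightarrow> real"
  assumes "open S" "smooth_on S f" "x \<in> S"
  shows "frechet_derivative (\<lambda>y. frechet_derivative f (at y) u) (at x) v
       = frechet_derivative (\<lambda>y. frechet_derivative f (at y) v) (at x) u"
\<comment> \<open>It suffices to bound the difference by every positive e; each of the two mixed
  derivatives contributes e/2 through its continuity at x.\<close>
proof (rule dense_eq0_I[of "_ - _", simplified])
  let ?D = "\<lambda>u v y. frechet_derivative (\<lambda>y. frechet_derivative f (at y) u) (at y) v"
  fix e :: real assume "0 < e"
  have "continuous (at x) (?D u v)" "continuous (at x) (?D v u)"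
    using assms continuous_on_eq_continuous_at
      smooth_on_imp_continuous_on[OF smooth_on_directional_derivative[OF smooth_on_directional_derivative[OF assms(2)]]]
    by blast+
  then have "\<forall>\<^sub>F y in at x. dist (?D u v y) (?D u v x) < e/2 \<and> dist (?D v u y) (?D v u x) < e/2 \<and> y \<in> S"
    using \<open>0 < e\<close> assms(1,3)
    by (intro eventually_conj tendstoD) (auto simp: continuous_at eventually_at_topological)
  then obtain d where "0 < d" and d: "\<And>y. y \<noteq> x \<Longrightarrow> dist y x < d \<Longrightarrow>
      dist (?D u v y) (?D u v x) < e/2 \<and> dist (?D v u y) (?D v u x) < e/2 \<and> y \<in> S"
    unfolding eventually_at by auto
  then have d': "\<And>y. dist y x < d \<Longrightarrow>
      dist (?D u v y) (?D u v x) < e/2 \<and> dist (?D v u y) (?D v u x) < e/2 \<and> y \<in> S"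
    using \<open>0 < e\<close> assms(3) by (metis dist_self half_gt_zero)
  \<comment> \<open>With this step the parallelogram spanned by h u and h v at x stays within
    distance d of x; the summand 1 keeps the denominator positive when u = v = 0.\<close>
  define h where "h = d / (norm u + norm v + 1)"
  have pos: "0 < norm u + norm v + 1"
    by (smt (verit) norm_ge_zero)
  then have "0 < h" using \<open>0 < d\<close> by (simp add: h_def)
  have near: "dist (x + s *\<^sub>R u + t *\<^sub>R v) x < d" "dist (x + s *\<^sub>R v + t *\<^sub>R u) x < d"
    if "0 \<le> s" "s \<le> h" "0 \<le> t" "t \<le> h" for s t
  proof -
    have hd: "h * norm u + h * norm v < d"
    proof -
      have "h * (norm u + norm v + 1) = d" using pos by (simp add: h_def)
      then show ?thesis using \<open>0 < h\<close> by (simp add: algebra_simps)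
    qed
    have *: "norm (s *\<^sub>R a + t *\<^sub>R b) \<le> h * norm a + h * norm b" for a b :: 'a
      using that by (intro norm_triangle_le add_mono) (auto intro: mult_right_mono)
    show "dist (x + s *\<^sub>R u + t *\<^sub>R v) x < d" "dist (x + s *\<^sub>R v + t *\<^sub>R u) x < d"
      using *[of u v] *[of v u] hd by (auto simp: dist_norm add.assoc)
  qed
  obtain s t where st: "0 < s" "s < h" "0 < t" "t < h"
    "f (x + h *\<^sub>R u + h *\<^sub>R v) - f (x + h *\<^sub>R u) - f (x + h *\<^sub>R v) + f x
       = h * (h * ?D u v (x + s *\<^sub>R u + t *\<^sub>R v))"
    by (rule second_difference_mvt[of h f "\<lambda>y. frechet_derivative f (at y)" x u v
          "\<lambda>y. frechet_derivative (\<lambda>y. frechet_derivative f (at y) u) (at y)"])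
       (use near d' \<open>0 < h\<close> smooth_on_has_derivative[OF assms(2)]
         smooth_on_has_derivative[OF smooth_on_directional_derivative[OF assms(2)]] in auto)
  obtain s' t' where st': "0 < s'" "s' < h" "0 < t'" "t' < h"
    "f (x + h *\<^sub>R v + h *\<^sub>R u) - f (x + h *\<^sub>R v) - f (x + h *\<^sub>R u) + f x
       = h * (h * ?D v u (x + s' *\<^sub>R v + t' *\<^sub>R u))"
    by (rule second_difference_mvt[of h f "\<lambda>y. frechet_derivative f (at y)" x v u
          "\<lambda>y. frechet_derivative (\<lambda>y. frechet_derivative f (at y) v) (at y)"])
       (use near d' \<open>0 < h\<close> smooth_on_has_derivative[OF assms(2)]
         smooth_on_has_derivative[OF smooth_on_directional_derivative[OF assms(2)]] in auto)
  \<comment> \<open>Exchanging u and v leaves the second difference unchanged, so the two mixed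
    derivatives take the same value at two intermediate points near x.\<close>
  have swap: "x + h *\<^sub>R v + h *\<^sub>R u = x + h *\<^sub>R u + h *\<^sub>R v" by simp
  have "h * (h * ?D u v (x + s *\<^sub>R u + t *\<^sub>R v)) = h * (h * ?D v u (x + s' *\<^sub>R v + t' *\<^sub>R u))"
    using st(5) st'(5) unfolding swap by linarith
  then have "?D u v (x + s *\<^sub>R u + t *\<^sub>R v) = ?D v u (x + s' *\<^sub>R v + t' *\<^sub>R u)"
    using \<open>0 < h\<close> by simp
  moreover have "dist (?D u v (x + s *\<^sub>R u + t *\<^sub>R v)) (?D u v x) < e/2"
    using d' near(1)[of s t] st by auto
  moreover have "dist (?D v u (x + s' *\<^sub>R v + t' *\<^sub>R u)) (?D v u x) < e/2"
    using d' near(2)[of s' t'] st' by auto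
  ultimately show "\<bar>?D u v x - ?D v u x\<bar> \<le> e"
    unfolding dist_real_def by linarith
qed

lemma frechet_derivative_inner:
  assumes "f differentiable at x"
  shows "frechet_derivative (\<lambda>y. f y \<bullet> b) (at x) v = frechet_derivative f (at x) v \<bullet> b"
  using frechet_derivative_at[OF has_derivative_inner_left[OF assms[unfolded frechet_derivative_works]], symmetric]
  by simp

lemma frechet_derivative_symmetric:
  fixes f :: "'a::real_normed_vector \<Rightarrow> 'b::euclidean_space"
  assumes "open S" "smooth_on S f" "x \<in> S"
  shows "frechet_derivative (\<lambda>y. frechet_derivative f (at y) u) (at x) v
       = frechet_derivative (\<lambda>y. frechet_derivative f (at y) v) (at x) u"
proof (rule euclidean_eqI)
  fix b :: 'b assume "b \<in> Basis"
  have s: "smooth_on S (\<lambda>y. f y \<bullet> b)"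
    using smooth_on_inner[OF assms(1,2) smooth_on_const] .
  have *: "frechet_derivative (\<lambda>y. frechet_derivative f (at y) u) (at x) v \<bullet> b
      = frechet_derivative (\<lambda>y. frechet_derivative (\<lambda>y. f y \<bullet> b) (at y) u) (at x) v" for u v
  proof -
    note d = smooth_on_differentiable[OF smooth_on_directional_derivative[OF assms(2)] assms(3)]
    \<comment> \<open>Taking a component commutes with the inner derivative at every point of the
      open S, so the identity may be differentiated once more.\<close>
    have "frechet_derivative (\<lambda>y. frechet_derivative f (at y) u \<bullet> b) (at x)
        = frechet_derivative (\<lambda>y. frechet_derivative (\<lambda>y. f y \<bullet> b) (at y) u) (at x)"
      by (rule differentiable_cong_open(2)[OF assms(1,3) _
            smooth_on_differentiable[OF smooth_on_directional_derivative[OF s] assms(3)]])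
         (rule frechet_derivative_inner[OF smooth_on_differentiable[OF assms(2)]])
    then show ?thesis using frechet_derivative_inner[OF d] by metis
  qed
  show "frechet_derivative (\<lambda>y. frechet_derivative f (at y) u) (at x) v \<bullet> b
      = frechet_derivative (\<lambda>y. frechet_derivative f (at y) v) (at x) u \<bullet> b"
    unfolding * by (rule frechet_derivative_symmetric_real[OF assms(1) s assms(3)])
qed

section \<open>Charts and their transition maps\<close>

text \<open>The chart conditions of \<open>smooth_manifold\<close>, stated apart because they pass
  from \<open>Q\<close> to products, bundles and \<open>HM_R\<close> by computing transition
  maps.\<close>

definition smooth_atlas :: "('a, 'e::euclidean_space) mfd \<Rightarrow> bool" where
  "smooth_atlas M \<longleftrightarrow>
     (\<forall>c\<in>charts M. is_chart (pts M) c) \<and> (\<forall>c\<in>charts M. \<forall>d\<in>charts M. compatible c d) \<and>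
     (\<forall>p\<in>pts M. pref M p \<in> charts M \<and> p \<in> cdom (pref M p))"

text \<open>\<open>to_coords\<close> and \<open>from_coords\<close> are the instances with the
  preferred chart as source and as target, so one chain rule governs every change of
  components.\<close>

definition jacobian :: "('a, 'e::euclidean_space) chart \<Rightarrow> ('a, 'f::euclidean_space) chart \<Rightarrow> 'a \<Rightarrow> 'e \<Rightarrow> 'f" where
  "jacobian c d p = frechet_derivative (cmap d \<circ> cinv c) (at (cmap c p))"

lemma to_coords_jacobian: "to_coords M c p = jacobian (pref M p) c p"
  by (simp add: to_coords_def jacobian_def)

lemma from_coords_jacobian: "from_coords M c p = jacobian c (pref M p) p"
  by (simp add: from_coords_def jacobian_def)

lemma cinv_cmap: "is_chart X c \<Longrightarrow> p \<in> cdom c \<Longrightarrow> cinv c (cmap c p) = p"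
  by (simp add: is_chart_def)

lemma cmap_cinv: "x \<in> cmap c ` cdom c \<Longrightarrow> cmap c (cinv c x) = x"
  by (rule f_inv_into_f)

lemma cinv_in_cdom: "x \<in> cmap c ` cdom c \<Longrightarrow> cinv c x \<in> cdom c"
  by (rule inv_into_into)

lemma compatible_has_derivative:
  assumes "compatible c d" "p \<in> cdom c" "p \<in> cdom d"
  shows "((cmap d \<circ> cinv c) has_derivative jacobian c d p) (at (cmap c p))"
  unfolding jacobian_def
  by (rule smooth_on_has_derivative[where S = "cmap c ` (cdom c \<inter> cdom d)"])
     (use assms in \<open>auto simp: compatible_def\<close>)

lemma linear_jacobian:
  "compatible c d \<Longrightarrow> p \<in> cdom c \<Longrightarrow> p \<in> cdom d \<Longrightarrow> linear (jacobian c d p)"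
  by (rule has_derivative_linear[OF compatible_has_derivative])

lemma compatible_sym: "compatible c d \<Longrightarrow> compatible d c"
  by (auto simp: compatible_def Int_commute)

lemma jacobian_self:
  assumes "is_chart X c" "p \<in> cdom c"
  shows "jacobian c c p = (\<lambda>v. v)"
proof -
  have "((cmap c \<circ> cinv c) has_derivative (\<lambda>v. v)) (at (cmap c p))"
    by (rule has_derivative_transform_within_open[OF has_derivative_ident, of "cmap c ` cdom c"])
       (use assms in \<open>auto simp: is_chart_def\<close>)
  then show ?thesis unfolding jacobian_def by (metis frechet_derivative_at)
qed

lemma jacobian_chain:
  assumes "is_chart X c" "is_chart X d" "compatible c d" "compatible d e"
    and "p \<in> cdom c" "p \<in> cdom d" "p \<in> cdom e"
  shows "jacobian d e p (jacobian c d p v) = jacobian c e p v"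
proof -
  have dp: "(cmap d \<circ> cinv c) (cmap c p) = cmap d p"
    using assms by (simp add: cinv_cmap)
  have "((\<lambda>x. (cmap e \<circ> cinv d) ((cmap d \<circ> cinv c) x)) has_derivative
      (\<lambda>v. jacobian d e p (jacobian c d p v))) (at (cmap c p))"
    by (rule has_derivative_compose[OF compatible_has_derivative[OF assms(3,5,6)]])
       (unfold dp, rule compatible_has_derivative[OF assms(4,6,7)])
  then have "((cmap e \<circ> cinv c) has_derivative
      (\<lambda>v. jacobian d e p (jacobian c d p v))) (at (cmap c p))"
    by (rule has_derivative_transform_within_open[where s = "cmap c ` (cdom c \<inter> cdom d)"])
       (use assms in \<open>auto simp: compatible_def cinv_cmap\<close>)
  then show ?thesis unfolding jacobian_def[of c e] by (metis frechet_derivative_at)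
qed

text \<open>Both sides differentiate one map, f read from \<open>c\<close> to \<open>d'\<close>, in
  two factorisations that agree on the overlap. With a bundle projection for f, this yields a
  component of the Jacobian upstairs from the Jacobian of the base.\<close>

lemma jacobian_natural:
  assumes "is_chart X c" "compatible c c'" "is_chart Y d" "compatible d d'"
    and p: "p \<in> cdom c" "p \<in> cdom c'"
    and f: "\<And>q. q \<in> cdom c \<Longrightarrow> q \<in> cdom c' \<Longrightarrow> f q \<in> cdom d \<and> f q \<in> cdom d' \<and>
              cmap d (f q) = F (cmap c q) \<and> cmap d' (f q) = F' (cmap c' q)"
    and F: "(F has_derivative DF) (at (cmap c p))" "(F' has_derivative DF') (at (cmap c' p))"
  shows "DF' (jacobian c c' p v) = jacobian d d' (f p) (DF v)"
proof -
  have c'p: "(cmap c' \<circ> cinv c) (cmap c p) = cmap c' p"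
    using assms by (simp add: cinv_cmap)
  have "((\<lambda>x. F' ((cmap c' \<circ> cinv c) x)) has_derivative (\<lambda>v. DF' (jacobian c c' p v))) (at (cmap c p))"
    by (rule has_derivative_compose[OF compatible_has_derivative[OF assms(2) p]])
       (unfold c'p, rule F(2))
  moreover have "((\<lambda>x. F' ((cmap c' \<circ> cinv c) x)) has_derivative (\<lambda>v. jacobian d d' (f p) (DF v))) (at (cmap c p))"
  proof (rule has_derivative_transform_within_open[where s = "cmap c ` (cdom c \<inter> cdom c')"])
    show "((\<lambda>x. (cmap d' \<circ> cinv d) (F x)) has_derivative (\<lambda>v. jacobian d d' (f p) (DF v))) (at (cmap c p))"
      by (rule has_derivative_compose[OF F(1)])
         (use compatible_has_derivative[OF assms(4), of "f p"] f[OF p] in \<open>simp add: o_def\<close>)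
    fix x assume "x \<in> cmap c ` (cdom c \<inter> cdom c')"
    then obtain q where q: "q \<in> cdom c" "q \<in> cdom c'" "x = cmap c q" by blast
    have "cinv d (cmap d (f q)) = f q"
      by (rule cinv_cmap[OF assms(3)]) (use f[OF q(1,2)] in blast)
    moreover have "F x = cmap d (f q)"
      using f[OF q(1,2)] q(3) by simp
    ultimately show "(cmap d' \<circ> cinv d) (F x) = F' ((cmap c' \<circ> cinv c) x)"
      using q f[OF q(1,2)] cinv_cmap[OF assms(1)] by simp
  qed (use assms in \<open>auto simp: compatible_def\<close>)
  ultimately show ?thesis
    using has_derivative_unique by metis
qed

section \<open>Basic facts about smooth atlases\<close>

lemma smooth_atlas_chart: "smooth_atlas M \<Longrightarrow> c \<in> charts M \<Longrightarrow> is_chart (pts M) c"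
  by (simp add: smooth_atlas_def)

lemma smooth_atlas_cinv: "smooth_atlas M \<Longrightarrow> c \<in> charts M \<Longrightarrow> p \<in> cdom c \<Longrightarrow> cinv c (cmap c p) = p"
  by (rule cinv_cmap[OF smooth_atlas_chart])

lemma smooth_atlas_compatible:
  "smooth_atlas M \<Longrightarrow> c \<in> charts M \<Longrightarrow> d \<in> charts M \<Longrightarrow> compatible c d"
  by (simp add: smooth_atlas_def)

lemma smooth_atlas_pref:
  "smooth_atlas M \<Longrightarrow> p \<in> pts M \<Longrightarrow> pref M p \<in> charts M"
  "smooth_atlas M \<Longrightarrow> p \<in> pts M \<Longrightarrow> p \<in> cdom (pref M p)"
  by (simp_all add: smooth_atlas_def)

lemma smooth_atlas_pts: "smooth_atlas M \<Longrightarrow> c \<in> charts M \<Longrightarrow> p \<in> cdom c \<Longrightarrow> p \<in> pts M"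
  by (auto simp: smooth_atlas_def is_chart_def)

lemma smooth_atlas_open:
  "smooth_atlas M \<Longrightarrow> c \<in> charts M \<Longrightarrow> open (cmap c ` cdom c)"
  by (auto simp: smooth_atlas_def is_chart_def)

lemma smooth_atlas_overlap:
  assumes "smooth_atlas M" "c \<in> charts M" "d \<in> charts M"
  shows "open (cmap c ` (cdom c \<inter> cdom d))"
    "smooth_on (cmap c ` (cdom c \<inter> cdom d)) (cmap d \<circ> cinv c)"
  using assms by (auto simp: smooth_atlas_def compatible_def)

lemma smooth_manifold_atlas: "smooth_manifold M \<Longrightarrow> smooth_atlas M"
  by (simp add: smooth_manifold_def smooth_atlas_def)

text \<open>Ordered pairs suffice: (d, c) supplies the inverse of the transition of (c, d), and (c,
  c) gives the open chart image. The witness \<phi> has to agree with the transition map only on the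
  overlap.\<close>

lemma smooth_atlasI:
  assumes "\<And>c. c \<in> charts M \<Longrightarrow> cdom c \<subseteq> pts M \<and> inj_on (cmap c) (cdom c)"
    and "\<And>c d. c \<in> charts M \<Longrightarrow> d \<in> charts M \<Longrightarrow> \<exists>\<phi>. open (cmap c ` (cdom c \<inter> cdom d)) \<and>
        smooth_on (cmap c ` (cdom c \<inter> cdom d)) \<phi> \<and> (\<forall>p\<in>cdom c \<inter> cdom d. cmap d p = \<phi> (cmap c p))"
    and "\<And>p. p \<in> pts M \<Longrightarrow> pref M p \<in> charts M \<and> p \<in> cdom (pref M p)"
  shows "smooth_atlas M"
proof -
  have *: "open (cmap c ` (cdom c \<inter> cdom d)) \<and> smooth_on (cmap c ` (cdom c \<inter> cdom d)) (cmap d \<circ> cinv c)"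
    if cd: "c \<in> charts M" "d \<in> charts M" for c d
  proof -
    obtain \<phi> where \<phi>: "open (cmap c ` (cdom c \<inter> cdom d))" "smooth_on (cmap c ` (cdom c \<inter> cdom d)) \<phi>"
      "\<forall>p\<in>cdom c \<inter> cdom d. cmap d p = \<phi> (cmap c p)" using assms(2)[OF cd] by blast
    have "smooth_on (cmap c ` (cdom c \<inter> cdom d)) (cmap d \<circ> cinv c)"
      by (rule smooth_on_cong[OF \<phi>(1) _ \<phi>(2)]) (use \<phi>(3) assms(1)[OF cd(1)] in auto)
    with \<phi>(1) show ?thesis by simp
  qed
  have "is_chart (pts M) c" if "c \<in> charts M" for c
    using assms(1)[OF that] *[OF that that] by (simp add: is_chart_def)
  moreover have "compatible c d" if "c \<in> charts M" "d \<in> charts M" for c d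
    using *[OF that] *[OF that(2,1)] by (simp add: compatible_def Int_commute)
  ultimately show ?thesis using assms(3) by (simp add: smooth_atlas_def)
qed

section \<open>Components of vectors in the charts of one atlas\<close>

context
  fixes M :: "('a, 'e::euclidean_space) mfd"
  assumes M: "smooth_atlas M"
begin

lemma jacobian_chart_chain:
  assumes "c \<in> charts M" "d \<in> charts M" "e \<in> charts M" "p \<in> cdom c" "p \<in> cdom d" "p \<in> cdom e"
  shows "jacobian d e p (jacobian c d p v) = jacobian c e p v"
  using jacobian_chain[OF smooth_atlas_chart[OF M] smooth_atlas_chart[OF M]
      smooth_atlas_compatible[OF M] smooth_atlas_compatible[OF M]] assms by blast

lemma linear_chart_jacobian:
  "c \<in> charts M \<Longrightarrow> d \<in> charts M \<Longrightarrow> p \<in> cdom c \<Longrightarrow> p \<in> cdom d \<Longrightarrow> linear (jacobian c d p)"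
  by (rule linear_jacobian[OF smooth_atlas_compatible[OF M]])

lemma linear_to_coords: "c \<in> charts M \<Longrightarrow> p \<in> cdom c \<Longrightarrow> linear (to_coords M c p)"
  unfolding to_coords_jacobian
  using linear_chart_jacobian smooth_atlas_pref[OF M] smooth_atlas_pts[OF M] by blast

lemma linear_from_coords: "c \<in> charts M \<Longrightarrow> p \<in> cdom c \<Longrightarrow> linear (from_coords M c p)"
  unfolding from_coords_jacobian
  using linear_chart_jacobian smooth_atlas_pref[OF M] smooth_atlas_pts[OF M] by blast

lemma to_coords_from_coords:
  assumes "c \<in> charts M" "d \<in> charts M" "p \<in> cdom c" "p \<in> cdom d"
  shows "to_coords M d p (from_coords M c p v) = jacobian c d p v"
  unfolding to_coords_jacobian from_coords_jacobian
  using jacobian_chart_chain assms smooth_atlas_pref[OF M] smooth_atlas_pts[OF M] by blast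

lemma from_coords_to_coords: "c \<in> charts M \<Longrightarrow> p \<in> cdom c \<Longrightarrow> from_coords M c p (to_coords M c p v) = v"
  unfolding to_coords_jacobian from_coords_jacobian
  using jacobian_chart_chain smooth_atlas_pref[OF M] smooth_atlas_pts[OF M]
    jacobian_self[OF smooth_atlas_chart[OF M]] by metis

lemma to_coords_from_coords_self:
  "c \<in> charts M \<Longrightarrow> p \<in> cdom c \<Longrightarrow> to_coords M c p (from_coords M c p v) = v"
  using to_coords_from_coords jacobian_self[OF smooth_atlas_chart[OF M]] by metis

lemma from_coords_change:
  assumes "c \<in> charts M" "d \<in> charts M" "p \<in> cdom c" "p \<in> cdom d"
  shows "from_coords M d p v = from_coords M c p (jacobian d c p v)"
  unfolding from_coords_jacobian
  using jacobian_chart_chain assms smooth_atlas_pref[OF M] smooth_atlas_pts[OF M] by metis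

lemma to_coords_change:
  assumes "c \<in> charts M" "d \<in> charts M" "p \<in> cdom c" "p \<in> cdom d"
  shows "to_coords M d p v = jacobian c d p (to_coords M c p v)"
  unfolding to_coords_jacobian
  using jacobian_chart_chain assms smooth_atlas_pref[OF M] smooth_atlas_pts[OF M] by metis

lemma to_coords_pref: "p \<in> pts M \<Longrightarrow> to_coords M (pref M p) p = (\<lambda>v. v)"
  unfolding to_coords_jacobian using jacobian_self smooth_atlas_pref[OF M] smooth_atlas_chart[OF M] by metis

lemma from_coords_pref: "p \<in> pts M \<Longrightarrow> from_coords M (pref M p) p = (\<lambda>v. v)"
  unfolding from_coords_jacobian using jacobian_self smooth_atlas_pref[OF M] smooth_atlas_chart[OF M] by metis

text \<open>The target chart is frozen at the one preferred at \<open>f p\<close> while q varies, so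
  F is a single coordinate expression that can be differentiated.\<close>

lemma tangent_map_eq:
  assumes "p \<in> pts M"
    and "\<And>q. q \<in> cdom (pref M p) \<Longrightarrow> cmap (pref N (f p)) (f q) = F (cmap (pref M p) q)"
    and "(F has_derivative F') (at (cmap (pref M p) p))"
  shows "tangent_map M N f p = F'"
proof -
  let ?c = "pref M p"
  have c: "is_chart (pts M) ?c" "p \<in> cdom ?c"
    using assms(1) smooth_atlas_pref[OF M] smooth_atlas_chart[OF M] by auto
  have "((cmap (pref N (f p)) \<circ> f \<circ> cinv ?c) has_derivative F') (at (cmap ?c p))"
    by (rule has_derivative_transform_within_open[OF assms(3), of "cmap ?c ` cdom ?c"])
       (use c assms(2) in \<open>auto simp: is_chart_def\<close>)
  then show ?thesis unfolding tangent_map_def by (metis frechet_derivative_at)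
qed

lemma local_form_cmap:
  "c \<in> charts M \<Longrightarrow> p \<in> cdom c \<Longrightarrow> local_form M c \<theta> (cmap c p) v = \<theta> p (from_coords M c p v)"
  by (simp add: local_form_def smooth_atlas_cinv[OF M])

text \<open>The coordinate formula for the exterior derivative is the same in every chart: the second
  derivatives of the transition map enter symmetrically and cancel.\<close>

lemma ext_d_chart:
  assumes c: "c \<in> charts M" "p \<in> cdom c"
    and lin: "\<And>q. q \<in> cdom c \<Longrightarrow> linear (\<theta> q)"
    and diff: "\<And>w. (\<lambda>y. local_form M c \<theta> y w) differentiable at (cmap c p)"
  shows "ext_d M \<theta> p v w =
      frechet_derivative (\<lambda>y. local_form M c \<theta> y (to_coords M c p w)) (at (cmap c p)) (to_coords M c p v)
    - frechet_derivative (\<lambda>y. local_form M c \<theta> y (to_coords M c p v)) (at (cmap c p)) (to_coords M c p w)"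
proof -
  let ?e = "pref M p"
  define x \<tau> U where "x = cmap ?e p" and "\<tau> = cmap c \<circ> cinv ?e" and "U = cmap ?e ` (cdom ?e \<inter> cdom c)"
  define T where "T = frechet_derivative \<tau> (at x)"
  define g g' where "g = (\<lambda>b y. local_form M c \<theta> y b)"
    and "g' = (\<lambda>b. frechet_derivative (g b) (at (cmap c p)))"
  have p: "p \<in> pts M" using c smooth_atlas_pts[OF M] by blast
  have e: "?e \<in> charts M" "p \<in> cdom ?e" using p smooth_atlas_pref[OF M] by auto
  have U: "open U" "x \<in> U" "smooth_on U \<tau>"
    using smooth_atlas_overlap[OF M e(1) c(1)] e c by (auto simp: U_def x_def \<tau>_def)
  have \<tau>x: "\<tau> x = cmap c p"
    using e by (simp add: \<tau>_def x_def smooth_atlas_cinv[OF M])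
  have T: "T = to_coords M c p"
    by (simp add: T_def to_coords_def \<tau>_def x_def)
  have T': "(\<tau> has_derivative T) (at x)"
    unfolding T_def using smooth_on_has_derivative[OF U(3,2)] .
  have g': "(g b has_derivative g' b) (at (cmap c p))" for b
    using diff frechet_derivative_works by (auto simp: g_def g'_def)
  have lin_g: "linear (\<lambda>b. g b (cmap c q))" if "q \<in> cdom c" for q
    unfolding g_def local_form_cmap[OF c(1) that]
    using linear_compose[OF linear_from_coords[OF c(1) that] lin[OF that]] by (simp add: o_def)
  define d2 where "d2 = (\<lambda>w. frechet_derivative (\<lambda>y. frechet_derivative \<tau> (at y) w) (at x))"
  have d2: "((\<lambda>y. frechet_derivative \<tau> (at y) w) has_derivative d2 w) (at x)" for w
    unfolding d2_def using smooth_on_has_derivative[OF smooth_on_directional_derivative[OF U(3)] U(2)] .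
  \<comment> \<open>On U the form in the preferred chart is the form in \<open>c\<close> at \<tau>
    y, fed with D\<tau>(y) w. The product rule splits its derivative: the sum with \<open>d2\<close>
    holds the second derivative of \<tau>, the other sum becomes the formula in
    \<open>c\<close>.\<close>
  have loc: "frechet_derivative (\<lambda>y. local_form M ?e \<theta> y w) (at x) v
      = (\<Sum>b\<in>Basis. (d2 w v \<bullet> b) * g b (cmap c p)) + (\<Sum>b\<in>Basis. (T w \<bullet> b) * g' b (T v))" for v w
  proof -
    have "((\<lambda>y. \<Sum>b\<in>Basis. (frechet_derivative \<tau> (at y) w \<bullet> b) * g b (\<tau> y)) has_derivative
        (\<lambda>v. \<Sum>b\<in>Basis. (T w \<bullet> b) * g' b (T v) + (d2 w v \<bullet> b) * g b (cmap c p))) (at x)"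
      using has_derivative_mult[OF has_derivative_inner_left[OF d2]
          has_derivative_compose[OF T' g'[folded \<tau>x]]]
      by (intro has_derivative_sum) (simp add: \<tau>x T_def)
    then have "((\<lambda>y. local_form M ?e \<theta> y w) has_derivative
        (\<lambda>v. \<Sum>b\<in>Basis. (T w \<bullet> b) * g' b (T v) + (d2 w v \<bullet> b) * g b (cmap c p))) (at x)"
    proof (rule has_derivative_transform_within_open[OF _ U(1,2)])
      fix y assume "y \<in> U"
      then obtain q where q: "q \<in> cdom ?e" "q \<in> cdom c" "y = cmap ?e q" by (auto simp: U_def)
      have \<tau>y: "\<tau> y = cmap c q" using q e by (simp add: \<tau>_def smooth_atlas_cinv[OF M])
      have "local_form M ?e \<theta> y w = \<theta> q (from_coords M c q (jacobian ?e c q w))"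
        using from_coords_change[OF c(1) e(1) q(2,1)] local_form_cmap[OF e(1) q(1)] q(3) by simp
      also have "\<dots> = g (frechet_derivative \<tau> (at y) w) (cmap c q)"
        using local_form_cmap[OF c(1) q(2)] by (simp add: g_def jacobian_def \<tau>_def q(3))
      also have "\<dots> = (\<Sum>b\<in>Basis. (frechet_derivative \<tau> (at y) w \<bullet> b) * g b (\<tau> y))"
        using linear_eq_sum_Basis[OF lin_g[OF q(2)]] unfolding \<tau>y real_scaleR_def .
      finally show "(\<Sum>b\<in>Basis. (frechet_derivative \<tau> (at y) w \<bullet> b) * g b (\<tau> y)) = local_form M ?e \<theta> y w"
        by simp
    qed
    then show ?thesis
      by (subst frechet_derivative_at[symmetric], assumption) (simp add: sum.distrib)
  qed
  \<comment> \<open>The form is linear in its argument at every point of the chart, so the basis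
    expansion can be undone under the derivative.\<close>
  have sum_g': "(\<Sum>b\<in>Basis. (w \<bullet> b) * g' b v) = frechet_derivative (g w) (at (cmap c p)) v" for v w
  proof -
    have "((\<lambda>y. \<Sum>b\<in>Basis. (w \<bullet> b) * g b y) has_derivative (\<lambda>v. \<Sum>b\<in>Basis. (w \<bullet> b) * g' b v)) (at (cmap c p))"
      by (intro has_derivative_sum has_derivative_mult_right g')
    then have "(g w has_derivative (\<lambda>v. \<Sum>b\<in>Basis. (w \<bullet> b) * g' b v)) (at (cmap c p))"
    proof (rule has_derivative_transform_within_open[OF _ smooth_atlas_open[OF M c(1)]])
      fix y assume "y \<in> cmap c ` cdom c"
      then obtain q where q: "q \<in> cdom c" "y = cmap c q" by blast
      show "(\<Sum>b\<in>Basis. (w \<bullet> b) * g b y) = g w y"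
        unfolding q(2) using linear_eq_sum_Basis[OF lin_g[OF q(1)], of w] by (simp only: real_scaleR_def)
    qed (use c in simp)
    then show ?thesis by (rule fun_cong[OF frechet_derivative_at])
  qed
  \<comment> \<open>Makes the two \<open>d2\<close> sums cancel in the antisymmetrised
    expression.\<close>
  have "d2 w v = d2 v w"
    unfolding d2_def by (rule frechet_derivative_symmetric[OF U(1,3,2)])
  then show ?thesis
    unfolding ext_d_def Let_def loc[unfolded x_def] sum_g' by (simp add: T g_def)
qed

end

section \<open>Smoothness checked in suitable charts\<close>

text \<open>\<open>topology\<close> returns a predicate as its open sets only once that predicate is
  shown to be a topology; intersections rest on the injectivity of charts.\<close>

lemma openin_mfd_topology:
  assumes "smooth_atlas M"
  shows "openin (mfd_topology M) U \<longleftrightarrow> U \<subseteq> pts M \<and> (\<forall>c\<in>charts M. open (cmap c ` (cdom c \<inter> U)))"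
proof -
  have "istopology (\<lambda>U. U \<subseteq> pts M \<and> (\<forall>c\<in>charts M. open (cmap c ` (cdom c \<inter> U))))"
    unfolding istopology_def
  proof (intro conjI allI impI ballI)
    fix S T c assume S: "S \<subseteq> pts M \<and> (\<forall>c\<in>charts M. open (cmap c ` (cdom c \<inter> S)))"
      and T: "T \<subseteq> pts M \<and> (\<forall>c\<in>charts M. open (cmap c ` (cdom c \<inter> T)))" and c: "c \<in> charts M"
    have "inj_on (cmap c) (cdom c)" using c smooth_atlas_chart[OF assms] by (simp add: is_chart_def)
    then have "cmap c ` (cdom c \<inter> (S \<inter> T)) = cmap c ` (cdom c \<inter> S) \<inter> cmap c ` (cdom c \<inter> T)"
      by (auto simp: inj_on_def)
    then show "open (cmap c ` (cdom c \<inter> (S \<inter> T)))" using S T c by auto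
  next
    fix K c assume "\<forall>U\<in>K. U \<subseteq> pts M \<and> (\<forall>c\<in>charts M. open (cmap c ` (cdom c \<inter> U)))" "c \<in> charts M"
    moreover have "cmap c ` (cdom c \<inter> \<Union>K) = (\<Union>U\<in>K. cmap c ` (cdom c \<inter> U))" by auto
    ultimately show "open (cmap c ` (cdom c \<inter> \<Union>K))" by auto
  qed auto
  then show ?thesis by (simp add: mfd_topology_def)
qed

lemma topspace_mfd_topology:
  assumes "smooth_atlas M"
  shows "topspace (mfd_topology M) = pts M"
proof -
  have "openin (mfd_topology M) (pts M)"
    using smooth_atlas_chart[OF assms]
    by (auto simp: openin_mfd_topology[OF assms] is_chart_def Int_absorb2)
  moreover have "topspace (mfd_topology M) \<subseteq> pts M"
    using openin_topspace openin_mfd_topology[OF assms] by blast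
  ultimately show ?thesis by (simp add: openin_subset subset_antisym)
qed

lemma openin_cdom: "smooth_atlas M \<Longrightarrow> c \<in> charts M \<Longrightarrow> openin (mfd_topology M) (cdom c)"
  using smooth_atlas_overlap(1)[of M _ c] smooth_atlas_pts[of M c]
  by (auto simp: openin_mfd_topology)

lemma open_chart_image:
  "smooth_atlas M \<Longrightarrow> c \<in> charts M \<Longrightarrow> openin (mfd_topology M) U \<Longrightarrow> open (cmap c ` (cdom c \<inter> U))"
  by (simp add: openin_mfd_topology)

lemma openin_chart_preimage:
  assumes M: "smooth_atlas M" and c: "c \<in> charts M" and W: "open W"
  shows "openin (mfd_topology M) {p \<in> cdom c. cmap c p \<in> W}"
  unfolding openin_mfd_topology[OF M]
proof (intro conjI ballI)
  show "{p \<in> cdom c. cmap c p \<in> W} \<subseteq> pts M" using smooth_atlas_pts[OF M c] by blast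
  fix d assume d: "d \<in> charts M"
  have "open ((cmap c \<circ> cinv d) -` W \<inter> cmap d ` (cdom d \<inter> cdom c))"
    using smooth_on_imp_continuous_on[OF smooth_atlas_overlap(2)[OF M d c]]
      continuous_on_open_vimage[OF smooth_atlas_overlap(1)[OF M d c]] W by blast
  moreover have "(cmap c \<circ> cinv d) -` W \<inter> cmap d ` (cdom d \<inter> cdom c)
      = cmap d ` (cdom d \<inter> {p \<in> cdom c. cmap c p \<in> W})"
    using smooth_atlas_cinv[OF M d] by auto
  ultimately show "open (cmap d ` (cdom d \<inter> {p \<in> cdom c. cmap c p \<in> W}))" by simp
qed

lemma smooth_on_local:
  assumes "\<And>x. x \<in> S \<Longrightarrow> \<exists>U. open U \<and> x \<in> U \<and> smooth_on U f"
  shows "smooth_on S f"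
proof -
  have "Ck_on k S f" if "\<And>x. x \<in> S \<Longrightarrow> \<exists>U. open U \<and> x \<in> U \<and> Ck_on k U f" for k
    using that
  proof (induction k arbitrary: f)
    case 0
    then show ?case
      by (metis Ck_on.simps(1) continuous_at_imp_continuous_on continuous_on_eq_continuous_at)
  next
    case (Suc k)
    then show ?case by (fastforce simp: Ck_on.simps(2))
  qed
  then show ?thesis using assms unfolding smooth_on_def by meson
qed

text \<open>\<open>smooth_map\<close> quantifies over all pairs of charts; one pair around each
  point is enough, because any other pair differs from it by transition maps. Continuity comes
  first: it makes the set of points sent into a given target chart open, and the comparison takes
  place there.\<close>

lemma smooth_map_chartwise:
  fixes M :: "('a, 'e::euclidean_space) mfd" and N :: "('b, 'f::euclidean_space) mfd"
  assumes M: "smooth_atlas M" and N: "smooth_atlas N"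
    and f: "\<And>p. p \<in> pts M \<Longrightarrow> \<exists>c\<in>charts M. \<exists>d\<in>charts N. \<exists>F. p \<in> cdom c \<and> f ` cdom c \<subseteq> cdom d \<and>
        smooth_on (cmap c ` cdom c) F \<and> (\<forall>q\<in>cdom c. cmap d (f q) = F (cmap c q))"
  shows "smooth_map M N f"
proof -
  have cont: "continuous_map (mfd_topology M) (mfd_topology N) f"
    unfolding continuous_map_def topspace_mfd_topology[OF M] topspace_mfd_topology[OF N]
  proof (intro conjI allI impI)
    show "f \<in> pts M \<rightarrow> pts N"
      using f smooth_atlas_pts[OF N] by blast
    fix V assume V: "openin (mfd_topology N) V"
    show "openin (mfd_topology M) {p \<in> pts M. f p \<in> V}"
    proof (subst openin_subopen, intro ballI)
      fix p assume "p \<in> {p \<in> pts M. f p \<in> V}"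
      then have p: "p \<in> pts M" "f p \<in> V" by auto
      obtain c d F where c: "c \<in> charts M" "p \<in> cdom c" and d: "d \<in> charts N" "f ` cdom c \<subseteq> cdom d"
        and F: "smooth_on (cmap c ` cdom c) F" "\<forall>q\<in>cdom c. cmap d (f q) = F (cmap c q)"
        using f[OF p(1)] by blast
      \<comment> \<open>The coordinates of the points of \<open>cdom c\<close> that f sends into V;
        F is continuous on the open chart image, hence W is open.\<close>
      define W where "W = F -` (cmap d ` (cdom d \<inter> V)) \<inter> cmap c ` cdom c"
      have "open W"
        unfolding W_def using smooth_on_imp_continuous_on[OF F(1)]
          continuous_on_open_vimage[OF smooth_atlas_open[OF M c(1)]] open_chart_image[OF N d(1) V] by blast
      then have "openin (mfd_topology M) {q \<in> cdom c. cmap c q \<in> W}"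
        by (rule openin_chart_preimage[OF M c(1)])
      moreover have "f q \<in> V" if q: "q \<in> cdom c" "cmap c q \<in> W" for q
      proof -
        have "cmap d (f q) \<in> cmap d ` (cdom d \<inter> V)" using q F(2) by (auto simp: W_def)
        moreover have "inj_on (cmap d) (cdom d)" "f q \<in> cdom d"
          using d q smooth_atlas_chart[OF N] by (auto simp: is_chart_def)
        ultimately show ?thesis by (auto simp: inj_on_def)
      qed
      moreover have "cmap c p \<in> W"
        using c p d F(2)[rule_format, OF c(2), symmetric] by (auto simp: W_def)
      ultimately show "\<exists>T. openin (mfd_topology M) T \<and> p \<in> T \<and> T \<subseteq> {p \<in> pts M. f p \<in> V}"
        using c smooth_atlas_pts[OF M c(1)] by (intro exI[of _ "{q \<in> cdom c. cmap c q \<in> W}"]) auto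
    qed
  qed
  moreover have "smooth_on (cmap c0 ` (cdom c0 \<inter> f -` cdom d0)) (cmap d0 \<circ> f \<circ> cinv c0)"
    if c0: "c0 \<in> charts M" and d0: "d0 \<in> charts N" for c0 d0
  proof (rule smooth_on_local)
    fix x assume "x \<in> cmap c0 ` (cdom c0 \<inter> f -` cdom d0)"
    then obtain p where p: "p \<in> cdom c0" "f p \<in> cdom d0" "x = cmap c0 p" by auto
    have pM: "p \<in> pts M" using p smooth_atlas_pts[OF M c0] by blast
    obtain c d F where c: "c \<in> charts M" "p \<in> cdom c" and d: "d \<in> charts N" "f ` cdom c \<subseteq> cdom d"
      and F: "smooth_on (cmap c ` cdom c) F" "\<forall>q\<in>cdom c. cmap d (f q) = F (cmap c q)"
      using f[OF pM] by blast
    define V where "V = cdom c \<inter> {q \<in> pts M. f q \<in> cdom d0}"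
    define U where "U = cmap c0 ` (cdom c0 \<inter> V)"
    have "openin (mfd_topology M) {q \<in> topspace (mfd_topology M). f q \<in> cdom d0}"
      by (rule openin_continuous_map_preimage[OF cont openin_cdom[OF N d0]])
    then have U: "open U"
      unfolding U_def V_def topspace_mfd_topology[OF M]
      by (intro open_chart_image[OF M c0] openin_Int openin_cdom[OF M c(1)])
    have inv: "cinv c0 (cmap c0 q) = q" if "q \<in> cdom c0" for q
      using that smooth_atlas_cinv[OF M c0] by simp
    have tr: "smooth_on U (cmap c \<circ> cinv c0)"
      by (rule smooth_on_subset[OF smooth_atlas_overlap(2)[OF M c0 c(1)]]) (auto simp: U_def V_def)
    have sm: "smooth_on U (\<lambda>x. (cmap d0 \<circ> cinv d) (F ((cmap c \<circ> cinv c0) x)))"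
    proof (rule smooth_on_compose[OF U smooth_atlas_overlap(1)[OF N d(1) d0], where f = "\<lambda>x. F ((cmap c \<circ> cinv c0) x)"])
      show "smooth_on U (\<lambda>x. F ((cmap c \<circ> cinv c0) x))"
        by (rule smooth_on_compose[OF U smooth_atlas_open[OF M c(1)] tr F(1)])
           (auto simp: U_def V_def inv)
      show "smooth_on (cmap d ` (cdom d \<inter> cdom d0)) (cmap d0 \<circ> cinv d)"
        by (rule smooth_atlas_overlap[OF N d(1) d0])
      show "F ((cmap c \<circ> cinv c0) x) \<in> cmap d ` (cdom d \<inter> cdom d0)" if "x \<in> U" for x
        using that d(2) F(2)[rule_format, symmetric] by (auto simp: U_def V_def inv)
    qed
    have "smooth_on U (cmap d0 \<circ> f \<circ> cinv c0)"
    proof (rule smooth_on_cong[OF U _ sm])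
      fix x assume "x \<in> U"
      then obtain q where q: "q \<in> cdom c0" "q \<in> cdom c" "x = cmap c0 q" by (auto simp: U_def V_def)
      have "cinv d (cmap d (f q)) = f q"
        using q d smooth_atlas_cinv[OF N d(1)] by blast
      then show "(cmap d0 \<circ> cinv d) (F ((cmap c \<circ> cinv c0) x)) = (cmap d0 \<circ> f \<circ> cinv c0) x"
        using q F(2) by (simp add: inv)
    qed
    then show "\<exists>U. open U \<and> x \<in> U \<and> smooth_on U (cmap d0 \<circ> f \<circ> cinv c0)"
      using U p c pM by (intro exI[of _ U]) (auto simp: U_def V_def)
  qed
  ultimately show ?thesis by (simp add: smooth_map_def)
qed

text \<open>Fits maps that read as one formula F in all charts induced by \<open>Q\<close>, which
  index both atlases. The equivalence \<open>dom\<close> puts two points with the same image into a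
  common chart, where the left inverse G separates them; \<open>img\<close> gives surjectivity, and
  G is the coordinate expression of the inverse.\<close>

lemma diffeo_chartwise:
  fixes M :: "('a, 'e::euclidean_space) mfd" and N :: "('b, 'f::euclidean_space) mfd"
  assumes M: "smooth_atlas M" and N: "smooth_atlas N"
    and charts: "charts M = C ` I" "charts N = D ` I"
    and dom: "\<And>i p. i \<in> I \<Longrightarrow> p \<in> pts M \<Longrightarrow> f p \<in> cdom (D i) \<longleftrightarrow> p \<in> cdom (C i)"
    and img: "\<And>i. i \<in> I \<Longrightarrow> F ` cmap (C i) ` cdom (C i) = cmap (D i) ` cdom (D i)"
    and f: "\<And>i p. i \<in> I \<Longrightarrow> p \<in> cdom (C i) \<Longrightarrow> cmap (D i) (f p) = F (cmap (C i) p)"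
    and F: "smooth_on UNIV F" "smooth_on UNIV G" "\<And>x. G (F x) = x"
  shows "diffeo M N f"
proof -
  have C: "is_chart (pts M) (C i)" and D: "is_chart (pts N) (D i)" if "i \<in> I" for i
    using smooth_atlas_chart[OF M] smooth_atlas_chart[OF N] charts that by auto
  have CD: "f p \<in> cdom (D i)" if "i \<in> I" "p \<in> cdom (C i)" for i p
    using that dom C by (auto simp: is_chart_def)
  have inj: "inj_on f (pts M)"
  proof (rule inj_onI)
    fix p q assume pq: "p \<in> pts M" "q \<in> pts M" "f p = f q"
    obtain i where i: "i \<in> I" "p \<in> cdom (C i)"
      using pq(1) smooth_atlas_pref[OF M] charts by (metis imageE)
    then have "q \<in> cdom (C i)" using CD[OF i] dom pq by metis
    moreover from this have "G (F (cmap (C i) p)) = G (F (cmap (C i) q))"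
      using f i pq(3) by metis
    ultimately show "p = q"
      using C[OF i(1)] i(2) F(3) by (auto simp: is_chart_def inj_on_def)
  qed
  have ex: "\<exists>p\<in>cdom (C i). f p = q" if i: "i \<in> I" "q \<in> cdom (D i)" for i q
  proof -
    have "cmap (D i) q \<in> F ` cmap (C i) ` cdom (C i)" using img i by auto
    then obtain p where "p \<in> cdom (C i)" "cmap (D i) q = cmap (D i) (f p)"
      using f[OF i(1)] by auto
    then show ?thesis using D[OF i(1)] CD[OF i(1)] i(2) by (metis is_chart_def inj_on_def)
  qed
  have "f p \<in> pts N" if p: "p \<in> pts M" for p
  proof -
    obtain i where "i \<in> I" "p \<in> cdom (C i)" using p smooth_atlas_pref[OF M] charts by (metis imageE)
    then show ?thesis using CD D by (auto simp: is_chart_def)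
  qed
  moreover have "q \<in> f ` pts M" if q: "q \<in> pts N" for q
  proof -
    obtain i where "i \<in> I" "q \<in> cdom (D i)" using q smooth_atlas_pref[OF N] charts by (metis imageE)
    then show ?thesis using ex C by (fastforce simp: is_chart_def)
  qed
  ultimately have bij: "bij_betw f (pts M) (pts N)"
    using inj by (auto simp: bij_betw_def)
  have "smooth_map M N f"
  proof (rule smooth_map_chartwise[OF M N])
    fix p assume p: "p \<in> pts M"
    obtain i where i: "i \<in> I" "p \<in> cdom (C i)" using p smooth_atlas_pref[OF M] charts by (metis imageE)
    show "\<exists>c\<in>charts M. \<exists>d\<in>charts N. \<exists>F. p \<in> cdom c \<and> f ` cdom c \<subseteq> cdom d \<and>
        smooth_on (cmap c ` cdom c) F \<and> (\<forall>q\<in>cdom c. cmap d (f q) = F (cmap c q))"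
      by (rule bexI[of _ "C i"], rule bexI[of _ "D i"], rule exI[of _ F])
         (use i f CD F(1) charts in \<open>auto intro: smooth_on_subset\<close>)
  qed
  moreover have "smooth_map N M (inv_into (pts M) f)"
  proof (rule smooth_map_chartwise[OF N M])
    fix q assume q: "q \<in> pts N"
    obtain i where i: "i \<in> I" "q \<in> cdom (D i)" using q smooth_atlas_pref[OF N] charts by (metis imageE)
    have *: "inv_into (pts M) f r \<in> cdom (C i) \<and> cmap (C i) (inv_into (pts M) f r) = G (cmap (D i) r)"
      if r: "r \<in> cdom (D i)" for r
    proof -
      obtain p where p: "p \<in> cdom (C i)" "f p = r" using ex[OF i(1) r] by blast
      then have "inv_into (pts M) f r = p" using inj C[OF i(1)] by (auto simp: is_chart_def)
      then show ?thesis using p f[OF i(1) p(1)] F(3) by auto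
    qed
    show "\<exists>c\<in>charts N. \<exists>d\<in>charts M. \<exists>F. q \<in> cdom c \<and> inv_into (pts M) f ` cdom c \<subseteq> cdom d \<and>
        smooth_on (cmap c ` cdom c) F \<and> (\<forall>r\<in>cdom c. cmap d (inv_into (pts M) f r) = F (cmap c r))"
      by (rule bexI[of _ "D i"], rule bexI[of _ "C i"], rule exI[of _ G])
         (use i * F(2) charts in \<open>auto intro: smooth_on_subset\<close>)
  qed
  ultimately show ?thesis using bij by (simp add: diffeo_def)
qed

section \<open>Atlases on products, tangent and cotangent bundles\<close>

lemma smooth_on_fst_comp:
  fixes f :: "'a::euclidean_space \<Rightarrow> 'c::real_normed_vector" and B :: "'b::euclidean_space set"
  assumes "open A" "open B" "smooth_on A f"
  shows "smooth_on (A \<times> B) (\<lambda>z. f (fst z))"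
  by (rule smooth_on_compose[OF open_Times[OF assms(1,2)] assms(1) _ assms(3)])
     (auto intro!: smooth_on_fst[OF _ smooth_on_ident] open_Times assms(1,2))

lemma smooth_on_snd_comp:
  fixes f :: "'b::euclidean_space \<Rightarrow> 'c::real_normed_vector" and A :: "'a::euclidean_space set"
  assumes "open A" "open B" "smooth_on B f"
  shows "smooth_on (A \<times> B) (\<lambda>z. f (snd z))"
  by (rule smooth_on_compose[OF open_Times[OF assms(1,2)] assms(2) _ assms(3)])
     (auto intro!: smooth_on_snd[OF _ smooth_on_ident] open_Times assms(1,2))

lemma real_line_simps [simp]:
  "pts real_line = UNIV" "charts real_line = {real_chart}" "pref real_line p = real_chart"
  "cdom real_chart = UNIV" "cmap real_chart = (\<lambda>x. x)"
  by (simp_all add: real_line_def real_chart_def)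

lemma prod_mfd_simps [simp]:
  "pts (prod_mfd M N) = pts M \<times> pts N"
  "pref (prod_mfd M N) (p, q) = prod_chart (pref M p) (pref N q)"
  "cdom (prod_chart c d) = cdom c \<times> cdom d" "cmap (prod_chart c d) (p, q) = (cmap c p, cmap d q)"
  by (simp_all add: prod_mfd_def prod_chart_def)

lemma prod_chart_in_charts:
  "c \<in> charts M \<Longrightarrow> d \<in> charts N \<Longrightarrow> prod_chart c d \<in> charts (prod_mfd M N)"
  unfolding prod_mfd_def by (simp del: split_paired_Ex) blast

lemma prod_chartE:
  assumes "C \<in> charts (prod_mfd M N)"
  obtains c d where "C = prod_chart c d" "c \<in> charts M" "d \<in> charts N"
  using assms unfolding prod_mfd_def by auto

lemma tangent_simps [simp]:
  "pts (tangent M) = pts M \<times> UNIV" "charts (tangent M) = tangent_chart M ` charts M"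
  "pref (tangent M) (p, v) = tangent_chart M (pref M p)"
  "cdom (tangent_chart M c) = cdom c \<times> UNIV"
  "cmap (tangent_chart M c) (p, v) = (cmap c p, to_coords M c p v)"
  by (simp_all add: tangent_def tangent_chart_def)

lemma cotangent_simps [simp]:
  "pts (cotangent M) = pts M \<times> UNIV" "charts (cotangent M) = cotangent_chart M ` charts M"
  "pref (cotangent M) (p, a) = cotangent_chart M (pref M p)"
  "cdom (cotangent_chart M c) = cdom c \<times> UNIV"
  "cmap (cotangent_chart M c) (p, a) = (cmap c p, adjoint (from_coords M c p) a)"
  by (simp_all add: cotangent_def cotangent_chart_def)

lemma inner_covector:
  fixes f :: "'e::euclidean_space \<Rightarrow> real"
  assumes "linear f"
  shows "covector f \<bullet> v = f v"
  unfolding covector_def inner_sum_left inner_scaleR_left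
  by (subst linear_eq_sum_Basis[OF assms, of v]) (simp add: inner_commute mult.commute)

lemma adjoint_covector:
  fixes f :: "'e::euclidean_space \<Rightarrow> 'e"
  assumes "linear f"
  shows "adjoint f a = covector (\<lambda>v. a \<bullet> f v)"
proof -
  have "linear (\<lambda>v. a \<bullet> f v)"
    using linear_compose[OF assms bounded_linear.linear[OF bounded_linear_inner_right]] by (simp add: o_def)
  then have "v \<bullet> adjoint f a = v \<bullet> covector (\<lambda>v. a \<bullet> f v)" for v
    using adjoint_works[OF assms, of v a] inner_covector[of "\<lambda>v. a \<bullet> f v" v]
    by (simp add: inner_commute)
  then show ?thesis by (metis vector_eq_ldot)
qed

section \<open>Smoothness of the induced atlases\<close>

lemma smooth_atlas_real_line: "smooth_atlas real_line"
  by (rule smooth_atlasI) (auto intro!: exI[of _ "\<lambda>x. x"] smooth_on_ident)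

lemma prod_chart_overlap:
  "cmap (prod_chart c d) ` (cdom (prod_chart c d) \<inter> cdom (prod_chart c' d'))
     = cmap c ` (cdom c \<inter> cdom c') \<times> cmap d ` (cdom d \<inter> cdom d')"
  by force

lemma smooth_atlas_prod:
  assumes M: "smooth_atlas M" and N: "smooth_atlas N"
  shows "smooth_atlas (prod_mfd M N)"
proof (rule smooth_atlasI)
  fix C assume "C \<in> charts (prod_mfd M N)"
  then obtain c d where C: "C = prod_chart c d" "c \<in> charts M" "d \<in> charts N" by (rule prod_chartE)
  show "cdom C \<subseteq> pts (prod_mfd M N) \<and> inj_on (cmap C) (cdom C)"
    using smooth_atlas_chart[OF M C(2)] smooth_atlas_chart[OF N C(3)]
    by (auto simp: C(1) is_chart_def inj_on_def)
next
  fix C D assume CD: "C \<in> charts (prod_mfd M N)" "D \<in> charts (prod_mfd M N)"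
  obtain c d where C: "C = prod_chart c d" "c \<in> charts M" "d \<in> charts N"
    using CD(1) by (rule prod_chartE)
  obtain c' d' where D: "D = prod_chart c' d'" "c' \<in> charts M" "d' \<in> charts N"
    using CD(2) by (rule prod_chartE)
  note o = smooth_atlas_overlap[OF M C(2) D(2)] smooth_atlas_overlap[OF N C(3) D(3)]
  have img: "cmap C ` (cdom C \<inter> cdom D)
      = cmap c ` (cdom c \<inter> cdom c') \<times> cmap d ` (cdom d \<inter> cdom d')"
    unfolding C(1) D(1) by (rule prod_chart_overlap)
  show "\<exists>\<phi>. open (cmap C ` (cdom C \<inter> cdom D)) \<and> smooth_on (cmap C ` (cdom C \<inter> cdom D)) \<phi> \<and>
      (\<forall>p\<in>cdom C \<inter> cdom D. cmap D p = \<phi> (cmap C p))"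
    unfolding img
    by (intro exI[of _ "\<lambda>z. ((cmap c' \<circ> cinv c) (fst z), (cmap d' \<circ> cinv d) (snd z))"] conjI
        open_Times smooth_on_Pair smooth_on_fst_comp smooth_on_snd_comp o)
       (auto simp: C(1) D(1) smooth_atlas_cinv[OF M C(2)] smooth_atlas_cinv[OF N C(3)])
next
  fix p assume "p \<in> pts (prod_mfd M N)"
  then show "pref (prod_mfd M N) p \<in> charts (prod_mfd M N) \<and> p \<in> cdom (pref (prod_mfd M N) p)"
    using smooth_atlas_pref[OF M] smooth_atlas_pref[OF N] by (auto simp: prod_chart_in_charts)
qed

lemma tangent_chart_overlap:
  assumes M: "smooth_atlas M" and c: "c \<in> charts M" and d: "d \<in> charts M"
  shows "cmap (tangent_chart M c) ` (cdom (tangent_chart M c) \<inter> cdom (tangent_chart M d))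
     = cmap c ` (cdom c \<inter> cdom d) \<times> UNIV"
proof -
  have "(x, v) \<in> cmap (tangent_chart M c) ` (cdom (tangent_chart M c) \<inter> cdom (tangent_chart M d))"
    if x: "x \<in> cmap c ` (cdom c \<inter> cdom d)" for x v
  proof -
    obtain p where p: "p \<in> cdom c" "p \<in> cdom d" "x = cmap c p" using x by blast
    then have "(x, v) = cmap (tangent_chart M c) (p, from_coords M c p v)"
      by (simp add: to_coords_from_coords_self[OF M c])
    then show ?thesis using p by (intro image_eqI) auto
  qed
  then show ?thesis by auto
qed

lemma tangent_chart_change:
  assumes M: "smooth_atlas M" and c: "c \<in> charts M" and d: "d \<in> charts M"
    and p: "p \<in> cdom c" "p \<in> cdom d"
  shows "cmap (tangent_chart M d) (p, v) = (\<lambda>z. ((cmap d \<circ> cinv c) (fst z),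
      frechet_derivative (cmap d \<circ> cinv c) (at (fst z)) (snd z))) (cmap (tangent_chart M c) (p, v))"
  using smooth_atlas_cinv[OF M c] to_coords_change[OF M c d p] p by (simp add: jacobian_def)

lemma smooth_tangent_chart_change:
  assumes M: "smooth_atlas M" and c: "c \<in> charts M" and d: "d \<in> charts M"
  shows "smooth_on (cmap c ` (cdom c \<inter> cdom d) \<times> UNIV) (\<lambda>z. ((cmap d \<circ> cinv c) (fst z),
      frechet_derivative (cmap d \<circ> cinv c) (at (fst z)) (snd z)))"
proof -
  note o = smooth_atlas_overlap[OF M c d]
  have O: "open (cmap c ` (cdom c \<inter> cdom d) \<times> UNIV)" by (rule open_Times[OF o(1) open_UNIV])
  show ?thesis
    by (intro smooth_on_Pair O smooth_on_fst_comp open_UNIV o smooth_on_fst smooth_on_snd smooth_on_ident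
        smooth_on_frechet_derivative[OF O o(1,2)]) auto
qed

lemma smooth_atlas_tangent:
  assumes M: "smooth_atlas M"
  shows "smooth_atlas (tangent M)"
proof (rule smooth_atlasI)
  fix C assume "C \<in> charts (tangent M)"
  then obtain c where C: "C = tangent_chart M c" "c \<in> charts M" by auto
  have "inj_on (cmap C) (cdom C)"
  proof (rule inj_onI, clarify)
    fix p v q w assume "(p, v) \<in> cdom C" "(q, w) \<in> cdom C" "cmap C (p, v) = cmap C (q, w)"
    then have p: "p \<in> cdom c" "p = q" "to_coords M c p v = to_coords M c q w"
      using smooth_atlas_chart[OF M C(2)] by (auto simp: C(1) is_chart_def inj_on_def)
    then show "p = q \<and> v = w" using from_coords_to_coords[OF M C(2)] by metis
  qed
  then show "cdom C \<subseteq> pts (tangent M) \<and> inj_on (cmap C) (cdom C)"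
    using smooth_atlas_chart[OF M C(2)] by (auto simp: C(1) is_chart_def)
next
  fix C D assume "C \<in> charts (tangent M)" "D \<in> charts (tangent M)"
  then obtain c d where C: "C = tangent_chart M c" "c \<in> charts M"
    and D: "D = tangent_chart M d" "d \<in> charts M" by auto
  show "\<exists>\<phi>. open (cmap C ` (cdom C \<inter> cdom D)) \<and> smooth_on (cmap C ` (cdom C \<inter> cdom D)) \<phi> \<and>
      (\<forall>p\<in>cdom C \<inter> cdom D. cmap D p = \<phi> (cmap C p))"
    using open_Times[OF smooth_atlas_overlap(1)[OF M C(2) D(2)] open_UNIV]
      smooth_tangent_chart_change[OF M C(2) D(2)] tangent_chart_change[OF M C(2) D(2)]
    unfolding C(1) D(1) tangent_chart_overlap[OF M C(2) D(2)] by (intro exI conjI) auto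
next
  fix p assume "p \<in> pts (tangent M)"
  then show "pref (tangent M) p \<in> charts (tangent M) \<and> p \<in> cdom (pref (tangent M) p)"
    using smooth_atlas_pref[OF M] by auto
qed

lemma inner_cotangent_coords:
  assumes "smooth_atlas M" "c \<in> charts M" "p \<in> cdom c"
  shows "adjoint (from_coords M c p) a \<bullet> v = a \<bullet> from_coords M c p v"
  using adjoint_works[OF linear_from_coords[OF assms], of v a] by (simp add: inner_commute)

lemma inner_cotangent_coords_change:
  assumes M: "smooth_atlas M" and c: "c \<in> charts M" "d \<in> charts M" "p \<in> cdom c" "p \<in> cdom d"
  shows "adjoint (from_coords M d p) a \<bullet> jacobian c d p v = adjoint (from_coords M c p) a \<bullet> v"
  using from_coords_change[OF M c(2,1,4,3)] inner_cotangent_coords[OF M] c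
    jacobian_chart_chain[OF M c(1,2,1)] jacobian_self[OF smooth_atlas_chart[OF M c(1)]] by simp

text \<open>Expresses new momenta through old ones by the Jacobian of the inverse transition, in a
  form from which smoothness can be read off.\<close>

lemma adjoint_from_coords_change:
  assumes M: "smooth_atlas M" and c: "c \<in> charts M" "d \<in> charts M" "p \<in> cdom c" "p \<in> cdom d"
  shows "adjoint (from_coords M d p) a = covector (\<lambda>v. adjoint (from_coords M c p) a \<bullet> jacobian d c p v)"
  using adjoint_covector[OF linear_from_coords[OF M c(2,4)]]
  by (simp add: from_coords_change[OF M c] inner_cotangent_coords[OF M c(1,3)])

lemma cotangent_chart_overlap:
  assumes M: "smooth_atlas M" and c: "c \<in> charts M" and d: "d \<in> charts M"
  shows "cmap (cotangent_chart M c) ` (cdom (cotangent_chart M c) \<inter> cdom (cotangent_chart M d))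
     = cmap c ` (cdom c \<inter> cdom d) \<times> UNIV"
proof -
  have "(x, a) \<in> cmap (cotangent_chart M c) ` (cdom (cotangent_chart M c) \<inter> cdom (cotangent_chart M d))"
    if x: "x \<in> cmap c ` (cdom c \<inter> cdom d)" for x a
  proof -
    obtain p where p: "p \<in> cdom c" "p \<in> cdom d" "x = cmap c p" using x by blast
    \<comment> \<open>Transposes compose in reverse order, so the transpose of
      \<open>to_coords\<close> is a right inverse of the transpose of
      \<open>from_coords\<close>.\<close>
    have "a = adjoint (from_coords M c p) (adjoint (to_coords M c p) a)"
    proof -
      have "v \<bullet> a = v \<bullet> adjoint (from_coords M c p) (adjoint (to_coords M c p) a)" for v
        using adjoint_works[OF linear_from_coords[OF M c p(1)]] adjoint_works[OF linear_to_coords[OF M c p(1)]]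
          to_coords_from_coords_self[OF M c p(1)] by simp
      then show ?thesis by (metis vector_eq_ldot)
    qed
    then have "(x, a) = cmap (cotangent_chart M c) (p, adjoint (to_coords M c p) a)"
      using p by simp
    then show ?thesis using p by (intro image_eqI) auto
  qed
  then show ?thesis by auto
qed

lemma smooth_atlas_cotangent:
  assumes M: "smooth_atlas M"
  shows "smooth_atlas (cotangent M)"
proof (rule smooth_atlasI)
  fix C assume "C \<in> charts (cotangent M)"
  then obtain c where C: "C = cotangent_chart M c" "c \<in> charts M" by auto
  have "inj_on (cmap C) (cdom C)"
  proof (rule inj_onI, clarify)
    fix p a q b assume *: "(p, a) \<in> cdom C" "(q, b) \<in> cdom C" "cmap C (p, a) = cmap C (q, b)"
    then have p: "p \<in> cdom c" "p = q" "adjoint (from_coords M c p) a = adjoint (from_coords M c p) b"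
      using smooth_atlas_chart[OF M C(2)] by (auto simp: C(1) is_chart_def inj_on_def)
    have "a \<bullet> from_coords M c p v = b \<bullet> from_coords M c p v" for v
      using inner_cotangent_coords[OF M C(2) p(1)] p(3) by metis
    then have "a \<bullet> v = b \<bullet> v" for v
      using from_coords_to_coords[OF M C(2) p(1)] by metis
    then show "p = q \<and> a = b" using p(2) by (metis vector_eq_rdot)
  qed
  then show "cdom C \<subseteq> pts (cotangent M) \<and> inj_on (cmap C) (cdom C)"
    using smooth_atlas_chart[OF M C(2)] by (auto simp: C(1) is_chart_def)
next
  fix C D assume "C \<in> charts (cotangent M)" "D \<in> charts (cotangent M)"
  then obtain c d where C: "C = cotangent_chart M c" "c \<in> charts M"
    and D: "D = cotangent_chart M d" "d \<in> charts M" by auto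
  define U where "U = cmap c ` (cdom c \<inter> cdom d)"
  \<comment> \<open>The base coordinate changes by the transition, the momenta by the transposed
    derivative of the inverse transition at the transported point.\<close>
  define \<phi> where "\<phi> = (\<lambda>z. ((cmap d \<circ> cinv c) (fst z), \<Sum>b\<in>Basis.
      (snd z \<bullet> frechet_derivative (cmap c \<circ> cinv d) (at ((cmap d \<circ> cinv c) (fst z))) b) *\<^sub>R b))"
  note o = smooth_atlas_overlap[OF M C(2) D(2), folded U_def]
  note o' = smooth_atlas_overlap[OF M D(2) C(2)]
  have O: "open (U \<times> UNIV)" by (rule open_Times[OF o(1) open_UNIV])
  have "(cmap d \<circ> cinv c) x \<in> cmap d ` (cdom d \<inter> cdom c)" if "x \<in> U" for x
    using that by (auto simp: U_def smooth_atlas_cinv[OF M C(2)])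
  then have "smooth_on (U \<times> UNIV) \<phi>"
    unfolding \<phi>_def
    by (intro smooth_on_Pair O smooth_on_fst_comp[OF o(1) open_UNIV o(2)] open_UNIV
        smooth_on_sum smooth_on_scaleR smooth_on_inner smooth_on_snd smooth_on_ident smooth_on_const
        smooth_on_frechet_derivative[OF O o'(1,2)]) auto
  moreover have "cmap D p = \<phi> (cmap C p)" if "p \<in> cdom C \<inter> cdom D" for p
  proof -
    obtain x a where x: "p = (x, a)" "x \<in> cdom c" "x \<in> cdom d"
      using \<open>p \<in> cdom C \<inter> cdom D\<close> by (auto simp: C(1) D(1))
    show ?thesis
      using adjoint_from_coords_change[OF M C(2) D(2) x(2,3)]
      by (simp add: C(1) D(1) x \<phi>_def smooth_atlas_cinv[OF M C(2)] covector_def jacobian_def)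
  qed
  ultimately show "\<exists>\<phi>. open (cmap C ` (cdom C \<inter> cdom D)) \<and> smooth_on (cmap C ` (cdom C \<inter> cdom D)) \<phi> \<and>
      (\<forall>p\<in>cdom C \<inter> cdom D. cmap D p = \<phi> (cmap C p))"
    using O unfolding C(1) D(1) cotangent_chart_overlap[OF M C(2) D(2)] U_def by blast
next
  fix p assume "p \<in> pts (cotangent M)"
  then show "pref (cotangent M) p \<in> charts (cotangent M) \<and> p \<in> cdom (pref (cotangent M) p)"
    using smooth_atlas_pref[OF M] by auto
qed

lemma cotangent_chart_covector:
  assumes "smooth_atlas M" "c \<in> charts M" "p \<in> cdom c" "linear f"
  shows "cmap (cotangent_chart M c) (p, covector f) = (cmap c p, covector (\<lambda>v. f (from_coords M c p v)))"
  by (simp add: adjoint_covector[OF linear_from_coords[OF assms(1-3)]] inner_covector[OF assms(4)])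

section \<open>Jacobians of the induced charts\<close>

lemma jacobian_prod:
  assumes M: "smooth_atlas M" and N: "smooth_atlas N"
    and c: "c \<in> charts M" "c' \<in> charts M" "p \<in> cdom c" "p \<in> cdom c'"
    and d: "d \<in> charts N" "d' \<in> charts N" "q \<in> cdom d" "q \<in> cdom d'"
  shows "jacobian (prod_chart c d) (prod_chart c' d') (p, q) V = (jacobian c c' p (fst V), jacobian d d' q (snd V))"
proof -
  note P = smooth_atlas_prod[OF M N]
  have cd: "prod_chart c d \<in> charts (prod_mfd M N)" "prod_chart c' d' \<in> charts (prod_mfd M N)"
    using c d by (auto intro: prod_chart_in_charts)
  have "fst (jacobian (prod_chart c d) (prod_chart c' d') (p, q) V) = jacobian c c' (fst (p, q)) (fst V)"
    by (rule jacobian_natural[OF smooth_atlas_chart[OF P cd(1)] smooth_atlas_compatible[OF P cd]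
          smooth_atlas_chart[OF M c(1)] smooth_atlas_compatible[OF M c(1,2)], where F = fst and F' = fst])
       (use c d in \<open>auto intro!: derivative_eq_intros\<close>)
  moreover have "snd (jacobian (prod_chart c d) (prod_chart c' d') (p, q) V) = jacobian d d' (snd (p, q)) (snd V)"
    by (rule jacobian_natural[OF smooth_atlas_chart[OF P cd(1)] smooth_atlas_compatible[OF P cd]
          smooth_atlas_chart[OF N d(1)] smooth_atlas_compatible[OF N d(1,2)], where F = snd and F' = snd])
       (use c d in \<open>auto intro!: derivative_eq_intros\<close>)
  ultimately show ?thesis by (simp add: prod_eq_iff)
qed

text \<open>The transition map sends (y, w) to (\<tau> y, D\<tau>(y) w). Its second component is
  jointly smooth, so its derivative is the sum of the partial ones: a second derivative of \<tau> in
  y, and D\<tau> itself in the linear variable w.\<close>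

lemma jacobian_tangent:
  assumes M: "smooth_atlas M" and c: "c \<in> charts M" "d \<in> charts M" "p \<in> cdom c" "p \<in> cdom d"
  shows "jacobian (tangent_chart M c) (tangent_chart M d) (p, v) W =
    (jacobian c d p (fst W),
     frechet_derivative (\<lambda>y. frechet_derivative (cmap d \<circ> cinv c) (at y) (to_coords M c p v)) (at (cmap c p)) (fst W)
     + jacobian c d p (snd W))"
proof -
  define \<tau> where "\<tau> = cmap d \<circ> cinv c"
  define U where "U = cmap c ` (cdom c \<inter> cdom d)"
  define x w where "x = cmap c p" and "w = to_coords M c p v"
  note T = smooth_atlas_tangent[OF M]
  have U: "open U" "x \<in> U" "smooth_on U \<tau>"
    using smooth_atlas_overlap[OF M c(1,2)] c by (auto simp: U_def x_def \<tau>_def)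
  have O: "open (U \<times> (UNIV :: 'b set))" by (rule open_Times[OF U(1) open_UNIV])
  define G where "G = (\<lambda>z. frechet_derivative \<tau> (at (fst z)) (snd z))"
  have "smooth_on (U \<times> UNIV) G"
    unfolding G_def by (intro smooth_on_frechet_derivative[OF O U(1,3)] smooth_on_fst smooth_on_snd smooth_on_ident O) auto
  then obtain G' where G': "(G has_derivative G') (at (x, w))"
    using smooth_on_has_derivative[of _ _ "(x, w)"] U(2) by blast
  have \<tau>': "(\<tau> has_derivative jacobian c d p) (at x)"
    using compatible_has_derivative[OF smooth_atlas_compatible[OF M c(1,2)] c(3,4)] by (simp add: \<tau>_def x_def)
  have G1: "G' (a, 0) = frechet_derivative (\<lambda>y. frechet_derivative \<tau> (at y) w) (at x) a" for a
  proof -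
    have "((\<lambda>y. G (y, w)) has_derivative (\<lambda>a. G' (a, 0))) (at x)"
      by (rule has_derivative_compose[of "\<lambda>y. (y, w)" "\<lambda>a. (a, 0)", OF _ G']) (auto intro!: derivative_eq_intros)
    then show ?thesis unfolding G_def by (metis (no_types, lifting) frechet_derivative_at fst_conv snd_conv ext)
  qed
  have G2: "G' (0, b) = jacobian c d p b" for b
  proof -
    have "((\<lambda>y. G (x, y)) has_derivative (\<lambda>b. G' (0, b))) (at w)"
      by (rule has_derivative_compose[of "\<lambda>y. (x, y)" "\<lambda>b. (0, b)", OF _ G']) (auto intro!: derivative_eq_intros)
    moreover have "((\<lambda>y. G (x, y)) has_derivative jacobian c d p) (at w)"
      unfolding G_def \<tau>_def x_def jacobian_def fst_conv snd_conv
      using linear_chart_jacobian[OF M c] linear_imp_has_derivative unfolding jacobian_def by blast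
    ultimately show ?thesis by (metis has_derivative_unique)
  qed
  have "G' W = G' (fst W, 0) + G' (0, snd W)"
    using linear_add[OF has_derivative_linear[OF G'], of "(fst W, 0)" "(0, snd W)"] by simp
  moreover have "((\<lambda>z. (\<tau> (fst z), G z)) has_derivative (\<lambda>W. (jacobian c d p (fst W), G' W))) (at (x, w))"
    by (intro has_derivative_Pair G' has_derivative_compose[of fst fst, OF has_derivative_fst[OF has_derivative_ident]]) (simp add: \<tau>')
  then have "((cmap (tangent_chart M d) \<circ> cinv (tangent_chart M c)) has_derivative
      (\<lambda>W. (jacobian c d p (fst W), G' W))) (at (x, w))"
  proof (rule has_derivative_transform_within_open[OF _ O])
    fix z assume "z \<in> U \<times> (UNIV :: 'b set)"
    then obtain q u where q: "q \<in> cdom c" "q \<in> cdom d" "z = cmap (tangent_chart M c) (q, u)"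
      using tangent_chart_overlap[OF M c(1,2)] unfolding U_def
      by (auto simp flip: tangent_chart_overlap[OF M c(1,2)])
    have "cinv (tangent_chart M c) z = (q, u)"
      unfolding q(3) using smooth_atlas_cinv[OF T, of "tangent_chart M c" "(q, u)"] c q by auto
    then show "(\<tau> (fst z), G z) = (cmap (tangent_chart M d) \<circ> cinv (tangent_chart M c)) z"
      using tangent_chart_change[OF M c(1,2) q(1,2), of u] by (simp only: o_apply q(3)[symmetric] G_def \<tau>_def)
  qed (use U in simp)
  then have "jacobian (tangent_chart M c) (tangent_chart M d) (p, v) = (\<lambda>W. (jacobian c d p (fst W), G' W))"
    unfolding jacobian_def[of "tangent_chart M c"] tangent_simps x_def w_def by (rule frechet_derivative_at[symmetric])
  ultimately show ?thesis using G1 G2 by (simp add: \<tau>_def x_def w_def)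
qed

lemma fst_jacobian_cotangent:
  assumes M: "smooth_atlas M" and c: "c \<in> charts M" "d \<in> charts M" "p \<in> cdom c" "p \<in> cdom d"
  shows "fst (jacobian (cotangent_chart M c) (cotangent_chart M d) (p, a) W) = jacobian c d p (fst W)"
proof -
  note T = smooth_atlas_cotangent[OF M]
  have "fst (jacobian (cotangent_chart M c) (cotangent_chart M d) (p, a) W) = jacobian c d (fst (p, a)) (fst W)"
    by (rule jacobian_natural[OF smooth_atlas_chart[OF T] smooth_atlas_compatible[OF T]
          smooth_atlas_chart[OF M c(1)] smooth_atlas_compatible[OF M c(1,2)], where F = fst and F' = fst])
       (use c in \<open>auto intro!: derivative_eq_intros\<close>)
  then show ?thesis by simp
qed

text \<open>The derivative of the pairing identity \<open>p' \<bullet> D\<tau> v = p \<bullet> v\<close> for fixed \<open>v\<close>.\<close>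

lemma snd_jacobian_cotangent:
  assumes M: "smooth_atlas M" and c: "c \<in> charts M" "d \<in> charts M" "p \<in> cdom c" "p \<in> cdom d"
  shows "snd (jacobian (cotangent_chart M c) (cotangent_chart M d) (p, a) W) \<bullet> jacobian c d p v
     + adjoint (from_coords M d p) a \<bullet>
       frechet_derivative (\<lambda>y. frechet_derivative (cmap d \<circ> cinv c) (at y) v) (at (cmap c p)) (fst W)
     = snd W \<bullet> v"
proof -
  define \<tau> where "\<tau> = cmap d \<circ> cinv c"
  define U where "U = cmap c ` (cdom c \<inter> cdom d)"
  define x \<xi> where "x = cmap c p" and "\<xi> = adjoint (from_coords M c p) a"
  define \<phi> where "\<phi> = cmap (cotangent_chart M d) \<circ> cinv (cotangent_chart M c)"
  define J where "J = jacobian (cotangent_chart M c) (cotangent_chart M d) (p, a)"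
  note T = smooth_atlas_cotangent[OF M]
  have U: "open U" "x \<in> U" "smooth_on U \<tau>"
    using smooth_atlas_overlap[OF M c(1,2)] c by (auto simp: U_def x_def \<tau>_def)
  have O: "open (U \<times> (UNIV :: 'b set))" by (rule open_Times[OF U(1) open_UNIV])
  have J: "(\<phi> has_derivative J) (at (x, \<xi>))"
    using compatible_has_derivative[OF smooth_atlas_compatible[OF T], of "cotangent_chart M c" "cotangent_chart M d" "(p, a)"] c
    by (simp add: \<phi>_def J_def x_def \<xi>_def)
  have inv: "\<phi> (cmap (cotangent_chart M c) (q, b)) = cmap (cotangent_chart M d) (q, b)" if "q \<in> cdom c" for q b
    using smooth_atlas_cinv[OF T, of "cotangent_chart M c" "(q, b)"] c that by (simp add: \<phi>_def)
  have "\<phi> (x, \<xi>) = cmap (cotangent_chart M d) (p, a)"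
    using inv[of p a] c by (simp add: x_def \<xi>_def)
  then have \<phi>x: "snd (\<phi> (x, \<xi>)) = adjoint (from_coords M d p) a" by simp
  let ?D = "\<lambda>y. frechet_derivative \<tau> (at y) v"
  have D: "(?D has_derivative frechet_derivative ?D (at x)) (at (fst (x, \<xi>)))"
    using smooth_on_has_derivative[OF smooth_on_directional_derivative[OF U(3)] U(2)] by simp
  have "((\<lambda>z. snd (\<phi> z) \<bullet> ?D (fst z)) has_derivative
      (\<lambda>W. snd (\<phi> (x, \<xi>)) \<bullet> frechet_derivative ?D (at x) (fst W) + snd (J W) \<bullet> ?D (fst (x, \<xi>)))) (at (x, \<xi>))"
    by (intro has_derivative_inner has_derivative_snd J
        has_derivative_compose[OF has_derivative_fst[OF has_derivative_ident] D])
  \<comment> \<open>Invariance of the pairing under a change of chart: on the overlap the same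
    function is the old momentum paired with v.\<close>
  moreover have "((\<lambda>z. snd (\<phi> z) \<bullet> ?D (fst z)) has_derivative (\<lambda>W. snd W \<bullet> v)) (at (x, \<xi>))"
  proof (rule has_derivative_transform_within_open[OF _ O])
    show "((\<lambda>z. snd z \<bullet> v) has_derivative (\<lambda>W. snd W \<bullet> v)) (at (x, \<xi>))"
      by (auto intro!: derivative_eq_intros)
    fix z assume "z \<in> U \<times> (UNIV :: 'b set)"
    then obtain q b where q: "q \<in> cdom c" "q \<in> cdom d" "z = cmap (cotangent_chart M c) (q, b)"
      unfolding U_def by (auto simp flip: cotangent_chart_overlap[OF M c(1,2)])
    show "snd z \<bullet> v = snd (\<phi> z) \<bullet> ?D (fst z)"
      using inner_cotangent_coords_change[OF M c(1,2) q(1,2), of b v] inv[OF q(1), of b]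
      by (simp add: q(3) jacobian_def \<tau>_def)
  qed (use U in simp)
  ultimately have "(\<lambda>W. snd (\<phi> (x, \<xi>)) \<bullet> frechet_derivative ?D (at x) (fst W) + snd (J W) \<bullet> ?D (fst (x, \<xi>)))
      = (\<lambda>W. snd W \<bullet> v)" by (rule has_derivative_unique)
  from fun_cong[OF this, of W] show ?thesis
    unfolding \<phi>x J_def by (simp add: jacobian_def \<tau>_def x_def add.commute)
qed

section \<open>The canonical forms\<close>

lemma liouville_eq:
  assumes "smooth_atlas N" "p \<in> pts N"
  shows "liouville N (p, a) V = a \<bullet> fst V"
proof -
  have "tangent_map (cotangent N) N fst (p, a) = fst"
    by (rule tangent_map_eq[OF smooth_atlas_cotangent[OF assms(1)], where F = fst])
       (use assms in \<open>auto intro!: derivative_eq_intros\<close>)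
  then show ?thesis by (simp add: liouville_def)
qed

lemma frechet_derivative_eqI:
  assumes "(g has_derivative g') (at x)" "open S" "x \<in> S" "\<And>y. y \<in> S \<Longrightarrow> f y = g y"
  shows "frechet_derivative f (at x) = g'"
proof -
  have "(f has_derivative g') (at x)"
    by (rule has_derivative_transform_within_open[OF assms(1-3)]) (simp add: assms(4))
  then show ?thesis by (metis frechet_derivative_at)
qed

text \<open>At a nearby point q the covector is stored in the chart preferred at q, not at p.
  Invariance of the pairing returns it to the chart of p, so the usual formula holds on that whole
  chart and can be differentiated.\<close>

lemma local_form_liouville:
  assumes N: "smooth_atlas N" and p: "p \<in> pts N" and y: "y \<in> cmap (pref N p) ` cdom (pref N p) \<times> UNIV"
  shows "local_form (cotangent N) (cotangent_chart N (pref N p)) (liouville N) y W = snd y \<bullet> fst W"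
proof -
  let ?c = "pref N p"
  note T = smooth_atlas_cotangent[OF N]
  have c: "?c \<in> charts N" using p smooth_atlas_pref[OF N] by auto
  obtain q b where q: "q \<in> cdom ?c" "y = cmap (cotangent_chart N ?c) (q, b)"
    using y unfolding cotangent_chart_overlap[OF N c c, unfolded Int_absorb, symmetric] by auto
  have qN: "q \<in> pts N" using q smooth_atlas_pts[OF N c] by blast
  have d: "pref N q \<in> charts N" "q \<in> cdom (pref N q)" using smooth_atlas_pref[OF N qN] by auto
  have "local_form (cotangent N) (cotangent_chart N ?c) (liouville N) y W
      = liouville N (q, b) (from_coords (cotangent N) (cotangent_chart N ?c) (q, b) W)"
    unfolding q(2) by (rule local_form_cmap[OF T]) (use c q in auto)
  also have "\<dots> = b \<bullet> from_coords N ?c q (fst W)"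
    using fst_jacobian_cotangent[OF N c d(1) q(1) d(2)]
    by (simp add: liouville_eq[OF N qN] from_coords_jacobian)
  also have "\<dots> = snd y \<bullet> fst W"
    unfolding q(2) using inner_cotangent_coords[OF N c q(1)] by simp
  finally show ?thesis .
qed

text \<open>At p itself the stored components are the coordinates; the right-hand side is the
  constant form dx \<and> da = -d(a dx) in position x and momentum a.\<close>

lemma canonical_form_eq:
  assumes N: "smooth_atlas N" and p: "p \<in> pts N"
  shows "canonical_form N (p, a) V W = snd W \<bullet> fst V - snd V \<bullet> fst W"
proof -
  let ?c = "pref N p"
  have c: "?c \<in> charts N" "p \<in> cdom ?c" using p smooth_atlas_pref[OF N] by auto
  have "frechet_derivative (\<lambda>y. local_form (cotangent N) (cotangent_chart N ?c) (liouville N) y W)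
      (at (cmap (cotangent_chart N ?c) (p, a))) = (\<lambda>V. snd V \<bullet> fst W)" for W
    by (rule frechet_derivative_eqI[where g = "\<lambda>y. snd y \<bullet> fst W",
          OF _ open_Times[OF smooth_atlas_open[OF N c(1)] open_UNIV] _ local_form_liouville[OF N p]])
       (use c in \<open>auto intro!: derivative_eq_intros\<close>)
  then show ?thesis by (simp add: canonical_form_def ext_d_def Let_def)
qed

section \<open>The contact form on \<open>T\<^sup>*Q \<times> \<real>\<close>\<close>

abbreviation (input) velocity_chart ::
    "('a, 'e::euclidean_space) mfd \<Rightarrow> ('a, 'e) chart \<Rightarrow> (('a \<times> 'e) \<times> real, ('e \<times> 'e) \<times> real) chart" where
  "velocity_chart Q c \<equiv> prod_chart (tangent_chart Q c) real_chart"

lemma charts_prod_real_line: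
  "charts (prod_mfd M real_line) = (\<lambda>c. prod_chart c real_chart) ` charts M"
proof (rule set_eqI)
  fix C show "C \<in> charts (prod_mfd M real_line) \<longleftrightarrow> C \<in> (\<lambda>c. prod_chart c real_chart) ` charts M"
    using prod_chartE[of C M real_line] prod_chart_in_charts[of _ M real_chart real_line]
    unfolding image_iff by (metis real_line_simps(2) singletonD singletonI)
qed

lemma phase_simps [simp]:
  "pts (phase Q) = (pts Q \<times> UNIV) \<times> UNIV"
  "charts (phase Q) = phase_chart Q ` charts Q"
  "pref (phase Q) ((q, p), z) = phase_chart Q (pref Q q)"
  "cdom (phase_chart Q c) = (cdom c \<times> UNIV) \<times> UNIV"
  "cmap (phase_chart Q c) ((q, p), z) = ((cmap c q, adjoint (from_coords Q c q) p), z)"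
  by (simp_all add: phase_def phase_chart_def charts_prod_real_line image_image)

lemma velocity_simps [simp]:
  "pts (velocity Q) = (pts Q \<times> UNIV) \<times> UNIV"
  "charts (velocity Q) = velocity_chart Q ` charts Q"
  "pref (velocity Q) ((q, v), z) = velocity_chart Q (pref Q q)"
  by (simp_all add: velocity_def charts_prod_real_line image_image)

lemma TM_R_simps [simp]:
  "charts (TM_R Q) = TM_R_chart Q ` charts Q"
  "pref (TM_R Q) (((((q, p), z), V), u)) = TM_R_chart Q (pref Q q)"
  "cdom (TM_R_chart Q c) = (cdom (phase_chart Q c) \<times> UNIV) \<times> UNIV"
  "cmap (TM_R_chart Q c) ((m, V), u) = ((cmap (phase_chart Q c) m, to_coords (phase Q) (phase_chart Q c) m V), u)"
  by (simp_all add: TM_R_def TM_R_chart_def charts_prod_real_line image_image)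

lemma velocity_cotangent_chart_in_charts:
  "charts (cotangent (velocity Q)) = velocity_cotangent_chart Q ` charts Q"
  by (auto simp: velocity_cotangent_chart_def)

lemma mem_HM_R_set: "((m, V), u) \<in> HM_R_set Q \<longleftrightarrow> m \<in> pts (phase Q) \<and> eta Q m V = 0"
  unfolding HM_R_set_def by blast

lemma HM_R_simps [simp]:
  "pts (HM_R Q) = HM_R_set Q" "charts (HM_R Q) = HM_R_chart Q ` charts Q"
  "pref (HM_R Q) ((((q, p), z), V), u) = HM_R_chart Q (pref Q q)"
  "((m, V), u) \<in> HM_R_set Q \<longleftrightarrow> m \<in> pts (phase Q) \<and> eta Q m V = 0"
  "cdom (HM_R_chart Q c) = cdom (TM_R_chart Q c) \<inter> HM_R_set Q"
  by (simp_all add: HM_R_def mem_HM_R_set HM_R_chart_def)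

section \<open>Coordinate expressions on \<open>HM_R\<close>\<close>

abbreviation (input) "hm_q y \<equiv> fst y"
abbreviation (input) "hm_p y \<equiv> fst (snd y)"
abbreviation (input) "hm_z y \<equiv> fst (snd (snd y))"
abbreviation (input) "hm_dq y \<equiv> fst (snd (snd (snd y)))"
abbreviation (input) "hm_dp y \<equiv> fst (snd (snd (snd (snd y))))"
abbreviation (input) "hm_u y \<equiv> snd (snd (snd (snd (snd y))))"

definition hm_base :: "'e::euclidean_space hm_model \<Rightarrow> ('e \<times> 'e) \<times> real" where
  "hm_base y = ((hm_q y, hm_p y), hm_z y)"

text \<open>The inclusion j of HM \<times> \<real> in coordinates; the slot of z-dot receives p
  paired with q-dot.\<close>

definition hm_incl :: "'e::euclidean_space hm_model \<Rightarrow> ((('e \<times> 'e) \<times> real) \<times> (('e \<times> 'e) \<times> real)) \<times> real" where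
  "hm_incl y = ((hm_base y, ((hm_dq y, hm_dp y), hm_p y \<bullet> hm_dq y)), hm_u y)"

definition hm_drop :: "((('e \<times> 'e) \<times> real) \<times> (('e \<times> 'e) \<times> real)) \<times> real \<Rightarrow> 'e::euclidean_space hm_model" where
  "hm_drop Y = (fst (fst (fst (fst Y))), snd (fst (fst (fst Y))), snd (fst (fst Y)),
     fst (fst (snd (fst Y))), snd (fst (snd (fst Y))), snd Y)"

lemma hm_drop_incl [simp]: "hm_drop (hm_incl y) = y"
  by (simp add: hm_drop_def hm_incl_def hm_base_def)

lemma HM_R_chart_drop: "cmap (HM_R_chart Q c) x = hm_drop (cmap (TM_R_chart Q c) x)"
  by (simp add: HM_R_chart_def hm_drop_def split: prod.split)

definition theta_loc :: "'e::euclidean_space hm_model \<Rightarrow> 'e hm_model \<Rightarrow> real" where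
  "theta_loc y W = hm_u y * (hm_z W - hm_p y \<bullet> hm_q W) + hm_p W \<bullet> hm_dq y - hm_dp y \<bullet> hm_q W"

text \<open>The exterior derivative of \<open>theta_loc\<close>, namely du \<and> (dz - p dq) - u dp
  \<and> dq + d(q-dot) \<and> dp - d(p-dot) \<and> dq, left as the antisymmetrised directional
  derivative that \<open>ext_d\<close> produces.\<close>

definition omega_loc :: "'e::euclidean_space hm_model \<Rightarrow> 'e hm_model \<Rightarrow> 'e hm_model \<Rightarrow> real" where
  "omega_loc y v w =
      hm_u v * (hm_z w - hm_p y \<bullet> hm_q w) - hm_u y * (hm_p v \<bullet> hm_q w) + hm_p w \<bullet> hm_dq v - hm_dp v \<bullet> hm_q w
    - (hm_u w * (hm_z v - hm_p y \<bullet> hm_q v) - hm_u y * (hm_p w \<bullet> hm_q v) + hm_p v \<bullet> hm_dq w - hm_dp w \<bullet> hm_q v)"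

context
  fixes Q :: "('a, 'e::euclidean_space) mfd"
  assumes Q: "smooth_atlas Q"
begin

lemma smooth_atlas_phase: "smooth_atlas (phase Q)"
  unfolding phase_def by (intro smooth_atlas_prod smooth_atlas_cotangent smooth_atlas_real_line Q)

lemma smooth_atlas_velocity: "smooth_atlas (velocity Q)"
  unfolding velocity_def by (intro smooth_atlas_prod smooth_atlas_tangent smooth_atlas_real_line Q)

lemma smooth_atlas_TM_R: "smooth_atlas (TM_R Q)"
  unfolding TM_R_def by (intro smooth_atlas_prod smooth_atlas_tangent smooth_atlas_real_line smooth_atlas_phase)

lemma phase_chart_open: "c \<in> charts Q \<Longrightarrow> open (cmap (phase_chart Q c) ` cdom (phase_chart Q c))"
  by (rule smooth_atlas_open[OF smooth_atlas_phase]) simp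

lemma phase_chart_overlap:
  assumes "c \<in> charts Q" "d \<in> charts Q"
  shows "cmap (phase_chart Q c) ` (cdom (phase_chart Q c) \<inter> cdom (phase_chart Q d))
    = (cmap c ` (cdom c \<inter> cdom d) \<times> UNIV) \<times> UNIV"
  unfolding phase_chart_def prod_chart_overlap cotangent_chart_overlap[OF Q assms] by simp

lemma phase_chart_image:
  assumes "c \<in> charts Q"
  shows "cmap (phase_chart Q c) ` cdom (phase_chart Q c) = (cmap c ` cdom c \<times> UNIV) \<times> UNIV"
  using phase_chart_overlap[OF assms assms] by simp

lemma jacobian_phase:
  assumes "c \<in> charts Q" "d \<in> charts Q" "q \<in> cdom c" "q \<in> cdom d"
  shows "jacobian (phase_chart Q c) (phase_chart Q d) ((q, p), z) V
    = (jacobian (cotangent_chart Q c) (cotangent_chart Q d) (q, p) (fst V), snd V)"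
  unfolding phase_chart_def
  using jacobian_prod[OF smooth_atlas_cotangent[OF Q] smooth_atlas_real_line, of "cotangent_chart Q c"
      "cotangent_chart Q d" "(q, p)" real_chart real_chart z V]
    jacobian_self[OF smooth_atlas_chart[OF smooth_atlas_real_line], of real_chart z] assms
  by simp

lemma jacobian_velocity:
  assumes "c \<in> charts Q" "d \<in> charts Q" "q \<in> cdom c" "q \<in> cdom d"
  shows "jacobian (velocity_chart Q c) (velocity_chart Q d) ((q, v), z) V
    = (jacobian (tangent_chart Q c) (tangent_chart Q d) (q, v) (fst V), snd V)"
  using jacobian_prod[OF smooth_atlas_tangent[OF Q] smooth_atlas_real_line, of "tangent_chart Q c"
      "tangent_chart Q d" "(q, v)" real_chart real_chart z V]
    jacobian_self[OF smooth_atlas_chart[OF smooth_atlas_real_line], of real_chart z] assms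
  by simp

lemma eta_pref:
  assumes "q \<in> pts Q"
  shows "eta Q ((q, p), z) V = snd V - p \<bullet> fst (fst V)"
proof -
  have "tangent_map (phase Q) real_line snd ((q, p), z) = snd"
    by (rule tangent_map_eq[OF smooth_atlas_phase, where F = snd])
       (use assms in \<open>auto intro!: derivative_eq_intros\<close>)
  moreover have "tangent_map (phase Q) (cotangent Q) fst ((q, p), z) = fst"
    by (rule tangent_map_eq[OF smooth_atlas_phase, where F = fst])
       (use assms in \<open>auto intro!: derivative_eq_intros\<close>)
  ultimately show ?thesis
    by (simp add: eta_def differential_def pullback1_def liouville_eq[OF Q assms])
qed

text \<open>The formula dz - p dq survives every change of chart: z is unchanged, the q-components
  change by the Jacobian of \<open>Q\<close>, and their pairing with p is invariant.\<close>

lemma eta_from_coords: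
  assumes c: "c \<in> charts Q" and m: "m \<in> cdom (phase_chart Q c)"
  shows "eta Q m (from_coords (phase Q) (phase_chart Q c) m W)
    = snd W - snd (fst (cmap (phase_chart Q c) m)) \<bullet> fst (fst W)"
proof -
  obtain q p z where m': "m = ((q, p), z)" "q \<in> cdom c" using m by auto
  have q: "q \<in> pts Q" using smooth_atlas_pts[OF Q c m'(2)] .
  have d: "pref Q q \<in> charts Q" "q \<in> cdom (pref Q q)" using smooth_atlas_pref[OF Q q] by auto
  show ?thesis
    using fst_jacobian_cotangent[OF Q c d(1) m'(2) d(2)] inner_cotangent_coords[OF Q c m'(2)]
    by (simp add: m' eta_pref[OF q] from_coords_jacobian jacobian_phase[OF c d(1) m'(2) d(2)])
qed

lemma eta_to_coords:
  assumes c: "c \<in> charts Q" and m: "m \<in> cdom (phase_chart Q c)"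
  shows "eta Q m V = snd (to_coords (phase Q) (phase_chart Q c) m V)
    - snd (fst (cmap (phase_chart Q c) m)) \<bullet> fst (fst (to_coords (phase Q) (phase_chart Q c) m V))"
  using eta_from_coords[OF c m, of "to_coords (phase Q) (phase_chart Q c) m V"]
    from_coords_to_coords[OF smooth_atlas_phase _ m] c by simp

lemma linear_eta:
  assumes "m \<in> pts (phase Q)"
  shows "linear (eta Q m)"
proof -
  obtain q p z where "m = ((q, p), z)" "q \<in> pts Q" using assms by auto
  then show ?thesis
    by (intro linearI) (auto simp: eta_pref inner_add_right algebra_simps)
qed

lemma local_form_eta:
  assumes c: "c \<in> charts Q" and y: "y \<in> cmap (phase_chart Q c) ` cdom (phase_chart Q c)"
  shows "local_form (phase Q) (phase_chart Q c) (eta Q) y W = snd W - snd (fst y) \<bullet> fst (fst W)"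
proof -
  obtain m where m: "m \<in> cdom (phase_chart Q c)" "y = cmap (phase_chart Q c) m" using y by blast
  show ?thesis
    unfolding m(2) using local_form_cmap[OF smooth_atlas_phase _ m(1)] eta_from_coords[OF c m(1)] c by simp
qed

lemma local_form_eta_has_derivative:
  assumes c: "c \<in> charts Q" and m: "m \<in> cdom (phase_chart Q c)"
  shows "((\<lambda>y. local_form (phase Q) (phase_chart Q c) (eta Q) y W) has_derivative
      (\<lambda>V. - (snd (fst V) \<bullet> fst (fst W)))) (at (cmap (phase_chart Q c) m))"
proof (rule has_derivative_transform_within_open)
  show "((\<lambda>y. snd W - snd (fst y) \<bullet> fst (fst W)) has_derivative (\<lambda>V. - (snd (fst V) \<bullet> fst (fst W))))
      (at (cmap (phase_chart Q c) m))"
    by (auto intro!: derivative_eq_intros)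
  show "open (cmap (phase_chart Q c) ` cdom (phase_chart Q c))"
    by (rule phase_chart_open[OF c])
  show "cmap (phase_chart Q c) m \<in> cmap (phase_chart Q c) ` cdom (phase_chart Q c)"
    using m by blast
qed (simp add: local_form_eta[OF c])

text \<open>In the coordinates of \<open>c\<close> the only varying coefficient of \<eta> is -p, and
  \<open>ext_d_chart\<close> admits this chart in place of the preferred one. The result is dq
  \<and> dp.\<close>

lemma ext_d_eta:
  assumes c: "c \<in> charts Q" and m: "m \<in> cdom (phase_chart Q c)"
  shows "ext_d (phase Q) (eta Q) m V W =
     snd (fst (to_coords (phase Q) (phase_chart Q c) m W)) \<bullet> fst (fst (to_coords (phase Q) (phase_chart Q c) m V))
   - snd (fst (to_coords (phase Q) (phase_chart Q c) m V)) \<bullet> fst (fst (to_coords (phase Q) (phase_chart Q c) m W))"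
proof -
  note D = local_form_eta_has_derivative[OF c m]
  have pc: "phase_chart Q c \<in> charts (phase Q)" using c by simp
  have lin: "linear (eta Q q)" if "q \<in> cdom (phase_chart Q c)" for q
    using linear_eta smooth_atlas_pts[OF smooth_atlas_phase pc that] .
  have "ext_d (phase Q) (eta Q) m V W =
      frechet_derivative (\<lambda>y. local_form (phase Q) (phase_chart Q c) (eta Q) y (to_coords (phase Q) (phase_chart Q c) m W))
        (at (cmap (phase_chart Q c) m)) (to_coords (phase Q) (phase_chart Q c) m V)
    - frechet_derivative (\<lambda>y. local_form (phase Q) (phase_chart Q c) (eta Q) y (to_coords (phase Q) (phase_chart Q c) m V))
        (at (cmap (phase_chart Q c) m)) (to_coords (phase Q) (phase_chart Q c) m W)"
    by (rule ext_d_chart[OF smooth_atlas_phase pc m lin]) (use D in \<open>auto simp: differentiable_def\<close>)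
  also have "\<dots> = - (snd (fst (to_coords (phase Q) (phase_chart Q c) m V)) \<bullet> fst (fst (to_coords (phase Q) (phase_chart Q c) m W)))
     + snd (fst (to_coords (phase Q) (phase_chart Q c) m W)) \<bullet> fst (fst (to_coords (phase Q) (phase_chart Q c) m V))"
    unfolding frechet_derivative_at[OF D, symmetric] by simp
  finally show ?thesis by simp
qed

lemma ext_d_eta_pref:
  assumes "m \<in> pts (phase Q)"
  shows "ext_d (phase Q) (eta Q) m V W = snd (fst W) \<bullet> fst (fst V) - snd (fst V) \<bullet> fst (fst W)"
proof -
  obtain q p z where m: "m = ((q, p), z)" "q \<in> pts Q" using assms by auto
  have "pref Q q \<in> charts Q" "m \<in> cdom (phase_chart Q (pref Q q))"
    using smooth_atlas_pref[OF Q m(2)] m by auto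
  from ext_d_eta[OF this] show ?thesis
    using to_coords_pref[OF smooth_atlas_phase assms] by (simp add: m(1))
qed

text \<open>Transition maps of the phase space fix z and change q, p independently of it, so the
  components ((0, 0), 1) are the same in all induced charts. This turns a pointwise definition in
  preferred charts into a smooth field.\<close>

lemma reeb_field_d_dz: "reeb_field (phase Q) (eta Q) d_dz"
proof -
  have dz: "to_coords (phase Q) (phase_chart Q c) m (d_dz m) = ((0, 0), 1)"
    if c: "c \<in> charts Q" and m: "m \<in> cdom (phase_chart Q c)" for c m
  proof -
    obtain q p z where m': "m = ((q, p), z)" "q \<in> cdom c" using m by auto
    have q: "q \<in> pts Q" using smooth_atlas_pts[OF Q c m'(2)] .
    have d: "pref Q q \<in> charts Q" "q \<in> cdom (pref Q q)" using smooth_atlas_pref[OF Q q] by auto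
    have "linear (jacobian (cotangent_chart Q (pref Q q)) (cotangent_chart Q c) (q, p))"
      using linear_chart_jacobian[OF smooth_atlas_cotangent[OF Q]] d c m' by simp
    from linear_0[OF this] show ?thesis
      by (simp add: to_coords_jacobian m' d_dz_def jacobian_phase[OF d(1) c d(2) m'(2)] zero_prod_def)
  qed
  have "smooth_vfield (phase Q) d_dz"
    unfolding smooth_vfield_def
  proof (rule smooth_map_chartwise[OF smooth_atlas_phase smooth_atlas_tangent[OF smooth_atlas_phase]])
    fix m assume m: "m \<in> pts (phase Q)"
    obtain c where c: "c \<in> charts Q" "m \<in> cdom (phase_chart Q c)"
      using smooth_atlas_pref[OF smooth_atlas_phase m] by auto
    have "smooth_on (cmap (phase_chart Q c) ` cdom (phase_chart Q c)) (\<lambda>y. (y, ((0, 0), 1)))"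
      by (intro smooth_on_intros phase_chart_open[OF c(1)])
    then show "\<exists>c\<in>charts (phase Q). \<exists>d\<in>charts (tangent (phase Q)). \<exists>F. m \<in> cdom c \<and>
        (\<lambda>p. (p, d_dz p)) ` cdom c \<subseteq> cdom d \<and> smooth_on (cmap c ` cdom c) F \<and>
        (\<forall>q\<in>cdom c. cmap d (q, d_dz q) = F (cmap c q))"
      using c dz[OF c(1)]
      by (intro bexI[of _ "phase_chart Q c"] bexI[of _ "tangent_chart (phase Q) (phase_chart Q c)"]
          exI[of _ "\<lambda>y. (y, ((0, 0), 1))"]) auto
  qed
  then show ?thesis
    using ext_d_eta_pref by (auto simp: reeb_field_def eta_pref d_dz_def)
qed

section \<open>The manifold \<open>HM \<times> \<real>\<close> and its symplectic form\<close>

text \<open>Nothing is lost by dropping z-dot: \<eta>(V) = 0 reads z-dot = p q-dot in every induced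
  chart.\<close>

lemma HM_R_chart_incl:
  assumes c: "c \<in> charts Q" and x: "x \<in> cdom (HM_R_chart Q c)"
  shows "cmap (TM_R_chart Q c) x = hm_incl (cmap (HM_R_chart Q c) x)"
proof -
  obtain m V u where x': "x = ((m, V), u)" "m \<in> cdom (phase_chart Q c)" "eta Q m V = 0"
    using x by (cases x) auto
  show ?thesis
    using eta_to_coords[OF c x'(2), of V] x'(3)
    by (simp add: HM_R_chart_drop hm_drop_def hm_incl_def hm_base_def x'(1) prod_eq_iff del: phase_simps)
qed

text \<open>The equation for z-dot is solvable for any values of the other coordinates, so only q is
  restricted.\<close>

lemma HM_R_chart_overlap:
  assumes c: "c \<in> charts Q" and d: "d \<in> charts Q"
  shows "cmap (HM_R_chart Q c) ` (cdom (HM_R_chart Q c) \<inter> cdom (HM_R_chart Q d))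
    = cmap c ` (cdom c \<inter> cdom d) \<times> UNIV"
proof -
  have "y \<in> cmap (HM_R_chart Q c) ` (cdom (HM_R_chart Q c) \<inter> cdom (HM_R_chart Q d))"
    if y: "hm_q y \<in> cmap c ` (cdom c \<inter> cdom d)" for y
  proof -
    have "hm_base y \<in> cmap (phase_chart Q c) ` (cdom (phase_chart Q c) \<inter> cdom (phase_chart Q d))"
      unfolding phase_chart_overlap[OF c d] using y by (simp add: hm_base_def)
    then obtain m where m: "m \<in> cdom (phase_chart Q c)" "m \<in> cdom (phase_chart Q d)"
      "hm_base y = cmap (phase_chart Q c) m" by blast
    \<comment> \<open>The last component is forced: it is the value of z-dot at which \<eta>
      vanishes.\<close>
    define V where "V = from_coords (phase Q) (phase_chart Q c) m ((hm_dq y, hm_dp y), hm_p y \<bullet> hm_dq y)"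
    have pc: "phase_chart Q c \<in> charts (phase Q)" using c by simp
    have "eta Q m V = 0"
      unfolding V_def eta_from_coords[OF c m(1)] m(3)[symmetric] by (simp add: hm_base_def)
    moreover have "m \<in> pts (phase Q)" using smooth_atlas_pts[OF smooth_atlas_phase pc m(1)] .
    ultimately have "((m, V), hm_u y) \<in> cdom (HM_R_chart Q c) \<inter> cdom (HM_R_chart Q d)"
      using m by (simp del: phase_simps)
    moreover have "cmap (TM_R_chart Q c) ((m, V), hm_u y) = hm_incl y"
      using to_coords_from_coords_self[OF smooth_atlas_phase pc m(1)]
      by (simp add: V_def hm_incl_def m(3) del: phase_simps)
    then have "y = cmap (HM_R_chart Q c) ((m, V), hm_u y)"
      by (simp only: HM_R_chart_drop hm_drop_incl)
    ultimately show ?thesis by blast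
  qed
  moreover have "hm_q (cmap (HM_R_chart Q c) x) \<in> cmap c ` (cdom c \<inter> cdom d)"
    if "x \<in> cdom (HM_R_chart Q c) \<inter> cdom (HM_R_chart Q d)" for x
    using that by (cases x) (auto simp: HM_R_chart_drop hm_drop_def)
  ultimately show ?thesis
    unfolding set_eq_iff mem_Times_iff by (metis (no_types, lifting) UNIV_I imageE)
qed

lemma HM_R_chart_image:
  "c \<in> charts Q \<Longrightarrow> cmap (HM_R_chart Q c) ` cdom (HM_R_chart Q c) = cmap c ` cdom c \<times> UNIV"
  using HM_R_chart_overlap[of c c] by simp

text \<open>Transition maps are inherited from \<open>TM_R\<close>: include, change charts there,
  drop z-dot.\<close>

lemma smooth_atlas_HM_R: "smooth_atlas (HM_R Q)"
proof (rule smooth_atlasI)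
  fix C assume "C \<in> charts (HM_R Q)"
  then obtain c where C: "C = HM_R_chart Q c" "c \<in> charts Q" by auto
  have "inj_on (cmap (TM_R_chart Q c)) (cdom (TM_R_chart Q c))"
    using smooth_atlas_chart[OF smooth_atlas_TM_R] C(2) by (simp add: is_chart_def del: TM_R_simps(3))
  then have "inj_on (cmap C) (cdom C)"
    unfolding C(1) inj_on_def using HM_R_chart_incl[OF C(2)] by (metis HM_R_simps(5) IntD1)
  then show "cdom C \<subseteq> pts (HM_R Q) \<and> inj_on (cmap C) (cdom C)"
    by (auto simp: C(1))
next
  fix C D assume "C \<in> charts (HM_R Q)" "D \<in> charts (HM_R Q)"
  then obtain c d where C: "C = HM_R_chart Q c" "c \<in> charts Q"
    and D: "D = HM_R_chart Q d" "d \<in> charts Q" by auto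
  define U where "U = cmap c ` (cdom c \<inter> cdom d) \<times> (UNIV :: ('e \<times> real \<times> 'e \<times> 'e \<times> real) set)"
  let ?\<tau> = "cmap (TM_R_chart Q d) \<circ> cinv (TM_R_chart Q c)"
  let ?W = "cmap (TM_R_chart Q c) ` (cdom (TM_R_chart Q c) \<inter> cdom (TM_R_chart Q d))"
  have U: "open U" unfolding U_def by (intro open_Times smooth_atlas_overlap[OF Q C(2) D(2)] open_UNIV)
  have cd: "TM_R_chart Q c \<in> charts (TM_R Q)" "TM_R_chart Q d \<in> charts (TM_R Q)"
    using C D by auto
  note T = smooth_atlas_overlap[OF smooth_atlas_TM_R cd]
  have "hm_incl y \<in> ?W" if "y \<in> U" for y
  proof -
    have "y \<in> cmap (HM_R_chart Q c) ` (cdom (HM_R_chart Q c) \<inter> cdom (HM_R_chart Q d))"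
      unfolding HM_R_chart_overlap[OF C(2) D(2)] using that by (simp add: U_def)
    then obtain x where "x \<in> cdom (HM_R_chart Q c)" "x \<in> cdom (HM_R_chart Q d)" "y = cmap (HM_R_chart Q c) x"
      by blast
    then show ?thesis using HM_R_chart_incl[OF C(2), of x] by (intro image_eqI[of _ _ x]) auto
  qed
  moreover have "smooth_on U hm_incl"
    unfolding hm_incl_def hm_base_def by (intro smooth_on_intros U)
  ultimately have "smooth_on U (\<lambda>y. ?\<tau> (hm_incl y))"
    by (intro smooth_on_compose[OF U T(1) _ T(2)])
  then have "smooth_on U (\<lambda>y. hm_drop (?\<tau> (hm_incl y)))"
    unfolding hm_drop_def by (intro smooth_on_Pair smooth_on_fst smooth_on_snd U)
  moreover have "cmap D x = hm_drop (?\<tau> (hm_incl (cmap C x)))" if x: "x \<in> cdom C \<inter> cdom D" for x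
  proof -
    have "x \<in> cdom (TM_R_chart Q c)" using x by (simp add: C(1))
    then have "cinv (TM_R_chart Q c) (cmap (TM_R_chart Q c) x) = x"
      by (rule smooth_atlas_cinv[OF smooth_atlas_TM_R cd(1)])
    then show ?thesis
      using HM_R_chart_incl[OF C(2), of x] x by (simp add: C(1) D(1) HM_R_chart_drop[of Q d])
  qed
  ultimately show "\<exists>\<phi>. open (cmap C ` (cdom C \<inter> cdom D)) \<and> smooth_on (cmap C ` (cdom C \<inter> cdom D)) \<phi> \<and>
      (\<forall>p\<in>cdom C \<inter> cdom D. cmap D p = \<phi> (cmap C p))"
    using U unfolding C(1) D(1) HM_R_chart_overlap[OF C(2) D(2)] U_def by blast
next
  fix x assume x: "x \<in> pts (HM_R Q)"
  obtain q p z V u where x': "x = ((((q, p), z), V), u)" by (metis surj_pair)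
  then have "q \<in> pts Q" using x by simp
  then show "pref (HM_R Q) x \<in> charts (HM_R Q) \<and> x \<in> cdom (pref (HM_R Q) x)"
    using smooth_atlas_pref[OF Q, of q] x by (simp add: x')
qed

lemma HM_R_pref_cases:
  assumes "x \<in> HM_R_set Q"
  obtains q p z dq dp u where
    "x = ((((q, p), z), ((dq, dp), p \<bullet> dq)), u)" "q \<in> pts Q"
    "cmap (HM_R_chart Q (pref Q q)) x = (cmap (pref Q q) q, p, z, dq, dp, u)"
proof -
  obtain q p z dq dp dz u where x: "x = ((((q, p), z), ((dq, dp), dz)), u)" by (metis surj_pair)
  have q: "q \<in> pts Q" "dz = p \<bullet> dq"
    using assms eta_pref[of q p z] by (auto simp: x)
  have m: "((q, p), z) \<in> pts (phase Q)" using q by simp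
  have "adjoint (from_coords Q (pref Q q) q) p = p"
    using from_coords_pref[OF Q q(1)] adjoint_works[of "\<lambda>v::'e. v" _ p] linear_id
    by (metis (no_types, lifting) id_def eq_id_iff vector_eq_ldot)
  then have "cmap (HM_R_chart Q (pref Q q)) x = (cmap (pref Q q) q, p, z, dq, dp, u)"
    using to_coords_pref[OF smooth_atlas_phase m] by (simp add: x HM_R_chart_drop hm_drop_def)
  with that show ?thesis using x q by blast
qed

text \<open>The z-dot slot of the included vector holds the derivative of p q-dot. Subtracting p
  times its q-dot slot leaves the p-part of W paired with q-dot, which is the half of d\<eta>(V, W)
  that the derivative of the coefficients of \<eta> lacks. So W enters only through
  \<open>hm_base\<close>.\<close>

lemma theta_eta_eq:
  assumes x: "((m, V), u) \<in> HM_R_set Q"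
  shows "theta_eta Q ((m, V), u) W
    = u * eta Q m (hm_base W) + ext_d (phase Q) (eta Q) m V (hm_base W)"
proof -
  obtain q p z dq dp u' where *: "((m, V), u) = ((((q, p), z), ((dq, dp), p \<bullet> dq)), u')" "q \<in> pts Q"
    "cmap (HM_R_chart Q (pref Q q)) ((m, V), u) = (cmap (pref Q q) q, p, z, dq, dp, u')"
    by (rule HM_R_pref_cases[OF x])
  then have x': "m = ((q, p), z)" "V = ((dq, dp), p \<bullet> dq)" "q \<in> pts Q"
    "cmap (HM_R_chart Q (pref Q q)) ((m, V), u) = (cmap (pref Q q) q, p, z, dq, dp, u)"
    by auto
  let ?c = "pref Q q" and ?y = "cmap (HM_R_chart Q (pref Q q)) ((m, V), u)"
  have c: "?c \<in> charts Q" "q \<in> cdom ?c" using smooth_atlas_pref[OF Q x'(3)] by auto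
  have m: "m \<in> cdom (phase_chart Q ?c)" "m \<in> pts (phase Q)" using c x' by auto
  have tm: "tangent_map (HM_R Q) (TM_R Q) (\<lambda>x. x) ((m, V), u)
     = (\<lambda>W. ((hm_base W, ((hm_dq W, hm_dp W), hm_p ?y \<bullet> hm_dq W + hm_p W \<bullet> hm_dq ?y)), hm_u W))"
  proof (rule tangent_map_eq[OF smooth_atlas_HM_R, where F = hm_incl])
    show "((m, V), u) \<in> pts (HM_R Q)" using x by simp
    show "cmap (pref (TM_R Q) ((m, V), u)) x = hm_incl (cmap (pref (HM_R Q) ((m, V), u)) x)"
      if "x \<in> cdom (pref (HM_R Q) ((m, V), u))" for x
      using HM_R_chart_incl[OF c(1), of x] that by (simp add: x'(1))
    show "(hm_incl has_derivative (\<lambda>W. ((hm_base W, ((hm_dq W, hm_dp W),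
        hm_p ?y \<bullet> hm_dq W + hm_p W \<bullet> hm_dq ?y)), hm_u W))) (at (cmap (pref (HM_R Q) ((m, V), u)) ((m, V), u)))"
      unfolding hm_incl_def[abs_def] hm_base_def x'(1) HM_R_simps
      by (auto intro!: derivative_eq_intros)
  qed
  note D = frechet_derivative_at[OF local_form_eta_has_derivative[OF c(1) m(1)], symmetric]
  have "theta_eta Q ((m, V), u) W = u * eta Q m (hm_base W)
      + (frechet_derivative (\<lambda>y. local_form (phase Q) (phase_chart Q ?c) (eta Q) y (hm_base W)) (at (cmap (phase_chart Q ?c) m)) V
      + eta Q m ((hm_dq W, hm_dp W), hm_p ?y \<bullet> hm_dq W + hm_p W \<bullet> hm_dq ?y))"
    unfolding theta_eta_def pullback1_def tm
    by (simp add: tangent_contact_form_def vertical_lift_def complete_lift_def Let_def x'(1)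
        del: phase_simps(5))
  then show ?thesis
    unfolding D ext_d_eta_pref[OF m(2)] x'(4)
    by (simp add: x' eta_pref hm_base_def)
qed

text \<open>Since \<open>theta_eta_eq\<close> involves only \<eta>, d\<eta> and the projected
  vector, it is enough that \<open>hm_base\<close> intertwines the Jacobians of \<open>HM_R\<close>
  and of the phase space.\<close>

lemma local_form_theta_eta:
  assumes c: "c \<in> charts Q" and y: "y \<in> cmap c ` cdom c \<times> UNIV"
  shows "local_form (HM_R Q) (HM_R_chart Q c) (theta_eta Q) y W = theta_loc y W"
proof -
  obtain x where x: "x \<in> cdom (HM_R_chart Q c)" "y = cmap (HM_R_chart Q c) x"
    using y unfolding HM_R_chart_image[OF c, symmetric] by blast
  obtain m V u where x': "x = ((m, V), u)" by (metis surj_pair)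
  obtain q p z where m': "m = ((q, p), z)" by (metis surj_pair)
  have m: "m \<in> cdom (phase_chart Q c)" "((m, V), u) \<in> HM_R_set Q" "q \<in> cdom c" "q \<in> pts Q"
    using x smooth_atlas_pts[OF Q c] by (auto simp: x' m')
  let ?d = "pref Q q"
  have d: "?d \<in> charts Q" "q \<in> cdom ?d" using smooth_atlas_pref[OF Q m(4)] by auto
  have C: "HM_R_chart Q c \<in> charts (HM_R Q)" "HM_R_chart Q ?d \<in> charts (HM_R Q)"
    "phase_chart Q c \<in> charts (phase Q)" "phase_chart Q ?d \<in> charts (phase Q)" using c d by auto
  have base: "hm_base (from_coords (HM_R Q) (HM_R_chart Q c) ((m, V), u) W)
      = from_coords (phase Q) (phase_chart Q c) m (hm_base W)"
  proof -
    have "hm_base (jacobian (HM_R_chart Q c) (HM_R_chart Q ?d) x W)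
      = jacobian (phase_chart Q c) (phase_chart Q ?d) (fst (fst x)) (hm_base W)"
    proof (rule jacobian_natural[OF smooth_atlas_chart[OF smooth_atlas_HM_R C(1)]
          smooth_atlas_compatible[OF smooth_atlas_HM_R C(1,2)]
          smooth_atlas_chart[OF smooth_atlas_phase C(3)]
          smooth_atlas_compatible[OF smooth_atlas_phase C(3,4)], where F = hm_base and F' = hm_base])
      show "x \<in> cdom (HM_R_chart Q c)" "x \<in> cdom (HM_R_chart Q ?d)"
        using x d m by (auto simp: x' m')
      show "fst (fst w) \<in> cdom (phase_chart Q c) \<and> fst (fst w) \<in> cdom (phase_chart Q ?d) \<and>
          cmap (phase_chart Q c) (fst (fst w)) = hm_base (cmap (HM_R_chart Q c) w) \<and>
          cmap (phase_chart Q ?d) (fst (fst w)) = hm_base (cmap (HM_R_chart Q ?d) w)"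
        if "w \<in> cdom (HM_R_chart Q c)" "w \<in> cdom (HM_R_chart Q ?d)" for w
        using that by (cases w) (auto simp: HM_R_chart_drop hm_drop_def hm_base_def)
      show "(hm_base has_derivative hm_base) (at (cmap (HM_R_chart Q c) x))"
        "(hm_base has_derivative hm_base) (at (cmap (HM_R_chart Q ?d) x))"
        unfolding hm_base_def[abs_def] by (auto intro!: derivative_eq_intros)
    qed
    then show ?thesis by (simp add: from_coords_jacobian x' m')
  qed
  have "local_form (HM_R Q) (HM_R_chart Q c) (theta_eta Q) y W
      = theta_eta Q ((m, V), u) (from_coords (HM_R Q) (HM_R_chart Q c) ((m, V), u) W)"
    using local_form_cmap[OF smooth_atlas_HM_R C(1) x(1)] by (simp add: x(2) x')
  also have "\<dots> = theta_loc y W"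
    unfolding theta_eta_eq[OF m(2)] base eta_from_coords[OF c m(1)] ext_d_eta[OF c m(1)]
      to_coords_from_coords_self[OF smooth_atlas_phase C(3) m(1)]
    by (simp add: x(2) x' HM_R_chart_drop hm_drop_def theta_loc_def hm_base_def del: phase_simps)
  finally show ?thesis .
qed

lemma omega_eta_eq:
  assumes x: "x \<in> HM_R_set Q" and y: "y = cmap (pref (HM_R Q) x) x"
  shows "omega_eta Q x v w = omega_loc y v w"
proof -
  obtain q p z dq dp u where x': "x = ((((q, p), z), ((dq, dp), p \<bullet> dq)), u)" "q \<in> pts Q"
    by (rule HM_R_pref_cases[OF x])
  let ?c = "pref Q q"
  have c: "?c \<in> charts Q" "q \<in> cdom ?c" using smooth_atlas_pref[OF Q x'(2)] by auto
  have y': "y = cmap (HM_R_chart Q ?c) x" using y by (simp add: x')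
  have yU: "y \<in> cmap ?c ` cdom ?c \<times> UNIV"
    unfolding HM_R_chart_image[OF c(1), symmetric] y' using x c by (simp add: x')
  have "frechet_derivative (\<lambda>y. local_form (HM_R Q) (HM_R_chart Q ?c) (theta_eta Q) y w) (at y)
     = (\<lambda>v. hm_u v * (hm_z w - hm_p y \<bullet> hm_q w) - hm_u y * (hm_p v \<bullet> hm_q w) + hm_p w \<bullet> hm_dq v - hm_dp v \<bullet> hm_q w)" for w
    by (rule frechet_derivative_eqI[OF _ open_Times[OF smooth_atlas_open[OF Q c(1)] open_UNIV] yU local_form_theta_eta[OF c(1)]])
       (auto simp: theta_loc_def fun_eq_iff algebra_simps intro!: derivative_eq_intros)
  then show ?thesis
    by (simp add: omega_eta_def ext_d_def Let_def omega_loc_def x'(1) flip: y'[unfolded x'(1)])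
qed

end

section \<open>The map \<open>\<beta>\<^sup>0\<close>\<close>

definition beta0_loc :: "'e::euclidean_space hm_model \<Rightarrow> (('e \<times> 'e) \<times> real) \<times> (('e \<times> 'e) \<times> real)" where
  "beta0_loc y = (hm_base y, ((hm_dp y + hm_u y *\<^sub>R hm_p y, - hm_dq y), - hm_u y))"

text \<open>Momenta (a, b, e) give q-dot = -b and u = -e, hence p-dot = a - u p = a + e p.\<close>

definition beta0_inv :: "(('e::euclidean_space \<times> 'e) \<times> real) \<times> (('e \<times> 'e) \<times> real) \<Rightarrow> 'e hm_model" where
  "beta0_inv Y = (fst (fst (fst Y)), snd (fst (fst Y)), snd (fst Y), - snd (fst (snd Y)),
     fst (fst (snd Y)) + snd (snd Y) *\<^sub>R snd (fst (fst Y)), - snd (snd Y))"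

definition beta0_deriv :: "'e::euclidean_space hm_model \<Rightarrow> 'e hm_model \<Rightarrow> (('e \<times> 'e) \<times> real) \<times> (('e \<times> 'e) \<times> real)" where
  "beta0_deriv y v = (hm_base v,
     ((hm_dp v + (hm_u y *\<^sub>R hm_p v + hm_u v *\<^sub>R hm_p y), - hm_dq v), - hm_u v))"

text \<open>The same elimination, except that p is now the momentum conjugate to q-dot, and q-dot is
  a position.\<close>

definition alpha0_inv :: "(('e::euclidean_space \<times> 'e) \<times> real) \<times> (('e \<times> 'e) \<times> real) \<Rightarrow> 'e hm_model" where
  "alpha0_inv Y = (fst (fst (fst Y)), snd (fst (snd Y)), snd (fst Y), snd (fst (fst Y)),
     fst (fst (snd Y)) + snd (snd Y) *\<^sub>R snd (fst (snd Y)), - snd (snd Y))"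

definition alpha0_deriv :: "'e::euclidean_space hm_model \<Rightarrow> 'e hm_model \<Rightarrow> (('e \<times> 'e) \<times> real) \<times> (('e \<times> 'e) \<times> real)" where
  "alpha0_deriv y v = (((hm_q v, hm_dq v), hm_z v),
     (((hm_u y *\<^sub>R hm_p v + hm_u v *\<^sub>R hm_p y) + hm_dp v, hm_p v), - hm_u v))"

lemma beta0_inv_loc: "beta0_inv (beta0_loc y) = y" and beta0_loc_inv: "beta0_loc (beta0_inv Y) = Y"
  by (simp_all add: beta0_inv_def beta0_loc_def hm_base_def)

lemma alpha0_local_eq:
  "alpha0_local y = (((hm_q y, hm_dq y), hm_z y), ((hm_u y *\<^sub>R hm_p y + hm_dp y, hm_p y), - hm_u y))"
  by (cases y) (simp add: alpha0_local_def)

lemma alpha0_inv_local: "alpha0_inv (alpha0_local y) = y"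
  and alpha0_local_inv: "alpha0_local (alpha0_inv Y) = Y"
  by (simp_all add: alpha0_inv_def alpha0_local_eq)

lemma smooth_beta0_loc: "open S \<Longrightarrow> smooth_on S beta0_loc"
  unfolding beta0_loc_def[abs_def] hm_base_def by (intro smooth_on_intros)

lemma smooth_beta0_inv: "open S \<Longrightarrow> smooth_on S beta0_inv"
  unfolding beta0_inv_def[abs_def] by (intro smooth_on_intros)

lemma smooth_alpha0_local: "open S \<Longrightarrow> smooth_on S alpha0_local"
  unfolding alpha0_local_eq[abs_def] by (intro smooth_on_intros)

lemma smooth_alpha0_inv: "open S \<Longrightarrow> smooth_on S alpha0_inv"
  unfolding alpha0_inv_def[abs_def] by (intro smooth_on_intros)

lemma beta0_loc_has_derivative: "(beta0_loc has_derivative beta0_deriv y) (at y)"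
  unfolding beta0_loc_def[abs_def] beta0_deriv_def[abs_def] hm_base_def
  by (auto intro!: derivative_eq_intros)

lemma alpha0_local_has_derivative: "(alpha0_local has_derivative alpha0_deriv y) (at y)"
  unfolding alpha0_local_eq[abs_def] alpha0_deriv_def[abs_def]
  by (auto intro!: derivative_eq_intros)

lemma beta0_deriv_symplectic:
  "snd (beta0_deriv y w) \<bullet> fst (beta0_deriv y v) - snd (beta0_deriv y v) \<bullet> fst (beta0_deriv y w) = omega_loc y v w"
  by (simp add: beta0_deriv_def omega_loc_def hm_base_def inner_add_left inner_commute algebra_simps)

text \<open>Compared with \<open>beta0_deriv_symplectic\<close>, the position-momentum pair (p, -
  q-dot) becomes (q-dot, p), a rotation that keeps the wedge; the other pairs are the same.\<close>

lemma alpha0_deriv_symplectic: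
  "snd (alpha0_deriv y w) \<bullet> fst (alpha0_deriv y v) - snd (alpha0_deriv y v) \<bullet> fst (alpha0_deriv y w) = omega_loc y v w"
  by (simp add: alpha0_deriv_def omega_loc_def inner_add_left inner_commute algebra_simps)

lemma covector_inner [simp]: "covector (\<lambda>v. a \<bullet> v) = a"
  by (simp add: covector_def euclidean_representation)

context
  fixes Q :: "('a, 'e::euclidean_space) mfd"
  assumes Q: "smooth_atlas Q"
begin

lemma beta0_functional:
  assumes c: "c \<in> charts Q" and x: "((m, V), u) \<in> cdom (HM_R_chart Q c)"
  shows "- ext_d (phase Q) (eta Q) m V W - u * eta Q m W
    = snd (beta0_loc (cmap (HM_R_chart Q c) ((m, V), u))) \<bullet> to_coords (phase Q) (phase_chart Q c) m W"
proof -
  have m: "m \<in> cdom (phase_chart Q c)" using x by simp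
  show ?thesis
    unfolding ext_d_eta[OF Q c m] eta_to_coords[OF Q c m, of W]
    by (simp add: beta0_loc_def HM_R_chart_drop hm_drop_def inner_prod_def inner_add_left inner_commute
        algebra_simps del: phase_simps)
qed

text \<open>\<open>beta0\<close> is chart-free, so its momenta in any induced chart are found by
  writing the defining functional as a pairing with the components of W.\<close>

lemma beta0_chart:
  assumes c: "c \<in> charts Q" and x: "x \<in> cdom (HM_R_chart Q c)"
  shows "cmap (cotangent_chart (phase Q) (phase_chart Q c)) (beta0 Q x) = beta0_loc (cmap (HM_R_chart Q c) x)"
proof -
  obtain m V u where x': "x = ((m, V), u)" by (metis surj_pair)
  have m: "m \<in> cdom (phase_chart Q c)" using x by (simp add: x')
  have pc: "phase_chart Q c \<in> charts (phase Q)" using c by simp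
  let ?\<xi> = "snd (beta0_loc (cmap (HM_R_chart Q c) x))"
  let ?f = "\<lambda>W. - ext_d (phase Q) (eta Q) m V W - u * eta Q m W"
  note f = beta0_functional[OF c x[unfolded x'], folded x']
  have lin: "linear ?f"
    unfolding f using linear_compose[OF linear_to_coords[OF smooth_atlas_phase[OF Q] pc m]
        bounded_linear.linear[OF bounded_linear_inner_right[of ?\<xi>]]] by (simp add: o_def)
  have "covector (\<lambda>W. ?f (from_coords (phase Q) (phase_chart Q c) m W)) = ?\<xi>"
    unfolding f to_coords_from_coords_self[OF smooth_atlas_phase[OF Q] pc m] by simp
  moreover have "fst (beta0_loc (cmap (HM_R_chart Q c) x)) = cmap (phase_chart Q c) m"
    by (simp add: beta0_loc_def hm_base_def HM_R_chart_drop hm_drop_def x' del: phase_simps)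
  ultimately show ?thesis
    using cotangent_chart_covector[OF smooth_atlas_phase[OF Q] pc m lin]
    by (simp add: beta0_def x' prod_eq_iff del: cotangent_simps phase_simps)
qed

lemma cotangent_phase_chart_image:
  assumes "c \<in> charts Q"
  shows "cmap (cotangent_chart (phase Q) (phase_chart Q c)) ` cdom (cotangent_chart (phase Q) (phase_chart Q c))
    = ((cmap c ` cdom c \<times> UNIV) \<times> UNIV) \<times> UNIV"
  using cotangent_chart_overlap[OF smooth_atlas_phase[OF Q], of "phase_chart Q c" "phase_chart Q c"]
    phase_chart_image[OF Q assms] assms by simp

lemma diffeo_beta0: "diffeo (HM_R Q) (cotangent (phase Q)) (beta0 Q)"
proof (rule diffeo_chartwise[OF smooth_atlas_HM_R[OF Q] smooth_atlas_cotangent[OF smooth_atlas_phase[OF Q]],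
      where I = "charts Q" and C = "HM_R_chart Q" and D = "\<lambda>c. cotangent_chart (phase Q) (phase_chart Q c)"
        and F = beta0_loc and G = beta0_inv])
  fix c assume c: "c \<in> charts Q"
  show "beta0 Q x \<in> cdom (cotangent_chart (phase Q) (phase_chart Q c)) \<longleftrightarrow> x \<in> cdom (HM_R_chart Q c)"
    if "x \<in> pts (HM_R Q)" for x
    using that by (cases x) (auto simp: beta0_def)
  show "beta0_loc ` cmap (HM_R_chart Q c) ` cdom (HM_R_chart Q c)
      = cmap (cotangent_chart (phase Q) (phase_chart Q c)) ` cdom (cotangent_chart (phase Q) (phase_chart Q c))"
    unfolding HM_R_chart_image[OF Q c] cotangent_phase_chart_image[OF c]
  proof (intro subset_antisym subsetI)
    fix Y :: "(('e \<times> 'e) \<times> real) \<times> (('e \<times> 'e) \<times> real)"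
    assume "Y \<in> ((cmap c ` cdom c \<times> UNIV) \<times> UNIV) \<times> UNIV"
    then have "beta0_inv Y \<in> cmap c ` cdom c \<times> UNIV" by (auto simp: beta0_inv_def)
    then show "Y \<in> beta0_loc ` (cmap c ` cdom c \<times> UNIV)" using beta0_loc_inv by (metis imageI)
  qed (auto simp: beta0_loc_def hm_base_def)
  show "cmap (cotangent_chart (phase Q) (phase_chart Q c)) (beta0 Q x) = beta0_loc (cmap (HM_R_chart Q c) x)"
    if "x \<in> cdom (HM_R_chart Q c)" for x using beta0_chart[OF c that] .
qed (simp_all add: image_image smooth_beta0_loc smooth_beta0_inv beta0_inv_loc)

text \<open>Shared by both maps. In preferred charts the target form is constant and
  \<open>omega_eta\<close> becomes \<open>omega_loc\<close>, so the pullback condition at x is an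
  algebraic identity for the derivative of F at one point of the model space.\<close>

lemma symplectic_diffeo_HM_R:
  fixes f :: "('a, 'e) hm_point \<Rightarrow> (('a \<times> 'e) \<times> real) \<times> (('e \<times> 'e) \<times> real)"
  assumes N: "smooth_atlas N" and f: "diffeo (HM_R Q) (cotangent N) f"
    and chart: "\<And>x w. x \<in> HM_R_set Q \<Longrightarrow> w \<in> cdom (pref (HM_R Q) x) \<Longrightarrow>
        cmap (pref (cotangent N) (f x)) (f w) = F (cmap (pref (HM_R Q) x) w)"
    and F: "\<And>y. (F has_derivative F' y) (at y)"
    and F': "\<And>y v w. snd (F' y w) \<bullet> fst (F' y v) - snd (F' y v) \<bullet> fst (F' y w) = omega_loc y v w"
  shows "symplectic_diffeo (HM_R Q) (omega_eta Q) (cotangent N) (canonical_form N) f"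
  unfolding symplectic_diffeo_def
proof (intro conjI f ballI ext)
  fix x v w assume x: "x \<in> pts (HM_R Q)"
  let ?y = "cmap (pref (HM_R Q) x) x"
  obtain n a where fx: "f x = (n, a)" by (metis surj_pair)
  have "f x \<in> pts (cotangent N)" using f x by (auto simp: diffeo_def bij_betw_def)
  then have n: "n \<in> pts N" by (simp add: fx)
  have "tangent_map (HM_R Q) (cotangent N) f x = F' ?y"
    by (rule tangent_map_eq[OF smooth_atlas_HM_R[OF Q] x chart F]) (use x in auto)
  then show "pullback2 (HM_R Q) (cotangent N) f (canonical_form N) x v w = omega_eta Q x v w"
    using omega_eta_eq[OF Q _ refl, of x v w] x by (simp add: pullback2_def fx canonical_form_eq[OF N n] F')
qed

lemma symplectic_diffeo_beta0:
  "symplectic_diffeo (HM_R Q) (omega_eta Q) (cotangent (phase Q)) (canonical_form (phase Q)) (beta0 Q)"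
proof (rule symplectic_diffeo_HM_R[OF smooth_atlas_phase[OF Q] diffeo_beta0 _ beta0_loc_has_derivative beta0_deriv_symplectic])
  fix x w assume x: "x \<in> HM_R_set Q" and w: "w \<in> cdom (pref (HM_R Q) x)"
  obtain q p z V u where x': "x = ((((q, p), z), V), u)" by (metis surj_pair)
  have "pref Q q \<in> charts Q" using x smooth_atlas_pref[OF Q] by (simp add: x')
  then show "cmap (pref (cotangent (phase Q)) (beta0 Q x)) (beta0 Q w) = beta0_loc (cmap (pref (HM_R Q) x) w)"
    using beta0_chart w by (simp add: x' beta0_def[of Q] del: cotangent_simps(4,5) HM_R_simps(5))
qed

section \<open>The map \<open>\<alpha>\<^sup>0\<close>\<close>

lemma velocity_chart_image:
  assumes "c \<in> charts Q"
  shows "cmap (velocity_chart Q c) ` cdom (velocity_chart Q c) = (cmap c ` cdom c \<times> UNIV) \<times> UNIV"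
  using prod_chart_overlap[of "tangent_chart Q c" real_chart "tangent_chart Q c" real_chart]
    tangent_chart_overlap[OF Q assms assms] by simp

lemma velocity_cotangent_chart_image:
  assumes "c \<in> charts Q"
  shows "cmap (velocity_cotangent_chart Q c) ` cdom (velocity_cotangent_chart Q c)
    = ((cmap c ` cdom c \<times> UNIV) \<times> UNIV) \<times> UNIV"
  using cotangent_chart_overlap[OF smooth_atlas_velocity[OF Q], of "velocity_chart Q c" "velocity_chart Q c"]
    velocity_chart_image[OF assms] assms by (simp add: velocity_cotangent_chart_def)

text \<open>\<open>alpha0\<close> is a preimage under a chart, and \<open>cinv\<close> is meaningful
  only on the chart image. That image is full over the domain of the chart of \<open>Q\<close>, so
  the coordinates can be read back, and injectivity recovers the base point q.\<close>

lemma alpha0_pref: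
  assumes x: "x \<in> HM_R_set Q" and x': "x = ((((q, p), z), ((dq, dp), dz)), u)"
  obtains a where "alpha0 Q x = (((q, dq), z), a)"
    "adjoint (from_coords (velocity Q) (velocity_chart Q (pref Q q)) ((q, dq), z)) a = ((u *\<^sub>R p + dp, p), - u)"
proof -
  have q: "q \<in> pts Q" using x by (simp add: x')
  let ?c = "pref Q q"
  have c: "?c \<in> charts Q" "q \<in> cdom ?c" using smooth_atlas_pref[OF Q q] by auto
  have y: "cmap (HM_R_chart Q ?c) x = (cmap ?c q, p, z, dq, dp, u)"
    by (rule HM_R_pref_cases[OF Q x]) (simp add: x')
  let ?Y = "alpha0_local (cmap (HM_R_chart Q ?c) x)"
  have Y: "?Y \<in> cmap (velocity_cotangent_chart Q ?c) ` cdom (velocity_cotangent_chart Q ?c)"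
    unfolding velocity_cotangent_chart_image[OF c(1)] y using c by (simp add: alpha0_local_def)
  have al: "alpha0 Q x = cinv (velocity_cotangent_chart Q ?c) ?Y"
    by (simp add: alpha0_def Let_def x')
  obtain q' v' z' a where a: "alpha0 Q x = (((q', v'), z'), a)" by (metis surj_pair)
  have "(((q', v'), z'), a) \<in> cdom (velocity_cotangent_chart Q ?c)"
    unfolding a[symmetric] al by (rule cinv_in_cdom[OF Y])
  then have q': "q' \<in> cdom ?c" by (simp add: velocity_cotangent_chart_def)
  have eq: "cmap (velocity_cotangent_chart Q ?c) (((q', v'), z'), a) = ?Y"
    using cmap_cinv[OF Y] by (simp add: al[symmetric] a)
  have "q' = q"
    using eq q' c smooth_atlas_chart[OF Q c(1)] unfolding y
    by (auto simp: velocity_cotangent_chart_def alpha0_local_def is_chart_def inj_on_def)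
  with eq to_coords_pref[OF Q q] have "v' = dq" "z' = z"
    "adjoint (from_coords (velocity Q) (velocity_chart Q ?c) ((q', v'), z')) a = ((u *\<^sub>R p + dp, p), - u)"
    unfolding y by (auto simp: velocity_cotangent_chart_def alpha0_local_def)
  then show ?thesis using that a \<open>q' = q\<close> by simp
qed

text \<open>Under a change of chart p-dot acquires a second derivative of the transition, contracted
  with p and q-dot; the covector on TQ \<times> \<real> acquires one too, from the Jacobian of the
  tangent chart. The two differ in the order of the directions and cancel by symmetry.\<close>

lemma alpha0_chart:
  assumes c: "c \<in> charts Q" and x: "x \<in> cdom (HM_R_chart Q c)"
  shows "alpha0 Q x \<in> cdom (velocity_cotangent_chart Q c)"
    "cmap (velocity_cotangent_chart Q c) (alpha0 Q x) = alpha0_local (cmap (HM_R_chart Q c) x)"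
proof -
  obtain q p z dq dp dz u where x': "x = ((((q, p), z), ((dq, dp), dz)), u)" by (metis surj_pair)
  have xH: "x \<in> HM_R_set Q" and q: "q \<in> cdom c" using x by (auto simp: x')
  have qQ: "q \<in> pts Q" using smooth_atlas_pts[OF Q c q] .
  obtain a where a: "alpha0 Q x = (((q, dq), z), a)"
    "adjoint (from_coords (velocity Q) (velocity_chart Q (pref Q q)) ((q, dq), z)) a = ((u *\<^sub>R p + dp, p), - u)"
    by (rule alpha0_pref[OF xH x'])
  show "alpha0 Q x \<in> cdom (velocity_cotangent_chart Q c)"
    using q by (simp add: a(1) velocity_cotangent_chart_def)
  let ?e = "pref Q q"
  have e: "?e \<in> charts Q" "q \<in> cdom ?e" using smooth_atlas_pref[OF Q qQ] by auto
  define J where "J = jacobian ?e c q"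
  define P where "P = adjoint (from_coords Q c q) p"
  define DP where "DP = snd (jacobian (cotangent_chart Q ?e) (cotangent_chart Q c) (q, p) (dq, dp))"
  \<comment> \<open>v is the direction of the inner derivative and w that of the outer one; the two
    sources of this term have dq in opposite slots.\<close>
  define D2 where "D2 = (\<lambda>v w. frechet_derivative (\<lambda>y. frechet_derivative (cmap c \<circ> cinv ?e) (at y) v) (at (cmap ?e q)) w)"
  have ad: "adjoint (from_coords Q ?e q) p = p"
    by (metis (no_types, lifting) inner_cotangent_coords[OF Q e] from_coords_pref[OF Q qQ] vector_eq_rdot)
  have hm: "cmap (HM_R_chart Q c) x = (cmap c q, P, z, J dq, DP, u)"
    using fst_jacobian_cotangent[OF Q e(1) c e(2) q]
    by (simp add: HM_R_chart_drop hm_drop_def x' to_coords_jacobian jacobian_phase[OF Q e(1) c e(2) q] P_def DP_def J_def)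
  have PJ: "P \<bullet> J v = p \<bullet> v" for v
    using inner_cotangent_coords_change[OF Q e(1) c e(2) q, of p v] by (simp add: P_def J_def ad)
  have DPJ: "DP \<bullet> J v + P \<bullet> D2 v dq = dp \<bullet> v" for v
    using snd_jacobian_cotangent[OF Q e(1) c e(2) q, of p "(dq, dp)" v] by (simp add: P_def J_def DP_def D2_def)
  have sym: "D2 v w = D2 w v" for v w
    unfolding D2_def
    by (rule frechet_derivative_symmetric[OF smooth_atlas_overlap[OF Q e(1) c]]) (use e q in auto)
  define T where "T = jacobian (velocity_chart Q ?e) (velocity_chart Q c) ((q, dq), z)"
  have T: "T W = ((J (fst (fst W)), D2 dq (fst (fst W)) + J (snd (fst W))), snd W)" for W
    unfolding T_def
    by (simp add: jacobian_velocity[OF Q e(1) c e(2) q] jacobian_tangent[OF Q e(1) c e(2) q]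
        to_coords_pref[OF Q qQ] J_def D2_def)
  let ?n = "((q, dq), z)"
  have V: "velocity_chart Q ?e \<in> charts (velocity Q)" "velocity_chart Q c \<in> charts (velocity Q)"
    "?n \<in> cdom (velocity_chart Q ?e)" "?n \<in> cdom (velocity_chart Q c)"
    using e c q by auto
  note AV = smooth_atlas_velocity[OF Q]
  \<comment> \<open>The Jacobian of a transition is onto, so a covector is determined by its values
    on all T W.\<close>
  have T_surj: "\<exists>W. T W = W'" for W'
    using jacobian_chart_chain[OF AV V(2,1,2,4,3,4), of W'] jacobian_self[OF smooth_atlas_chart[OF AV V(2)] V(4)]
    unfolding T_def by metis
  have "adjoint (from_coords (velocity Q) (velocity_chart Q c) ?n) a \<bullet> T W = ((u *\<^sub>R P + DP, P), - u) \<bullet> T W" for W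
  proof -
    have "adjoint (from_coords (velocity Q) (velocity_chart Q c) ?n) a \<bullet> T W = ((u *\<^sub>R p + dp, p), - u) \<bullet> W"
      unfolding T_def inner_cotangent_coords_change[OF AV V] a(2) ..
    also have "\<dots> = u * (p \<bullet> fst (fst W)) + dp \<bullet> fst (fst W) + p \<bullet> snd (fst W) - u * snd W"
      by (simp add: inner_prod_def inner_add_left)
    also have "\<dots> = ((u *\<^sub>R P + DP, P), - u) \<bullet> T W"
      using PJ[of "fst (fst W)"] PJ[of "snd (fst W)"] DPJ[of "fst (fst W)"] sym[of dq "fst (fst W)"]
      by (simp add: T inner_prod_def inner_add_left inner_add_right)
    finally show ?thesis .
  qed
  then have "adjoint (from_coords (velocity Q) (velocity_chart Q c) ?n) a = ((u *\<^sub>R P + DP, P), - u)"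
    using T_surj by (metis vector_eq_rdot)
  moreover have "to_coords Q c q dq = J dq" by (simp add: J_def to_coords_jacobian)
  ultimately show "cmap (velocity_cotangent_chart Q c) (alpha0 Q x) = alpha0_local (cmap (HM_R_chart Q c) x)"
    by (simp add: hm a(1) velocity_cotangent_chart_def alpha0_local_def)
qed

lemma alpha0_well_defined: "alpha0_well_defined Q"
  using alpha0_chart by (simp add: alpha0_well_defined_def del: HM_R_simps)

lemma diffeo_alpha0: "diffeo (HM_R Q) (cotangent (velocity Q)) (alpha0 Q)"
proof (rule diffeo_chartwise[OF smooth_atlas_HM_R[OF Q] smooth_atlas_cotangent[OF smooth_atlas_velocity[OF Q]],
      where I = "charts Q" and C = "HM_R_chart Q" and D = "velocity_cotangent_chart Q"
        and F = alpha0_local and G = alpha0_inv])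
  fix c assume c: "c \<in> charts Q"
  show "alpha0 Q x \<in> cdom (velocity_cotangent_chart Q c) \<longleftrightarrow> x \<in> cdom (HM_R_chart Q c)"
    if x: "x \<in> pts (HM_R Q)" for x
  proof -
    obtain q p z dq dp dz u where x': "x = ((((q, p), z), ((dq, dp), dz)), u)" by (metis surj_pair)
    have "x \<in> HM_R_set Q" using x by simp
    then obtain a where "alpha0 Q x = (((q, dq), z), a)"
      by (rule alpha0_pref[OF _ x'])
    then show ?thesis using x by (simp add: x' velocity_cotangent_chart_def)
  qed
  show "alpha0_local ` cmap (HM_R_chart Q c) ` cdom (HM_R_chart Q c)
      = cmap (velocity_cotangent_chart Q c) ` cdom (velocity_cotangent_chart Q c)"
    unfolding HM_R_chart_image[OF Q c] velocity_cotangent_chart_image[OF c]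
  proof (intro subset_antisym subsetI)
    fix Y :: "(('e \<times> 'e) \<times> real) \<times> (('e \<times> 'e) \<times> real)"
    assume "Y \<in> ((cmap c ` cdom c \<times> UNIV) \<times> UNIV) \<times> UNIV"
    then have "alpha0_inv Y \<in> cmap c ` cdom c \<times> UNIV" by (auto simp: alpha0_inv_def)
    then show "Y \<in> alpha0_local ` (cmap c ` cdom c \<times> UNIV)" using alpha0_local_inv by (metis imageI)
  qed (auto simp: alpha0_local_eq)
  show "cmap (velocity_cotangent_chart Q c) (alpha0 Q x) = alpha0_local (cmap (HM_R_chart Q c) x)"
    if "x \<in> cdom (HM_R_chart Q c)" for x using alpha0_chart(2)[OF c that] .
qed (simp_all add: velocity_cotangent_chart_in_charts smooth_alpha0_local smooth_alpha0_inv alpha0_inv_local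
      del: cotangent_simps(2))

lemma symplectic_diffeo_alpha0:
  "symplectic_diffeo (HM_R Q) (omega_eta Q) (cotangent (velocity Q)) (canonical_form (velocity Q)) (alpha0 Q)"
proof (rule symplectic_diffeo_HM_R[OF smooth_atlas_velocity[OF Q] diffeo_alpha0 _ alpha0_local_has_derivative alpha0_deriv_symplectic])
  fix x w assume x: "x \<in> HM_R_set Q" and w: "w \<in> cdom (pref (HM_R Q) x)"
  obtain q p z dq dp dz u where x': "x = ((((q, p), z), ((dq, dp), dz)), u)" by (metis surj_pair)
  obtain a where a: "alpha0 Q x = (((q, dq), z), a)"
    by (rule alpha0_pref[OF x x'])
  have "pref Q q \<in> charts Q" using x smooth_atlas_pref[OF Q] by (simp add: x')
  moreover have "pref (cotangent (velocity Q)) (alpha0 Q x) = velocity_cotangent_chart Q (pref Q q)"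
    by (simp add: a velocity_cotangent_chart_def)
  ultimately show "cmap (pref (cotangent (velocity Q)) (alpha0 Q x)) (alpha0 Q w) = alpha0_local (cmap (pref (HM_R Q) x) w)"
    using alpha0_chart(2) w by (simp add: x' del: HM_R_simps(5))
qed

lemma fst_alpha0:
  assumes x: "x \<in> HM_R_set Q"
  shows "fst (alpha0 Q x) = velocity_proj Q x"
proof -
  obtain q p z dq dp dz u where x': "x = ((((q, p), z), ((dq, dp), dz)), u)" by (metis surj_pair)
  have q: "q \<in> pts Q" using x by (simp add: x')
  obtain a where a: "alpha0 Q x = (((q, dq), z), a)"
    by (rule alpha0_pref[OF x x'])
  have "tangent_map (phase Q) Q (\<lambda>m. fst (fst m)) ((q, p), z) = (\<lambda>V. fst (fst V))"
    by (rule tangent_map_eq[OF smooth_atlas_phase[OF Q], where F = "\<lambda>V. fst (fst V)"])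
       (use q in \<open>auto intro!: derivative_eq_intros\<close>)
  then show ?thesis using a by (simp add: velocity_proj_def x')
qed

end

section \<open>Sections of \<open>HM \<times> \<real>\<close> given by evolution fields\<close>

lemma smooth_map_real_line_chart:
  assumes M: "smooth_atlas M" and H: "smooth_map M real_line H" and c: "c \<in> charts M"
  shows "smooth_on (cmap c ` cdom c) (H \<circ> cinv c)"
proof -
  have "smooth_on (cmap c ` (cdom c \<inter> H -` cdom real_chart)) (cmap real_chart \<circ> H \<circ> cinv c)"
    using H c unfolding smooth_map_def by simp
  then show ?thesis by (simp add: comp_def)
qed

text \<open>Naturality of H between charts of M and the only chart of the real line, whose Jacobian
  is the identity.\<close>

lemma differential_from_coords:
  assumes M: "smooth_atlas M" and H: "smooth_map M real_line H" and c: "c \<in> charts M" and p: "p \<in> cdom c"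
  shows "differential M H p (from_coords M c p v) = frechet_derivative (H \<circ> cinv c) (at (cmap c p)) v"
proof -
  let ?e = "pref M p"
  have e: "?e \<in> charts M" "p \<in> cdom ?e"
    using smooth_atlas_pref[OF M smooth_atlas_pts[OF M c p]] by auto
  have K: "((H \<circ> cinv d) has_derivative frechet_derivative (H \<circ> cinv d) (at (cmap d p))) (at (cmap d p))"
    if "d \<in> charts M" "p \<in> cdom d" for d
    using smooth_on_has_derivative[OF smooth_map_real_line_chart[OF M H that(1)]] that(2) by blast
  have R: "is_chart UNIV real_chart" "compatible real_chart real_chart"
    using smooth_atlas_chart[OF smooth_atlas_real_line] smooth_atlas_compatible[OF smooth_atlas_real_line] by auto
  have "frechet_derivative (H \<circ> cinv ?e) (at (cmap ?e p)) (jacobian c ?e p v)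
      = jacobian real_chart real_chart (H p) (frechet_derivative (H \<circ> cinv c) (at (cmap c p)) v)"
    by (rule jacobian_natural[OF smooth_atlas_chart[OF M c] smooth_atlas_compatible[OF M c e(1)] R p e(2) _
          K[OF c p] K[OF e]])
       (auto simp: smooth_atlas_cinv[OF M c] smooth_atlas_cinv[OF M e(1)])
  then show ?thesis
    using jacobian_self[OF R(1), of "H p"]
    by (simp add: differential_def tangent_map_def from_coords_jacobian comp_def)
qed

lemma linear_differential:
  assumes M: "smooth_atlas M" and H: "smooth_map M real_line H" and p: "p \<in> pts M"
  shows "linear (differential M H p)"
proof -
  have e: "pref M p \<in> charts M" "p \<in> cdom (pref M p)" using smooth_atlas_pref[OF M p] by auto
  have "differential M H p = frechet_derivative (H \<circ> cinv (pref M p)) (at (cmap (pref M p) p))"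
    using differential_from_coords[OF M H e] from_coords_pref[OF M p] by (simp add: fun_eq_iff)
  then show ?thesis
    using smooth_on_linear_frechet_derivative[OF smooth_map_real_line_chart[OF M H e(1)]] e(2) by simp
qed

lemma smooth_vfield_chart:
  assumes M: "smooth_atlas M" and X: "smooth_vfield M X" and c: "c \<in> charts M"
  shows "smooth_on (cmap c ` cdom c) (local_vfield M c X)"
proof -
  let ?f = "\<lambda>p. (p, X p)"
  have "smooth_on (cmap c ` (cdom c \<inter> ?f -` cdom (tangent_chart M c))) (cmap (tangent_chart M c) \<circ> ?f \<circ> cinv c)"
    using X c unfolding smooth_vfield_def smooth_map_def by simp
  moreover have "cdom c \<inter> ?f -` cdom (tangent_chart M c) = cdom c" by auto
  ultimately have "smooth_on (cmap c ` cdom c) (cmap (tangent_chart M c) \<circ> ?f \<circ> cinv c)"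
    by (simp only:)
  from smooth_on_snd[OF smooth_atlas_open[OF M c] this] show ?thesis
    by (simp add: local_vfield_def[abs_def] comp_def)
qed

text \<open>Source of charts outside the given atlas: a chart followed by a diffeomorphism of its
  image, with inverse \<Psi>, belongs to the maximal atlas. Slice charts are obtained in this
  way.\<close>

lemma chart_compose:
  assumes M: "smooth_atlas M" and c: "c \<in> charts M" and V: "open V" "\<Phi> ` cmap c ` cdom c = V"
    and \<Phi>: "smooth_on (cmap c ` cdom c) \<Phi>" and \<Psi>: "smooth_on V \<Psi>"
    and inv: "\<And>y. y \<in> cmap c ` cdom c \<Longrightarrow> \<Psi> (\<Phi> y) = y"
  shows "is_chart (pts M) (cdom c, \<Phi> \<circ> cmap c)" "d \<in> charts M \<Longrightarrow> compatible (cdom c, \<Phi> \<circ> cmap c) d"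
proof -
  let ?c = "(cdom c, \<Phi> \<circ> cmap c)"
  have C: "is_chart (pts M) c" by (rule smooth_atlas_chart[OF M c])
  have inj: "inj_on (\<Phi> \<circ> cmap c) (cdom c)"
  proof (rule inj_onI)
    fix p q assume pq: "p \<in> cdom c" "q \<in> cdom c" "(\<Phi> \<circ> cmap c) p = (\<Phi> \<circ> cmap c) q"
    have "\<Psi> (\<Phi> (cmap c p)) = \<Psi> (\<Phi> (cmap c q))" using pq(3) by (simp only: o_apply)
    then have "cmap c p = cmap c q" by (simp only: inv[OF imageI[OF pq(1)]] inv[OF imageI[OF pq(2)]])
    then show "p = q" using pq C by (auto simp: is_chart_def inj_on_def)
  qed
  then show chart: "is_chart (pts M) ?c"
    using C V by (auto simp: is_chart_def image_comp)
  assume d: "d \<in> charts M"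
  note o = smooth_atlas_overlap[OF M c d]
  note o' = smooth_atlas_overlap[OF M d c]
  define U where "U = (\<Phi> \<circ> cmap c) ` (cdom c \<inter> cdom d)"
  have cinv1: "cinv ?c ((\<Phi> \<circ> cmap c) p) = p" if "p \<in> cdom c" for p
    using cinv_cmap[OF chart, of p] that by simp
  \<comment> \<open>As a preimage of an open set under the continuous \<Psi>, U is open.\<close>
  have "U = \<Psi> -` (cmap c ` (cdom c \<inter> cdom d)) \<inter> V"
  proof (intro subset_antisym subsetI)
    fix y assume "y \<in> U"
    then show "y \<in> \<Psi> -` (cmap c ` (cdom c \<inter> cdom d)) \<inter> V"
      using inv V(2) by (auto simp: U_def)
  next
    fix y assume y: "y \<in> \<Psi> -` (cmap c ` (cdom c \<inter> cdom d)) \<inter> V"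
    then obtain p q where p: "p \<in> cdom c" "y = \<Phi> (cmap c p)" and q: "q \<in> cdom c" "q \<in> cdom d" "\<Psi> y = cmap c q"
      using V(2) by auto
    then have "cmap c p = cmap c q" using inv by simp
    then have "p = q" using p q C by (auto simp: is_chart_def inj_on_def)
    then show "y \<in> U" using p q by (auto simp: U_def)
  qed
  then have U: "open U"
    using continuous_on_open_vimage[OF V(1)] smooth_on_imp_continuous_on[OF \<Psi>] o(1) by blast
  have UV: "U \<subseteq> V" using V(2) by (auto simp: U_def)
  have 1: "smooth_on U (\<lambda>y. (cmap d \<circ> cinv c) (\<Psi> y))"
    by (rule smooth_on_compose[OF U o(1) smooth_on_subset[OF \<Psi> UV] o(2)]) (auto simp: U_def inv)
  have 2: "smooth_on U (cmap d \<circ> cinv ?c)"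
  proof (rule smooth_on_cong[OF U _ 1])
    fix y assume "y \<in> U"
    then obtain p where p: "p \<in> cdom c" "p \<in> cdom d" "y = (\<Phi> \<circ> cmap c) p" by (auto simp: U_def)
    have "\<Psi> y = cmap c p" using p inv by simp
    then show "(cmap d \<circ> cinv c) (\<Psi> y) = (cmap d \<circ> cinv ?c) y"
      using cinv1[OF p(1)] p by (simp add: smooth_atlas_cinv[OF M c])
  qed
  have 3: "smooth_on (cmap d ` (cdom d \<inter> cdom c)) (\<lambda>y. \<Phi> ((cmap c \<circ> cinv d) y))"
    by (rule smooth_on_compose[OF o'(1) smooth_atlas_open[OF M c] o'(2) \<Phi>])
       (auto simp: smooth_atlas_cinv[OF M d])
  show "compatible ?c d"
    using 2 3 U o'(1) by (simp add: compatible_def U_def Int_commute comp_def)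
qed

section \<open>Gradients and the model of the slices\<close>

definition gradient :: "('e::euclidean_space \<Rightarrow> real) \<Rightarrow> 'e \<Rightarrow> 'e" where
  "gradient K y = covector (frechet_derivative K (at y))"

lemma inner_gradient: "K differentiable at y \<Longrightarrow> gradient K y \<bullet> v = frechet_derivative K (at y) v"
  unfolding gradient_def by (rule inner_covector[OF linear_frechet_derivative])

lemma smooth_on_gradient:
  assumes "open S" "smooth_on S K"
  shows "smooth_on S (gradient K)"
  unfolding gradient_def[abs_def] covector_def
  by (intro smooth_on_sum smooth_on_scaleR smooth_on_const smooth_on_directional_derivative assms)

text \<open>Pairing with a fixed w turns the derivative of the gradient into an iterated directional
  derivative of K, to which the symmetry of second derivatives applies.\<close>

lemma gradient_symmetric:
  assumes "open S" "smooth_on S K" "x \<in> S"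
  shows "frechet_derivative (gradient K) (at x) v \<bullet> w = frechet_derivative (gradient K) (at x) w \<bullet> v"
proof -
  have *: "frechet_derivative (gradient K) (at x) v \<bullet> w
      = frechet_derivative (\<lambda>y. frechet_derivative K (at y) w) (at x) v" for v w
  proof -
    have "gradient K differentiable at x"
      by (rule smooth_on_differentiable[OF smooth_on_gradient[OF assms(1,2)] assms(3)])
    then have "frechet_derivative (gradient K) (at x) v \<bullet> w = frechet_derivative (\<lambda>y. gradient K y \<bullet> w) (at x) v"
      by (rule frechet_derivative_inner[symmetric])
    also have "frechet_derivative (\<lambda>y. gradient K y \<bullet> w) (at x)
        = frechet_derivative (\<lambda>y. frechet_derivative K (at y) w) (at x)"
      by (rule frechet_derivative_eqI[OF
            smooth_on_has_derivative[OF smooth_on_directional_derivative[OF assms(2)] assms(3)] assms(1,3)])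
         (rule inner_gradient[OF smooth_on_differentiable[OF assms(2)]])
    finally show ?thesis .
  qed
  show ?thesis unfolding * by (rule frechet_derivative_symmetric[OF assms])
qed

text \<open>The image of the zero section under \<open>beta0_inv\<close>: a linear subspace of the
  model of \<open>HM_R\<close>, although \<open>beta0_inv\<close> is quadratic.\<close>

definition zero_momentum :: "'e::euclidean_space hm_model set" where
  "zero_momentum = {y. hm_dq y = 0 \<and> hm_dp y = 0 \<and> hm_u y = 0}"

lemma subspace_zero_momentum: "subspace zero_momentum"
  by (auto simp: zero_momentum_def subspace_def)

lemma dim_zero_momentum:
  "2 * dim (zero_momentum :: 'e::euclidean_space hm_model set) = DIM('e hm_model)"
proof -
  let ?f = "\<lambda>x :: 'e \<times> 'e \<times> real. (fst x, fst (snd x), snd (snd x), 0 :: 'e, 0 :: 'e, 0 :: real)"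
  have "linear ?f" by (rule linearI) auto
  moreover have "inj ?f" by (auto simp: inj_on_def)
  ultimately have "dim (?f ` UNIV) = dim (UNIV :: ('e \<times> 'e \<times> real) set)"
    by (simp add: dim_image_eq)
  moreover have "y \<in> range ?f" if "y \<in> zero_momentum" for y
    by (rule range_eqI[of _ _ "(hm_q y, hm_p y, hm_z y)"])
       (use that in \<open>simp add: zero_momentum_def prod_eq_iff\<close>)
  then have "range ?f = zero_momentum"
    by (auto simp: zero_momentum_def)
  ultimately show ?thesis by (simp add: dim_UNIV)
qed

lemma beta0_inv_zero_momentum: "beta0_inv Y \<in> zero_momentum \<longleftrightarrow> snd Y = 0"
  by (auto simp: zero_momentum_def beta0_inv_def prod_eq_iff)

context
  fixes Q :: "('a, 'e::euclidean_space) mfd" and H \<epsilon>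
  assumes Q: "smooth_atlas Q"
    and H: "smooth_map (phase Q) real_line H"
    and \<epsilon>: "evolution_field (phase Q) (eta Q) d_dz H \<epsilon>"
begin

text \<open>Cartan's formula: \<open>L\<^sub>X \<eta> = \<iota>\<^sub>X d\<eta> + d(\<eta>(X))\<close>, and \<open>\<eta>(\<epsilon>\<^sub>H) = 0\<close>.\<close>

lemma lie_deriv_evolution:
  assumes m: "m \<in> pts (phase Q)"
  shows "lie_deriv (phase Q) \<epsilon> (eta Q) m W = ext_d (phase Q) (eta Q) m (\<epsilon> m) W"
proof -
  obtain q p z where m': "m = ((q, p), z)" "q \<in> pts Q" using m by auto
  let ?c = "pref Q q"
  let ?C = "phase_chart Q ?c"
  let ?y = "cmap ?C m"
  note AP = smooth_atlas_phase[OF Q]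
  have c: "?c \<in> charts Q" "?C \<in> charts (phase Q)" "m \<in> cdom ?C"
    using smooth_atlas_pref[OF Q m'(2)] m' by auto
  have prefm: "pref (phase Q) m = ?C" by (simp add: m')
  have open_C: "open (cmap ?C ` cdom ?C)" by (rule phase_chart_open[OF Q c(1)])
  let ?X = "local_vfield (phase Q) ?C \<epsilon>"
  define X' where "X' = frechet_derivative ?X (at ?y)"
  have X': "(?X has_derivative X') (at ?y)"
    unfolding X'_def using \<epsilon> c
    by (intro smooth_on_has_derivative[OF smooth_vfield_chart[OF AP _ c(2)]]) (auto simp: evolution_field_def)
  have Xy: "?X ?y = \<epsilon> m"
    using to_coords_pref[OF AP m] c by (simp add: local_vfield_def smooth_atlas_cinv[OF AP c(2,3)] prefm del: phase_simps)
  \<comment> \<open>This is \<eta>(X) in coordinates. It vanishes on the whole chart, so its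
    product-rule derivative expresses the term of the Lie derivative that contains derivatives of X
    through X itself.\<close>
  have "((\<lambda>y. snd (?X y) - snd (fst y) \<bullet> fst (fst (?X y))) has_derivative
      (\<lambda>W. snd (X' W) - (snd (fst ?y) \<bullet> fst (fst (X' W)) + snd (fst W) \<bullet> fst (fst (?X ?y))))) (at ?y)"
    by (auto intro!: derivative_eq_intros X')
  moreover have "((\<lambda>y. snd (?X y) - snd (fst y) \<bullet> fst (fst (?X y))) has_derivative (\<lambda>W. 0)) (at ?y)"
  proof (rule has_derivative_transform_within_open[OF has_derivative_const[of 0] open_C])
    fix y assume "y \<in> cmap ?C ` cdom ?C"
    then obtain n where n: "n \<in> cdom ?C" "y = cmap ?C n" by blast
    have "n \<in> pts (phase Q)" using smooth_atlas_pts[OF AP c(2) n(1)] .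
    then have "eta Q n (\<epsilon> n) = 0" using \<epsilon> by (simp add: evolution_field_def del: phase_simps)
    then show "0 = snd (?X y) - snd (fst y) \<bullet> fst (fst (?X y))"
      using eta_to_coords[OF Q c(1) n(1), of "\<epsilon> n"]
      by (simp add: n(2) local_vfield_def smooth_atlas_cinv[OF AP c(2) n(1)] del: phase_simps)
  qed (use c in blast)
  ultimately have "(\<lambda>W. snd (X' W) - (snd (fst ?y) \<bullet> fst (fst (X' W)) + snd (fst W) \<bullet> fst (fst (?X ?y)))) = (\<lambda>W. 0)"
    by (rule has_derivative_unique)
  \<comment> \<open>The right-hand side is the half of d\<eta>(\<epsilon>, W) that is missing from
    the derivative of the coefficients of \<eta> along \<epsilon>.\<close>
  from fun_cong[OF this, of W]
  have 0: "snd (X' W) - snd (fst ?y) \<bullet> fst (fst (X' W)) = snd (fst W) \<bullet> fst (fst (\<epsilon> m))"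
    unfolding Xy by simp
  have eta: "eta Q m (X' W) = snd (X' W) - snd (fst ?y) \<bullet> fst (fst (X' W))"
    using eta_from_coords[OF Q c(1,3), of "X' W"] from_coords_pref[OF AP m] by (simp add: prefm del: phase_simps)
  note D = frechet_derivative_at[OF local_form_eta_has_derivative[OF Q c(1,3)], symmetric]
  show ?thesis
    unfolding lie_deriv_def Let_def prefm D ext_d_eta_pref[OF Q m] X'_def[symmetric] eta 0 by simp
qed

text \<open>For V = \<epsilon> and u = R(H) the term -u \<eta> cancels the R(H) \<eta> in -i_V
  d\<eta> = -(dH - R(H) \<eta>).\<close>

lemma beta0_evolution_section:
  assumes m: "m \<in> pts (phase Q)"
  shows "beta0 Q (evolution_section Q H \<epsilon> m) = (m, covector (\<lambda>W. - differential (phase Q) H m W))"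
proof -
  have "lie_deriv (phase Q) \<epsilon> (eta Q) m W
      = differential (phase Q) H m W - differential (phase Q) H m (d_dz m) * eta Q m W" for W
    using \<epsilon> m unfolding evolution_field_def by blast
  then show ?thesis
    by (simp add: beta0_def evolution_section_def lie_deriv_evolution[OF m, symmetric])
qed

lemma evolution_section_HM_R: "m \<in> pts (phase Q) \<Longrightarrow> evolution_section Q H \<epsilon> m \<in> HM_R_set Q"
  using \<epsilon> by (simp add: evolution_section_def evolution_field_def del: phase_simps)

abbreviation (input) "image_section \<equiv> evolution_section Q H \<epsilon> ` pts (phase Q)"

text \<open>A point over m can only be the value of the section at m. Both \<open>beta0\<close> and
  the cotangent chart are injective, so equality with that value can be tested on momenta; this
  gives a coordinate equation for the image.\<close>

lemma image_section_chart:
  assumes c: "c \<in> charts Q" and x: "x \<in> cdom (HM_R_chart Q c)" and y: "y = cmap (HM_R_chart Q c) x"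
  shows "x \<in> image_section \<longleftrightarrow>
    snd (beta0_loc y) + gradient (H \<circ> cinv (phase_chart Q c)) (hm_base y) = 0"
proof -
  note AP = smooth_atlas_phase[OF Q]
  obtain m V u where x': "x = ((m, V), u)" by (metis surj_pair)
  have m: "m \<in> cdom (phase_chart Q c)" "phase_chart Q c \<in> charts (phase Q)" using x c by (auto simp: x')
  have mP: "m \<in> pts (phase Q)" by (rule smooth_atlas_pts[OF AP m(2,1)])
  let ?C = "cotangent_chart (phase Q) (phase_chart Q c)"
  let ?\<alpha> = "(m, covector (\<lambda>W. - differential (phase Q) H m W))"
  have base: "hm_base y = cmap (phase_chart Q c) m"
    by (simp add: y hm_base_def HM_R_chart_drop hm_drop_def x' del: phase_simps)
  have b: "cmap ?C (beta0 Q x) = (hm_base y, snd (beta0_loc y))"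
    using beta0_chart[OF Q c x] by (simp add: y beta0_loc_def del: cotangent_simps)
  have lin: "linear (\<lambda>W. - differential (phase Q) H m W)"
    using linear_differential[OF AP H mP] by (rule linear_compose_neg)
  have a: "cmap ?C ?\<alpha> = (hm_base y, - gradient (H \<circ> cinv (phase_chart Q c)) (hm_base y))"
    unfolding cotangent_chart_covector[OF AP m(2,1) lin] differential_from_coords[OF AP H m(2,1)] base
    by (simp add: gradient_def covector_def sum_negf)
  have dom: "beta0 Q x \<in> cdom ?C" "?\<alpha> \<in> cdom ?C" using m(1) by (simp_all add: x' beta0_def)
  have inj: "inj_on (cmap ?C) (cdom ?C)"
    using smooth_atlas_chart[OF smooth_atlas_cotangent[OF AP], of ?C] m(2) by (simp add: is_chart_def)
  have injb: "inj_on (beta0 Q) (HM_R_set Q)"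
    using diffeo_beta0[OF Q] by (simp add: diffeo_def bij_betw_def)
  have xH: "x \<in> HM_R_set Q" using x by simp
  have "x \<in> image_section \<longleftrightarrow> x = evolution_section Q H \<epsilon> m"
    using mP by (auto simp: x' evolution_section_def)
  also have "\<dots> \<longleftrightarrow> beta0 Q x = ?\<alpha>"
    using injb xH evolution_section_HM_R[OF mP] beta0_evolution_section[OF mP] by (metis inj_onD)
  also have "\<dots> \<longleftrightarrow> cmap ?C (beta0 Q x) = cmap ?C ?\<alpha>"
    by (rule inj_on_eq_iff[OF inj dom, symmetric])
  also have "\<dots> \<longleftrightarrow> snd (beta0_loc y) + gradient (H \<circ> cinv (phase_chart Q c)) (hm_base y) = 0"
    unfolding a b by (simp add: eq_neg_iff_add_eq_0)
  finally show ?thesis .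
qed

lemma smooth_on_gradient_base:
  assumes c: "c \<in> charts Q"
  shows "smooth_on (cmap c ` cdom c \<times> UNIV)
    (\<lambda>y. gradient (H \<circ> cinv (phase_chart Q c)) (hm_base y) :: ('e \<times> 'e) \<times> real)"
proof -
  note AP = smooth_atlas_phase[OF Q]
  have o: "open (cmap (phase_chart Q c) ` cdom (phase_chart Q c))" by (rule phase_chart_open[OF Q c])
  have U: "open (cmap c ` cdom c \<times> (UNIV :: ('e \<times> real \<times> 'e \<times> 'e \<times> real) set))"
    by (rule open_Times[OF smooth_atlas_open[OF Q c] open_UNIV])
  have "smooth_on (cmap (phase_chart Q c) ` cdom (phase_chart Q c)) (H \<circ> cinv (phase_chart Q c))"
    by (rule smooth_map_real_line_chart[OF AP H]) (use c in simp)
  moreover have "hm_base y \<in> cmap (phase_chart Q c) ` cdom (phase_chart Q c)"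
    if "y \<in> cmap c ` cdom c \<times> UNIV" for y
    unfolding phase_chart_image[OF Q c] using that by (auto simp: hm_base_def)
  moreover have "smooth_on (cmap c ` cdom c \<times> UNIV) hm_base"
    unfolding hm_base_def[abs_def] by (intro smooth_on_intros U)
  ultimately show ?thesis
    by (intro smooth_on_compose[OF U o _ smooth_on_gradient[OF o]])
qed

lemma slice_chart_image_section:
  assumes x: "x \<in> HM_R_set Q"
  shows "\<exists>c. x \<in> cdom c \<and> slice_chart (HM_R Q) image_section c zero_momentum"
proof -
  note AH = smooth_atlas_HM_R[OF Q]
  obtain q p z V u where x': "x = ((((q, p), z), V), u)" by (metis surj_pair)
  let ?c = "pref Q q"
  let ?C = "HM_R_chart Q ?c"
  have q: "q \<in> pts Q" using x by (simp add: x')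
  have c: "?c \<in> charts Q" "?C \<in> charts (HM_R Q)" "x \<in> cdom ?C"
    using smooth_atlas_pref[OF Q q] x by (auto simp: x')
  define U where "U = cmap ?c ` cdom ?c \<times> (UNIV :: ('e \<times> real \<times> 'e \<times> 'e \<times> real) set)"
  have U: "open U" unfolding U_def by (rule open_Times[OF smooth_atlas_open[OF Q c(1)] open_UNIV])
  have CU: "cmap ?C ` cdom ?C = U" unfolding U_def by (rule HM_R_chart_image[OF Q c(1)])
  define g where "g = (\<lambda>y. gradient (H \<circ> cinv (phase_chart Q ?c)) (hm_base y))"
  have g: "smooth_on U g" unfolding U_def g_def by (rule smooth_on_gradient_base[OF c(1)])
  \<comment> \<open>Go to the coordinates of \<open>beta0\<close>, translate the momenta, come back.
    The translation depends on the base coordinates only and keeps them, so subtracting the same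
    gradient undoes it.\<close>
  define \<Phi> where "\<Phi> = (\<lambda>y. beta0_inv (fst (beta0_loc y), snd (beta0_loc y) + g y))"
  define \<Psi> where "\<Psi> = (\<lambda>y. beta0_inv (fst (beta0_loc y), snd (beta0_loc y) - g y))"
  have base: "hm_base (beta0_inv (hm_base y, \<xi>)) = hm_base y" for y :: "'e hm_model" and \<xi>
    by (simp add: beta0_inv_def hm_base_def)
  have gb: "g (beta0_inv (hm_base y, \<xi>)) = g y" for y \<xi> by (simp add: g_def base)
  have fb: "fst (beta0_loc y) = hm_base y" for y :: "'e hm_model" by (simp add: beta0_loc_def)
  have inv: "\<Psi> (\<Phi> y) = y" "\<Phi> (\<Psi> y) = y" for y
    unfolding \<Phi>_def \<Psi>_def
    by (simp_all add: beta0_loc_inv fb gb)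
       (simp_all add: beta0_inv_loc flip: fb)
  have inU: "\<Phi> y \<in> U" "\<Psi> y \<in> U" if "y \<in> U" for y
    using that by (auto simp: \<Phi>_def \<Psi>_def U_def beta0_inv_def beta0_loc_def hm_base_def)
  have img: "\<Phi> ` cmap ?C ` cdom ?C = U"
    unfolding CU using inU inv by (metis (no_types, lifting) image_eqI image_subsetI subsetI subset_antisym)
  have smooth: "smooth_on U \<Phi>" "smooth_on U \<Psi>"
    unfolding \<Phi>_def \<Psi>_def
    by (rule smooth_on_compose[OF U open_UNIV _ smooth_beta0_inv[OF open_UNIV]];
        auto intro!: smooth_on_intros U g smooth_beta0_loc)+
  note cc = chart_compose[OF AH c(2) U img, unfolded CU, OF smooth inv(1)]
  have "slice_chart (HM_R Q) image_section (cdom ?C, \<Phi> \<circ> cmap ?C) zero_momentum"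
    unfolding slice_chart_def
  proof (intro conjI ballI cc subspace_zero_momentum)
    have *: "w \<in> image_section \<longleftrightarrow> (\<Phi> \<circ> cmap ?C) w \<in> zero_momentum" if w: "w \<in> cdom ?C" for w
      using image_section_chart[OF c(1) w refl] by (simp add: \<Phi>_def g_def beta0_inv_zero_momentum)
    show "cmap (cdom ?C, \<Phi> \<circ> cmap ?C) ` (cdom (cdom ?C, \<Phi> \<circ> cmap ?C) \<inter> image_section)
        = cmap (cdom ?C, \<Phi> \<circ> cmap ?C) ` cdom (cdom ?C, \<Phi> \<circ> cmap ?C) \<inter> zero_momentum"
      unfolding fst_conv snd_conv using * by blast
  qed
  then show ?thesis using c(3) by (intro exI[of _ "(cdom ?C, \<Phi> \<circ> cmap ?C)"]) simp
qed

text \<open>A vector tangent to the image is the velocity of a curve in it, namely a line segment in the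
  slice chart.\<close>

lemma subtangent_image_section:
  assumes x: "x \<in> image_section" and v: "v \<in> subtangent (HM_R Q) image_section x"
    and c: "c = pref Q (fst (fst (fst (fst x))))" and y: "y = cmap (HM_R_chart Q c) x"
  shows "snd (beta0_deriv y v)
    = - frechet_derivative (gradient (H \<circ> cinv (phase_chart Q c))) (at (hm_base y)) (hm_base v)"
proof -
  note AH = smooth_atlas_HM_R[OF Q] and AP = smooth_atlas_phase[OF Q]
  have xH: "x \<in> HM_R_set Q" using x evolution_section_HM_R by blast
  obtain q p z V u where x': "x = ((((q, p), z), V), u)" by (metis surj_pair)
  have q: "q \<in> pts Q" using xH by (simp add: x')
  have c': "c = pref Q q" by (simp add: c x')
  let ?C = "HM_R_chart Q c"
  have C: "c \<in> charts Q" "?C \<in> charts (HM_R Q)" "x \<in> cdom ?C" "q \<in> cdom c"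
    using smooth_atlas_pref[OF Q q] xH by (auto simp: x' c')
  \<comment> \<open>An arbitrary slice chart: all that is known of L is that it is a subspace which
    the image of the section fills in the coordinates of d.\<close>
  obtain d L where d: "x \<in> cdom d" "slice_chart (HM_R Q) image_section d L" "to_coords (HM_R Q) d x v \<in> L"
    using v by (auto simp: subtangent_def)
  have dch: "is_chart (pts (HM_R Q)) d" "compatible d ?C" "subspace L"
    and slice: "cmap d ` (cdom d \<inter> image_section) = cmap d ` cdom d \<inter> L"
    using d(2) C(2) unfolding slice_chart_def by auto
  define w where "w = jacobian ?C d x v"
  have w: "w \<in> L" using d(3) by (simp add: w_def to_coords_jacobian x' c')
  have Jw: "jacobian d ?C x w = v"
    unfolding w_def
    using jacobian_chain[OF smooth_atlas_chart[OF AH C(2)] dch(1) compatible_sym[OF dch(2)] dch(2) C(3) d(1) C(3)]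
      jacobian_self[OF smooth_atlas_chart[OF AH C(2)] C(3)] by metis
  define K where "K = H \<circ> cinv (phase_chart Q c)"
  \<comment> \<open>A defining function: by \<open>image_section_chart\<close> the image of the
    section is the zero set of E on this chart.\<close>
  define E where "E = (\<lambda>y. snd (beta0_loc y) + gradient K (hm_base y))"
  have oP: "open (cmap (phase_chart Q c) ` cdom (phase_chart Q c))" by (rule phase_chart_open[OF Q C(1)])
  have K: "smooth_on (cmap (phase_chart Q c) ` cdom (phase_chart Q c)) K"
    unfolding K_def by (rule smooth_map_real_line_chart[OF AP H]) (use C in simp)
  have yP: "hm_base y \<in> cmap (phase_chart Q c) ` cdom (phase_chart Q c)"
    unfolding phase_chart_image[OF Q C(1)] using C(4)
    by (simp add: y hm_base_def HM_R_chart_drop hm_drop_def x')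
  have hb: "(hm_base has_derivative hm_base) (at y)"
    unfolding hm_base_def[abs_def] by (auto intro!: derivative_eq_intros)
  have E: "(E has_derivative (\<lambda>v. snd (beta0_deriv y v) + frechet_derivative (gradient K) (at (hm_base y)) (hm_base v))) (at y)"
    unfolding E_def
    by (intro has_derivative_add has_derivative_snd beta0_loc_has_derivative
        has_derivative_compose[OF hb smooth_on_has_derivative[OF smooth_on_gradient[OF oP K] yP]])
  let ?U = "cmap d ` (cdom d \<inter> cdom ?C)"
  define \<gamma> where "\<gamma> = (\<lambda>t::real. cmap d x + t *\<^sub>R w)"
  have oU: "open ?U" using dch(2) by (simp add: compatible_def)
  have \<gamma>0: "\<gamma> 0 = cmap d x" by (simp add: \<gamma>_def)
  have "continuous_on UNIV \<gamma>" unfolding \<gamma>_def by (intro continuous_intros)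
  then have oT: "open (\<gamma> -` ?U)" using oU by (simp add: open_vimage)
  have \<gamma>': "(\<gamma> has_derivative (\<lambda>t. t *\<^sub>R w)) (at 0)"
    unfolding \<gamma>_def by (auto intro!: derivative_eq_intros)
  have "(cmap ?C \<circ> cinv d has_derivative jacobian d ?C x) (at (\<gamma> 0))"
    unfolding \<gamma>0 by (rule compatible_has_derivative[OF dch(2) d(1) C(3)])
  from has_derivative_compose[OF \<gamma>' this]
  have 1: "((\<lambda>t. (cmap ?C \<circ> cinv d) (\<gamma> t)) has_derivative (\<lambda>t. jacobian d ?C x (t *\<^sub>R w))) (at 0)" .
  have y0: "(cmap ?C \<circ> cinv d) (\<gamma> 0) = y" by (simp add: \<gamma>0 cinv_cmap[OF dch(1) d(1)] y)
  have "((\<lambda>t. E ((cmap ?C \<circ> cinv d) (\<gamma> t))) has_derivative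
      (\<lambda>t. snd (beta0_deriv y (jacobian d ?C x (t *\<^sub>R w)))
        + frechet_derivative (gradient K) (at (hm_base y)) (hm_base (jacobian d ?C x (t *\<^sub>R w))))) (at 0)"
    by (rule has_derivative_compose[OF 1]) (unfold y0, rule E)
  moreover have "((\<lambda>t. E ((cmap ?C \<circ> cinv d) (\<gamma> t))) has_derivative (\<lambda>t. 0)) (at 0)"
  proof (rule has_derivative_transform_within_open[OF has_derivative_const[of 0] oT])
    show "0 \<in> \<gamma> -` ?U" using \<gamma>0 d(1) C(3) by auto
    fix t assume "t \<in> \<gamma> -` ?U"
    then obtain r where r: "r \<in> cdom d" "r \<in> cdom ?C" "\<gamma> t = cmap d r" by auto
    \<comment> \<open>The segment starts in the subspace L and moves along w in L, so it stays in
      the slice, where E vanishes.\<close>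
    have "cmap d x \<in> L" using slice x d(1) by blast
    then have "\<gamma> t \<in> L" unfolding \<gamma>_def using dch(3) w by (simp add: subspace_add subspace_scale)
    then have "cmap d r \<in> cmap d ` (cdom d \<inter> image_section)" using slice r by auto
    then have "r \<in> image_section" using r(1) dch(1) by (auto simp: is_chart_def inj_on_def)
    then have "E (cmap ?C r) = 0"
      using image_section_chart[OF C(1) r(2) refl] by (simp add: E_def K_def)
    then show "0 = E ((cmap ?C \<circ> cinv d) (\<gamma> t))" by (simp add: r(3) cinv_cmap[OF dch(1) r(1)])
  qed
  ultimately have "(\<lambda>t::real. snd (beta0_deriv y (jacobian d ?C x (t *\<^sub>R w)))
        + frechet_derivative (gradient K) (at (hm_base y)) (hm_base (jacobian d ?C x (t *\<^sub>R w)))) = (\<lambda>t. 0)"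
    by (rule has_derivative_unique)
  from fun_cong[OF this, of 1] show ?thesis
    by (simp add: Jw K_def eq_neg_iff_add_eq_0)
qed

lemma lagrangian_image_section: "lagrangian_submanifold (HM_R Q) (omega_eta Q) image_section"
  unfolding lagrangian_submanifold_def
proof (intro conjI ballI exI)
  show "2 * dim (zero_momentum :: 'e hm_model set) = DIM('e hm_model)" by (rule dim_zero_momentum)
  show "submanifold (HM_R Q) (dim (zero_momentum :: 'e hm_model set)) image_section"
    unfolding submanifold_def
  proof (intro conjI ballI)
    show "image_section \<subseteq> pts (HM_R Q)" using evolution_section_HM_R by auto
    fix x assume "x \<in> image_section"
    then have "x \<in> HM_R_set Q" using evolution_section_HM_R by blast
    from slice_chart_image_section[OF this]
    show "\<exists>c L. x \<in> cdom c \<and> slice_chart (HM_R Q) image_section c L \<and> dim L = dim (zero_momentum :: 'e hm_model set)"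
      by blast
  qed
  fix x v w assume x: "x \<in> image_section" and v: "v \<in> subtangent (HM_R Q) image_section x"
    and w: "w \<in> subtangent (HM_R Q) image_section x"
  note AP = smooth_atlas_phase[OF Q]
  have xH: "x \<in> HM_R_set Q" using x evolution_section_HM_R by blast
  define c where "c = pref Q (fst (fst (fst (fst x))))"
  define y where "y = cmap (HM_R_chart Q c) x"
  obtain q p z V u where x': "x = ((((q, p), z), V), u)" by (metis surj_pair)
  have "q \<in> pts Q" using xH by (simp add: x')
  then have c: "c \<in> charts Q" "q \<in> cdom c" using smooth_atlas_pref[OF Q] by (auto simp: c_def x')
  let ?K = "H \<circ> cinv (phase_chart Q c)"
  have oP: "open (cmap (phase_chart Q c) ` cdom (phase_chart Q c))" by (rule phase_chart_open[OF Q c(1)])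
  have K: "smooth_on (cmap (phase_chart Q c) ` cdom (phase_chart Q c)) ?K"
    by (rule smooth_map_real_line_chart[OF AP H]) (use c in simp)
  have yP: "hm_base y \<in> cmap (phase_chart Q c) ` cdom (phase_chart Q c)"
    unfolding phase_chart_image[OF Q c(1)] using c(2)
    by (simp add: y_def hm_base_def HM_R_chart_drop hm_drop_def x')
  have "omega_eta Q x v w = omega_loc y v w"
    by (rule omega_eta_eq[OF Q xH]) (simp add: y_def c_def x')
  also have "\<dots> = 0"
    \<comment> \<open>The momentum part of each tangent vector is minus the Hessian of H applied to
      its base part, so the form becomes the difference of the Hessian taken in the two
      orders.\<close>
    unfolding beta0_deriv_symplectic[symmetric] subtangent_image_section[OF x v c_def y_def]
      subtangent_image_section[OF x w c_def y_def]
    using gradient_symmetric[OF oP K yP, of "hm_base v" "hm_base w"] by (simp add: beta0_deriv_def)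
  finally show "omega_eta Q x v w = 0" .
qed

end

theorem mainTheorem4:
  fixes Q :: "('a, 'e::euclidean_space) mfd"
  assumes "smooth_manifold Q"
  shows
    "reeb_field (phase Q) (eta Q) d_dz
   \<and> symplectic_diffeo (HM_R Q) (omega_eta Q)
       (cotangent (phase Q)) (canonical_form (phase Q)) (beta0 Q)
   \<and> alpha0_well_defined Q
   \<and> symplectic_diffeo (HM_R Q) (omega_eta Q)
       (cotangent (velocity Q)) (canonical_form (velocity Q)) (alpha0 Q)
   \<and> (\<forall>x\<in>pts (HM_R Q). fst (beta0 Q x) = base_point x)
   \<and> (\<forall>x\<in>pts (HM_R Q). fst (alpha0 Q x) = velocity_proj Q x)
   \<and> (\<forall>H \<epsilon>. smooth_map (phase Q) real_line H \<longrightarrow>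
         evolution_field (phase Q) (eta Q) d_dz H \<epsilon> \<longrightarrow>
         (\<forall>m\<in>pts (phase Q).
            beta0 Q (evolution_section Q H \<epsilon> m)
              = (m, covector (\<lambda>W. - differential (phase Q) H m W)))
         \<and> lagrangian_submanifold (HM_R Q) (omega_eta Q)
             (evolution_section Q H \<epsilon> ` pts (phase Q)))"
proof -
  have Q: "smooth_atlas Q" by (rule smooth_manifold_atlas[OF assms])
  have "fst (beta0 Q x) = base_point x" for x
    by (cases x) (auto simp: beta0_def base_point_def)
  then show ?thesis
    using reeb_field_d_dz[OF Q] symplectic_diffeo_beta0[OF Q] alpha0_well_defined[OF Q]
      symplectic_diffeo_alpha0[OF Q] fst_alpha0[OF Q] beta0_evolution_section[OF Q]
      lagrangian_image_section[OF Q] by (simp del: phase_simps)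
qed

end
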